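(* Let $d$ be a positive integer and let $G$ be a $2$-connected multigraph which contains the complete graph $K_{d+2}$ as a minor. Then $G$ has a $d$-dimensional injective super stable tensegrity realization.
   Context: A multigraph is a finite undirected graph that may contain parallel edges but no loops. A tensegrity in $\mathbb{R}^d$ is a triple $(G,\sigma,p)$ where $G$ is a multigraph, $\sigma:E(G)\to\{+,-\}$ is a sign function and $p:V(G)\to\mathbb{R}^d$ is a (not necessarily injective) point configuration; it is called a tensegrity realization of $G$. It is $d$-dimensional if the affine span of $p(V(G))$ has dimension $d$, and injective if $p$ is injective. Write $V(G)=\{1,\dots,n\}$ and let $\mathbf{e}_i$ be the $i$-th standard basis vector of $\mathbb{R}^n$. For $\omega:E(G)\to\mathbb{R}$, the weighted Laplacian is $L_{G,\omega}=\sum_{e\in E(G)}\omega(e)(\mathbf{e}_i-\mathbf{e}_j)(\mathbf{e}_i-\mathbf{e}_j)^\top$, where $i,j$ are the endpoints of $e$. The weight $\omega$ is an equilibrium stress of $(G,\sigma,p)$ if $\sum_{e\in E(G),\ e \text{ joins } i \text{ and } j}\omega(e)(p(j)-p(i))=0$ for every vertex $i$; it is strictly proper if $\sigma(e)\omega(e)>0$ for every edge $e$. A tensegrity $(G,\sigma,p)$ with $p:V(G)\to\mathbb{R}^d$ whose image affinely spans $\mathbb{R}^d$ is super stable if (i) there is a strictly proper equilibrium stress $\omega$ with $L_{G,\omega}$ positive semidefinite and $\dim\ker L_{G,\omega}=d+1$, and (ii) there is no nonzero symmetric $d\times d$ matrix $S$ with $(p(j)-p(i))^\top S(p(j)-p(i))=0$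 for every edge $ij\in E(G)$. $G$ has a $d$-dimensional (injective) super stable tensegrity realization if there exist such $\sigma$ and (injective) $p$ making $(G,\sigma,p)$ super stable. Minors are taken in the usual sense (deleting vertices and edges, contracting edges; loops arising from contraction are deleted). *)

theory Defs
  imports "HOL-Analysis.Analysis"
begin

section \<open>Multigraphs\<close>

text \<open>Edges are abstract objects, so that parallel edges are possible; \<open>ends\<close> gives the
  (unordered) set of endpoints of an edge.\<close>

record ('v, 'e) multigraph =
  verts :: "'v set"
  edges :: "'e set"
  ends :: "'e \<Rightarrow> 'v set"

definition multigraph :: "('v, 'e) multigraph \<Rightarrow> bool" where
  "multigraph G \<longleftrightarrow> finite (verts G) \<and> finite (edges G) \<and>
     (\<forall>e\<in>edges G. ends G e \<subseteq> verts G \<and> card (ends G e) = 2)"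

definition delete_vertex :: "('v, 'e) multigraph \<Rightarrow> 'v \<Rightarrow> ('v, 'e) multigraph" where
  "delete_vertex G v =
     \<lparr>verts = verts G - {v}, edges = {e \<in> edges G. v \<notin> ends G e}, ends = ends G\<rparr>"

definition delete_edge :: "('v, 'e) multigraph \<Rightarrow> 'e \<Rightarrow> ('v, 'e) multigraph" where
  "delete_edge G e = \<lparr>verts = verts G, edges = edges G - {e}, ends = ends G\<rparr>"

text \<open>Contraction of an edge joining \<open>u\<close> and \<open>v\<close>: the vertex \<open>v\<close> is merged into \<open>u\<close>. The
  contracted edge disappears, and so do the edges parallel to it, since they become loops.\<close>

definition contract :: "('v, 'e) multigraph \<Rightarrow> 'v \<Rightarrow> 'v \<Rightarrow> ('v, 'e) multigraph" where
  "contract G u v =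
     \<lparr>verts = verts G - {v},
      edges = {e \<in> edges G. ends G e \<noteq> {u, v}},
      ends = (\<lambda>e. (\<lambda>w. if w = v then u else w) ` ends G e)\<rparr>"

inductive reduces_to :: "('v, 'e) multigraph \<Rightarrow> ('v, 'e) multigraph \<Rightarrow> bool"
  for G :: "('v, 'e) multigraph" where
  refl: "reduces_to G G"
| del_vertex: "reduces_to G H \<Longrightarrow> v \<in> verts H \<Longrightarrow> reduces_to G (delete_vertex H v)"
| del_edge: "reduces_to G H \<Longrightarrow> e \<in> edges H \<Longrightarrow> reduces_to G (delete_edge H e)"
| contraction: "reduces_to G H \<Longrightarrow> e \<in> edges H \<Longrightarrow> ends H e = {u, v} \<Longrightarrow> u \<noteq> v \<Longrightarrow>
    reduces_to G (contract H u v)"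

definition isomorphic :: "('v, 'e) multigraph \<Rightarrow> ('w, 'f) multigraph \<Rightarrow> bool" where
  "isomorphic G H \<longleftrightarrow> (\<exists>f g. bij_betw f (verts G) (verts H) \<and> bij_betw g (edges G) (edges H) \<and>
     (\<forall>e\<in>edges G. ends H (g e) = f ` ends G e))"

definition has_minor :: "('v, 'e) multigraph \<Rightarrow> ('w, 'f) multigraph \<Rightarrow> bool" where
  "has_minor G H \<longleftrightarrow> (\<exists>G'. reduces_to G G' \<and> isomorphic G' H)"

definition complete_graph :: "nat \<Rightarrow> (nat, nat set) multigraph" where
  "complete_graph n = \<lparr>verts = {..<n}, edges = {A. A \<subseteq> {..<n} \<and> card A = 2}, ends = (\<lambda>A. A)\<rparr>"

definition connected_multigraph :: "('v, 'e) multigraph \<Rightarrow> bool" where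
  "connected_multigraph G \<longleftrightarrow> verts G \<noteq> {} \<and>
     (\<forall>u\<in>verts G. \<forall>v\<in>verts G. (u, v) \<in> {(x, y). \<exists>e\<in>edges G. ends G e = {x, y}}\<^sup>*)"

definition two_connected :: "('v, 'e) multigraph \<Rightarrow> bool" where
  "two_connected G \<longleftrightarrow> 3 \<le> card (verts G) \<and> connected_multigraph G \<and>
     (\<forall>v\<in>verts G. connected_multigraph (delete_vertex G v))"


section \<open>Tensegrities\<close>

text \<open>The dimension \<open>d\<close> is \<open>CARD('d)\<close>. The values of \<open>\<sigma>\<close> and \<open>p\<close> outside the edge set,
  respectively the vertex set, are irrelevant.\<close>

datatype sign = Plus | Minus

fun sign_value :: "sign \<Rightarrow> real" where
  "sign_value Plus = 1"
| "sign_value Minus = -1"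

text \<open>\<open>edge_matrix {i, j}\<close> is the matrix $(e_i - e_j)(e_i - e_j)^T$. It does not depend on the order
  in which the two endpoints are chosen; see \<open>edge_matrix_eq\<close> below.\<close>

definition edge_matrix :: "'v::finite set \<Rightarrow> real^'v^'v" where
  "edge_matrix A = (let (i, j) = (SOME (i, j). A = {i, j}); x = axis i 1 - axis j 1
     in (columnvector x :: real^1^'v) ** (rowvector x :: real^'v^1))"

lemma edge_matrix_eq:
  "edge_matrix {i, j} =
     (columnvector (axis i 1 - axis j 1) :: real^1^'v::finite) **
     (rowvector (axis i 1 - axis j 1) :: real^'v^1)"
proof -
  obtain a b where ab: "(SOME (a, b). {i, j} = {a, b}) = (a, b)"
    by (metis surj_pair)
  have "case (SOME (a, b). {i, j} = {a, b}) of (a, b) \<Rightarrow> {i, j} = {a, b}"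
    by (rule someI[where x = "(i, j)"]) simp
  then have "{i, j} = {a, b}"
    by (simp add: ab)
  then consider "a = i" "b = j" | "a = j" "b = i"
    by (metis doubleton_eq_iff)
  then show ?thesis
    by cases (simp_all add: edge_matrix_def ab matrix_matrix_mult_def columnvector_def
        rowvector_def vec_eq_iff algebra_simps)
qed

text \<open>The vertex set is a subset of the finite type \<open>'v\<close>. The Laplacian is written as a matrix
  indexed by all of \<open>'v\<close>, whose rows and columns outside \<open>verts G\<close> vanish; hence positive
  semidefiniteness is unaffected, whereas the kernel has to be taken inside the coordinate subspace
  of the vectors supported on \<open>verts G\<close>.\<close>

definition laplacian :: "('v::finite, 'e) multigraph \<Rightarrow> ('e \<Rightarrow> real) \<Rightarrow> real^'v^'v" where
  "laplacian G \<omega> = (\<Sum>e\<in>edges G. \<omega> e *\<^sub>R edge_matrix (ends G e))"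

definition laplacian_kernel :: "('v::finite, 'e) multigraph \<Rightarrow> ('e \<Rightarrow> real) \<Rightarrow> (real^'v) set" where
  "laplacian_kernel G \<omega> = {x. (\<forall>i. i \<notin> verts G \<longrightarrow> x $ i = 0) \<and> laplacian G \<omega> *v x = 0}"

definition positive_semidefinite :: "real^'n^'n \<Rightarrow> bool" where
  "positive_semidefinite A \<longleftrightarrow> transpose A = A \<and> (\<forall>x. 0 \<le> x \<bullet> (A *v x))"

definition equilibrium_stress ::
    "('v, 'e) multigraph \<Rightarrow> ('v \<Rightarrow> real^'d) \<Rightarrow> ('e \<Rightarrow> real) \<Rightarrow> bool" where
  "equilibrium_stress G p \<omega> \<longleftrightarrow> (\<forall>i\<in>verts G.
     (\<Sum>j\<in>verts G. \<Sum>e\<in>{e \<in> edges G. ends G e = {i, j}}. \<omega> e *\<^sub>R (p j - p i)) = 0)"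

definition strictly_proper ::
    "('v, 'e) multigraph \<Rightarrow> ('e \<Rightarrow> sign) \<Rightarrow> ('e \<Rightarrow> real) \<Rightarrow> bool" where
  "strictly_proper G \<sigma> \<omega> \<longleftrightarrow> (\<forall>e\<in>edges G. sign_value (\<sigma> e) * \<omega> e > 0)"

definition super_stable ::
    "('v::finite, 'e) multigraph \<Rightarrow> ('e \<Rightarrow> sign) \<Rightarrow> ('v \<Rightarrow> real^'d) \<Rightarrow> bool" where
  "super_stable G \<sigma> p \<longleftrightarrow>
     affine hull (p ` verts G) = UNIV \<and>
     (\<exists>\<omega>. equilibrium_stress G p \<omega> \<and> strictly_proper G \<sigma> \<omega> \<and>
        positive_semidefinite (laplacian G \<omega>) \<and>
        dim (laplacian_kernel G \<omega>) = CARD('d) + 1) \<and>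
     \<not> (\<exists>S :: real^'d^'d. S \<noteq> 0 \<and> transpose S = S \<and>
        (\<forall>e\<in>edges G. \<forall>i j. ends G e = {i, j} \<longrightarrow> (p j - p i) \<bullet> (S *v (p j - p i)) = 0))"

end

theory Submission
  imports Defs
begin

text \<open>
  A stress \<open>c\<close> with positive semidefinite Laplacian of corank \<open>d + 1\<close> is the same thing as vectors
  \<open>b i\<close> of rank \<open>n - (d + 1)\<close> with sum 0 and \<open>b i \<bullet> b j = - c i j\<close> for \<open>i \<noteq> j\<close>, so that the Laplacian
  is their Gram matrix; the points \<open>p i\<close> form the Gale dual of the vectors \<open>b i\<close>. In this language \<open>p\<close>
  is injective iff no functional takes the values 1 and -1 at two of the \<open>b i\<close> and 0 at the others, and
  the conic condition is the Strong Arnold Property: a symmetric matrix \<open>N\<close> supported on the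
  nonadjacent pairs with \<open>\<Sum>j. N i j * b j\<close> independent of \<open>i\<close> vanishes.

  Such vectors are built by undoing contractions. Extend the branch sets of the minor to a partition of
  the vertices; as long as some class is not a singleton, it contains an edge \<open>uv\<close> whose contraction
  keeps the graph 2-connected. On \<open>d + 2\<close> vertices the graph is complete and rank 1 suffices. To split
  a vertex into \<open>u\<close> and \<open>v\<close>, let \<open>b v\<close> be a long vector in a new direction \<open>e\<close>, subtract almost the
  same vector from \<open>b u\<close>, and correct the neighbours of \<open>v\<close> by small multiples of \<open>e\<close>. This spoils the
  orthogonality relations only slightly, and the Strong Arnold Property allows to repair them by a small
  perturbation. Everything required is an open condition, except that the points at \<open>u\<close> and \<open>v\<close>
  coincide in the limit; they separate as soon as the edges going to \<open>v\<close> are not in equilibrium by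
  themselves. Therefore the induction also carries along that no proper nonempty part of the star of a
  vertex is in equilibrium, and the common edges of \<open>u\<close> and \<open>v\<close> are divided generically.
\<close>

section \<open>Limits and generic choices\<close>

text \<open>The multiples of \<open>e\<close> give all products with the two new vectors the right
  zero pattern; the only damage is an extra term \<open>\<rho>\<^sup>2 * a i * a j\<close> for pairs
  of neighbours of \<open>v\<close>. It would put stress on nonadjacent pairs, so it is cancelled in
  advance: the vectors of the contracted graph are moved to solutions of relations that already
  contain this term, with \<open>\<rho>\<^sup>2\<close> as one more unknown. The Strong Arnold
  Property says that no Lagrange multiplier obstructs these equations, so an open mapping argument
  gives solutions with arbitrarily small positive \<open>\<rho>\<^sup>2\<close>. Apart from
  nonvanishing products, every other requirement says that a vector is not in the row space of the
  configuration, or that a linear map is injective. Suitably rescaled by \<open>\<rho>\<close>, it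
  becomes a condition on the contracted graph with a limit as \<open>\<rho>\<close> tends to 0; the
  limit is checked and the condition transferred back. Nonmembership is stable only if the rank does
  not rise, so the perturbation stays in the old span and \<open>e\<close> is the only new
  dimension.\<close>

lemma eventually_inj_on_subspace:
  fixes T :: "nat \<Rightarrow> 'a::euclidean_space \<Rightarrow> 'b::euclidean_space"
  assumes S: "subspace S" and lin0: "linear T0" and lin: "\<And>m. linear (T m)"
    and lim: "\<And>x. (\<lambda>m. T m x) \<longlonglongrightarrow> T0 x"
    and inj: "\<And>x. x \<in> S \<Longrightarrow> T0 x = 0 \<Longrightarrow> x = 0"
  shows "\<forall>\<^sub>F m in sequentially. \<forall>x\<in>S. T m x = 0 \<longrightarrow> x = 0"
proof -
  obtain \<delta> where \<delta>: "\<delta> > 0" "\<And>x. x \<in> S \<Longrightarrow> \<delta> * norm x \<le> norm (T0 x)"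
    using injective_imp_isometric[of S T0] S lin0 inj
    by (metis closed_subspace linear_conv_bounded_linear mult.commute)
  \<comment> \<open>The sum over the basis bounds the operator norm of \<open>T m - T0\<close>. Once
    it is below the constant \<open>\<delta>\<close> that bounds \<open>T0\<close> from below on
    \<open>S\<close>, no kernel is left.\<close>
  have "(\<lambda>m. \<Sum>k\<in>Basis. norm (T m k - T0 k)) \<longlonglongrightarrow> (\<Sum>k\<in>(Basis::'a set). norm (T0 k - T0 k))"
    by (intro tendsto_intros lim)
  then have "(\<lambda>m. \<Sum>k\<in>(Basis::'a set). norm (T m k - T0 k)) \<longlonglongrightarrow> 0"
    by simp
  then have "\<forall>\<^sub>F m in sequentially. (\<Sum>k\<in>(Basis::'a set). norm (T m k - T0 k)) < \<delta>"
    using \<delta>(1) by (rule order_tendstoD)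
  then show ?thesis
  proof eventually_elim
    case (elim m)
    have "x = 0" if x: "x \<in> S" "T m x = 0" for x
    proof (rule ccontr)
      assume "x \<noteq> 0"
      have l: "linear (\<lambda>x. T m x - T0 x)"
        using lin lin0 by (rule linear_compose_sub)
      have "T m x - T0 x = (\<Sum>k\<in>Basis. (x \<bullet> k) *\<^sub>R (T m k - T0 k))"
        by (subst (1 2) euclidean_representation[symmetric, of x])
          (simp add: linear_sum[OF lin] linear_sum[OF lin0] linear_cmul[OF lin] linear_cmul[OF lin0]
            scaleR_right_diff_distrib sum_subtractf)
      then have "norm (T0 x) = norm (\<Sum>k\<in>Basis. (x \<bullet> k) *\<^sub>R (T m k - T0 k))"
        using x by (metis diff_0 norm_minus_cancel)
      also have "\<dots> \<le> (\<Sum>k\<in>Basis. norm x * norm (T m k - T0 k))"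
        by (rule sum_norm_le) (simp add: Basis_le_norm mult_right_mono)
      also have "\<dots> < norm x * \<delta>"
        using elim \<open>x \<noteq> 0\<close> by (simp add: sum_distrib_left[symmetric])
      finally show False
        using \<delta>(2)[OF x(1)] by (simp add: mult.commute)
    qed
    then show ?case by blast
  qed
qed

text \<open>The row space of the matrix with columns \<open>b l\<close>, read only on
  \<open>I\<close>; entries outside \<open>I\<close> are free. If the vectors sum to 0 over
  \<open>V\<close> and \<open>I = V - {j}\<close>, the entry at \<open>j\<close> is determined by
  the others, and the completed vectors are the affine dependencies of the Gale dual points. Hence
  \<open>axis i 1\<close> belongs to it iff the points at \<open>i\<close> and \<open>j\<close>
  coincide, and a vector of stresses on edges at \<open>j\<close> belongs to it iff these edges
  alone are in equilibrium at \<open>j\<close>.\<close>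

definition profiles :: "('v::finite \<Rightarrow> 'a::euclidean_space) \<Rightarrow> 'v set \<Rightarrow> (real^'v) set" where
  "profiles b I = {\<phi>. \<exists>y. \<forall>l\<in>I. y \<bullet> b l = \<phi> $ l}"

lemma subspace_profiles: "subspace (profiles b I)"
proof (rule subspaceI)
  show "0 \<in> profiles b I"
    by (auto simp: profiles_def intro!: exI[of _ 0])
  fix x y assume "x \<in> profiles b I" "y \<in> profiles b I"
  then obtain x' y' where "\<forall>l\<in>I. x' \<bullet> b l = x $ l" "\<forall>l\<in>I. y' \<bullet> b l = y $ l"
    by (auto simp: profiles_def)
  then show "x + y \<in> profiles b I"
    by (auto simp: profiles_def inner_add_left intro!: exI[of _ "x' + y'"])
next
  fix x c assume "x \<in> profiles b I"
  then obtain x' where "\<forall>l\<in>I. x' \<bullet> b l = x $ l"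
    by (auto simp: profiles_def)
  then show "c *\<^sub>R x \<in> profiles b I"
    by (auto simp: profiles_def intro!: exI[of _ "c *\<^sub>R x'"])
qed

lemma orthogonal_span_eq_0:
  fixes y :: "'a::real_inner"
  assumes "y \<in> span S" "\<And>x. x \<in> S \<Longrightarrow> y \<bullet> x = 0"
  shows "y = 0"
proof -
  have "orthogonal y y"
    by (rule orthogonal_to_span[OF assms(1)]) (simp add: orthogonal_def assms(2))
  then show ?thesis
    by (simp add: orthogonal_self)
qed

text \<open>Homogenization turns nonmembership into injectivity: in the limit, no pair
  \<open>(z, c)\<close> other than 0 satisfies \<open>z \<bullet> b l = c * \<phi>0 $ l\<close> on
  \<open>I\<close> with \<open>z\<close> in the span. The vectors \<open>b' m l\<close> have to stay
  in the span of the limit vectors, because a rank that is larger along the sequence would enlarge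
  the row space.\<close>

lemma eventually_notin_profiles:
  fixes b :: "'v::finite \<Rightarrow> 'a::euclidean_space"
  assumes lim: "\<And>l. l \<in> I \<Longrightarrow> (\<lambda>m. b' m l) \<longlonglongrightarrow> b l"
    and sp: "\<And>m l. l \<in> I \<Longrightarrow> b' m l \<in> span (b ` I)"
    and limf: "\<And>l. l \<in> I \<Longrightarrow> (\<lambda>m. \<phi> m $ l) \<longlonglongrightarrow> \<phi>0 $ l"
    and nr: "\<phi>0 \<notin> profiles b I"
  shows "\<forall>\<^sub>F m in sequentially. \<phi> m \<notin> profiles (b' m) I"
proof -
  define S where "S = span (b ` I) \<times> (UNIV :: real set)"
  define T where "T = (\<lambda>m (z, c). (\<chi> l. if l \<in> I then z \<bullet> b' m l - c * \<phi> m $ l else 0) :: real^'v)"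
  define T0 where "T0 = (\<lambda>(z, c). (\<chi> l. if l \<in> I then z \<bullet> b l - c * \<phi>0 $ l else 0) :: real^'v)"
  have "\<forall>\<^sub>F m in sequentially. \<forall>x\<in>S. T m x = 0 \<longrightarrow> x = 0"
  proof (rule eventually_inj_on_subspace[of S T0])
    show "subspace S"
      unfolding S_def by (intro subspace_Times) auto
    show "linear T0"
      by (rule linearI) (auto simp: T0_def vec_eq_iff inner_add_left algebra_simps)
    show "linear (T m)" for m
      by (rule linearI) (auto simp: T_def vec_eq_iff inner_add_left algebra_simps)
    show "(\<lambda>m. T m x) \<longlonglongrightarrow> T0 x" for x
    proof (cases x)
      case (Pair z c)
      have "(\<lambda>m. if l \<in> I then z \<bullet> b' m l - c * \<phi> m $ l else 0) \<longlonglongrightarrow>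
         (if l \<in> I then z \<bullet> b l - c * \<phi>0 $ l else 0)" for l
        by (cases "l \<in> I") (auto intro!: tendsto_intros lim limf)
      then show ?thesis
        by (auto simp: T_def T0_def Pair intro!: vec_tendstoI)
    qed
    show "x = 0" if "x \<in> S" "T0 x = 0" for x
    proof (cases x)
      case (Pair z c)
      have eq: "\<And>l. l \<in> I \<Longrightarrow> z \<bullet> b l = c * \<phi>0 $ l"
        using that(2) by (auto simp: Pair T0_def vec_eq_iff split: if_splits)
      have "c = 0"
      proof (rule ccontr)
        assume "c \<noteq> 0"
        then have "\<forall>l\<in>I. (z /\<^sub>R c) \<bullet> b l = \<phi>0 $ l"
          using eq by (simp add: field_simps)
        then have "\<phi>0 \<in> profiles b I"
          unfolding profiles_def mem_Collect_eq by (rule exI)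
        then show False
          using nr by contradiction
      qed
      moreover have "z = 0"
        using that(1) eq \<open>c = 0\<close> by (auto simp: Pair S_def intro!: orthogonal_span_eq_0[of z "b ` I"])
      ultimately show ?thesis
        by (simp add: Pair zero_prod_def)
    qed
  qed
  then show ?thesis
  proof eventually_elim
    case (elim m)
    show ?case
    proof
      assume "\<phi> m \<in> profiles (b' m) I"
      then obtain y where y: "\<forall>l\<in>I. y \<bullet> b' m l = \<phi> m $ l"
        by (auto simp: profiles_def)
      \<comment> \<open>Only the component of \<open>y\<close> in the span is seen by the vectors
        \<open>b' m l\<close>; paired with the number 1 it would be a nonzero kernel
        element.\<close>
      obtain z z' where z: "z \<in> span (b ` I)" "\<And>w. w \<in> span (b ` I) \<Longrightarrow> orthogonal z' w" "y = z + z'"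
        using orthogonal_subspace_decomp_exists[of "b ` I" y] by metis
      have "T m (z, 1) = 0"
        using y z sp by (auto simp: T_def vec_eq_iff inner_add_left orthogonal_def)
      then have "(z, 1::real) = 0"
        using elim z(1) by (auto simp: S_def)
      then show False
        by (simp add: zero_prod_def)
    qed
  qed
qed

text \<open>A direction outside the subspace \<open>R k\<close> rules out at most one value of its
  coefficient. Each coefficient is chosen generically only for those \<open>k\<close> that none of
  the remaining directions can serve; the other conditions are left to the remaining coefficients,
  with \<open>\<beta>\<close> shifted by the choice already made.\<close>

lemma generic_coefficients:
  fixes R :: "'k \<Rightarrow> 'a::real_vector set" and \<gamma> :: "'k \<Rightarrow> 'c \<Rightarrow> 'a"
  assumes "finite C" "finite K" "\<And>k. k \<in> K \<Longrightarrow> subspace (R k)"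
    and "\<And>k. k \<in> K \<Longrightarrow> \<exists>j\<in>C. \<gamma> k j \<notin> R k"
  shows "\<exists>t. (\<forall>j\<in>C. 0 < t j \<and> t j < (1::real)) \<and> (\<forall>k\<in>K. \<beta> k + (\<Sum>j\<in>C. t j *\<^sub>R \<gamma> k j) \<notin> R k)"
  using assms(1,2,3,4)
proof (induction C arbitrary: K \<beta> rule: finite_induct)
  case empty
  then show ?case by auto
next
  case (insert x C)
  define K1 where "K1 = {k \<in> K. \<exists>j\<in>C. \<gamma> k j \<notin> R k}"
  have K1: "finite K1" "\<And>k. k \<in> K1 \<Longrightarrow> \<exists>j\<in>C. \<gamma> k j \<notin> R k"
    using insert.prems by (auto simp: K1_def)
  have "finite {s. \<beta> k + s *\<^sub>R \<gamma> k x \<in> R k}" if k: "k \<in> K - K1" for k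
  proof -
    have g: "\<gamma> k x \<notin> R k"
      using k insert.prems(3)[of k] by (auto simp: K1_def)
    have sub: "subspace (R k)"
      using k insert.prems by auto
    have unique: "s = r" if "\<beta> k + s *\<^sub>R \<gamma> k x \<in> R k" "\<beta> k + r *\<^sub>R \<gamma> k x \<in> R k" for s r
    proof (rule ccontr)
      assume "s \<noteq> r"
      have "(s - r) *\<^sub>R \<gamma> k x \<in> R k"
        using subspace_diff[OF sub that] by (simp add: algebra_simps)
      from subspace_mul[OF sub this, of "inverse (s - r)"] show False
        using g \<open>s \<noteq> r\<close> by simp
    qed
    show ?thesis
    proof (rule ccontr)
      assume inf: "infinite {s. \<beta> k + s *\<^sub>R \<gamma> k x \<in> R k}"
      then obtain r where "\<beta> k + r *\<^sub>R \<gamma> k x \<in> R k"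
        using infinite_imp_nonempty by blast
      then have "{s. \<beta> k + s *\<^sub>R \<gamma> k x \<in> R k} \<subseteq> {r}"
        using unique by auto
      then show False
        using inf finite_subset by blast
    qed
  qed
  then have "finite (\<Union>k\<in>K - K1. {s. \<beta> k + s *\<^sub>R \<gamma> k x \<in> R k})"
    using insert.prems(1) by blast
  moreover have "infinite {0<..<1::real}"
    by (rule infinite_Ioo) simp
  ultimately have "\<not> {0<..<1} \<subseteq> (\<Union>k\<in>K - K1. {s. \<beta> k + s *\<^sub>R \<gamma> k x \<in> R k})"
    using finite_subset by blast
  then obtain s where "s \<in> {0<..<1}" "s \<notin> (\<Union>k\<in>K - K1. {s. \<beta> k + s *\<^sub>R \<gamma> k x \<in> R k})"
    by blast
  then have s: "0 < s" "s < 1" "\<And>k. k \<in> K - K1 \<Longrightarrow> \<beta> k + s *\<^sub>R \<gamma> k x \<notin> R k"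
    by auto
  obtain t where t: "\<forall>j\<in>C. 0 < t j \<and> t j < (1::real)"
      "\<forall>k\<in>K1. (\<beta> k + s *\<^sub>R \<gamma> k x) + (\<Sum>j\<in>C. t j *\<^sub>R \<gamma> k j) \<notin> R k"
    using insert.IH[OF K1(1) _ K1(2), of "\<lambda>k. \<beta> k + s *\<^sub>R \<gamma> k x"] insert.prems by (auto simp: K1_def)
  define t' where "t' = t(x := s)"
  have sums: "(\<Sum>j\<in>insert x C. t' j *\<^sub>R \<gamma> k j) = s *\<^sub>R \<gamma> k x + (\<Sum>j\<in>C. t j *\<^sub>R \<gamma> k j)" for k
    using insert.hyps by (auto simp: t'_def intro!: sum.cong)
  have "\<beta> k + (\<Sum>j\<in>insert x C. t' j *\<^sub>R \<gamma> k j) \<notin> R k" if k: "k \<in> K" for k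
  proof (cases "k \<in> K1")
    case True
    then show ?thesis
      using t(2) by (simp add: sums add.assoc)
  next
    case False
    have sub: "subspace (R k)"
      using k insert.prems by auto
    have "(\<Sum>j\<in>C. t j *\<^sub>R \<gamma> k j) \<in> R k"
      using False k by (intro subspace_sum[OF sub] subspace_mul[OF sub]) (auto simp: K1_def)
    then show ?thesis
      using s(3)[of k] False k subspace_diff[OF sub, of "\<beta> k + (\<Sum>j\<in>insert x C. t' j *\<^sub>R \<gamma> k j)"]
      by (force simp: sums)
  qed
  moreover have "\<forall>j\<in>insert x C. 0 < t' j \<and> t' j < 1"
    using t(1) s by (auto simp: t'_def)
  ultimately show ?case by blast
qed

section \<open>Perturbing orthogonality relations\<close>

lemma has_derivative_vecI:
  fixes f :: "'a::real_normed_vector \<Rightarrow> 'b::euclidean_space^'n"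
  assumes "\<And>i. ((\<lambda>x. f x $ i) has_derivative (\<lambda>h. f' h $ i)) (at a)"
  shows "(f has_derivative f') (at a)"
  using assms
  by (subst has_derivative_componentwise_within)
    (auto simp: Basis_vec_def inner_axis intro!: has_derivative_inner_left)

text \<open>The quadratic term anticipates what a split of \<open>u\<close> adds to the inner
  products, with \<open>\<eta>\<close> in the role of \<open>\<rho>\<^sup>2\<close>. The assumption
  \<open>sap\<close> is the dual form of the statement that the derivative of the relations at
  \<open>b\<close> is surjective.\<close>

lemma perturbed_representation:
  fixes b :: "'v::finite \<Rightarrow> 'a::euclidean_space"
  assumes "V \<noteq> {}" and sum0: "(\<Sum>i\<in>V. b i) = 0"
    and sym: "\<And>i j. A i j \<longleftrightarrow> A j i"
    and orth: "\<And>i j. i \<in> V \<Longrightarrow> j \<in> V \<Longrightarrow> i \<noteq> j \<Longrightarrow> \<not> A i j \<Longrightarrow> b i \<bullet> b j = 0"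
    and sap: "\<And>(N::real^'v^'v) t. (\<forall>i j. N $ i $ j = N $ j $ i) \<Longrightarrow>
      (\<forall>i j. N $ i $ j \<noteq> 0 \<longrightarrow> i \<in> V \<and> j \<in> V \<and> i \<noteq> j \<and> \<not> A i j) \<Longrightarrow>
      (\<forall>i\<in>V. (\<Sum>j\<in>V. N $ i $ j *\<^sub>R b j) = t) \<Longrightarrow> N = 0"
  obtains b' :: "nat \<Rightarrow> 'v \<Rightarrow> 'a" and \<eta> :: "nat \<Rightarrow> real" where
    "\<And>m. 0 < \<eta> m" "\<eta> \<longlonglongrightarrow> 0" "\<And>i. (\<lambda>m. b' m i) \<longlonglongrightarrow> b i"
    "\<And>m. (\<Sum>i\<in>V. b' m i) = 0" "\<And>m i. i \<in> V \<Longrightarrow> b' m i \<in> span (b ` V)"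
    "\<And>m i j. i \<in> V \<Longrightarrow> j \<in> V \<Longrightarrow> i \<noteq> j \<Longrightarrow> \<not> A i j \<Longrightarrow>
       b' m i \<bullet> b' m j + \<eta> m * \<tau> i * \<tau> j * (b' m u \<bullet> b' m i) * (b' m u \<bullet> b' m j) = 0"
proof -
  define n where "n = real (card V)"
  have n: "n > 0"
    using \<open>V \<noteq> {}\<close> by (simp add: n_def card_gt_0_iff)
  \<comment> \<open>All perturbations by vectors of the span, with the mean subtracted so that the
    sum stays 0. This subtraction is the reason why the dual condition reads "independent of
    \<open>i\<close>" and not "zero".\<close>
  define D where "D = (\<lambda>i (Z::real^'v^'v). \<Sum>j\<in>V. (Z $ i $ j - (\<Sum>l\<in>V. Z $ l $ j) / n) *\<^sub>R b j)"
  define P where "P = (\<lambda>i j. i \<in> V \<and> j \<in> V \<and> i \<noteq> j \<and> \<not> A i j)"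
  define \<kappa> where "\<kappa> = (\<lambda>i j. \<tau> i * \<tau> j * (b u \<bullet> b i) * (b u \<bullet> b j))"
  define \<Theta> where "\<Theta> = (\<lambda>i j (Z::real^'v^'v) h. (b i + D i Z) \<bullet> (b j + D j Z) +
     h * \<tau> i * \<tau> j * ((b u + D u Z) \<bullet> (b i + D i Z)) * ((b u + D u Z) \<bullet> (b j + D j Z)))"
  \<comment> \<open>The relations form a symmetric matrix that vanishes outside \<open>P\<close>. The second component of \<open>x\<close> is a
    free matrix that fills up the rest of the target space, so that the derivative becomes surjective.\<close>
  define f where "f = (\<lambda>x :: (real^'v^'v) \<times> (real^'v^'v) \<times> real.
     ((\<chi> i j. if P i j then \<Theta> i j (fst x) (snd (snd x)) + fst (snd x) $ i $ j - fst (snd x) $ j $ i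
        else fst (snd x) $ i $ j) :: real^'v^'v, snd (snd x)))"
  define f' where "f' = (\<lambda>x :: (real^'v^'v) \<times> (real^'v^'v) \<times> real.
     ((\<chi> i j. if P i j then b i \<bullet> D j (fst x) + D i (fst x) \<bullet> b j + snd (snd x) * \<kappa> i j
          + fst (snd x) $ i $ j - fst (snd x) $ j $ i
        else fst (snd x) $ i $ j) :: real^'v^'v, snd (snd x)))"
  have Dlin: "linear (D i)" for i
  proof (rule linearI)
    show "D i (x + y) = D i x + D i y" for x y
      by (simp add: D_def sum.distrib add_divide_distrib scaleR_left_distrib scaleR_left_diff_distrib
          sum_subtractf)
    show "D i (c *\<^sub>R x) = c *\<^sub>R D i x" for c x
      by (simp add: D_def scaleR_sum_right right_diff_distrib sum_distrib_left[symmetric])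
  qed
  have D0 [simp]: "D i 0 = 0" for i
    by (simp add: D_def)
  have P_sym: "P i j \<longleftrightarrow> P j i" for i j
    using sym by (auto simp: P_def)
  have Dder: "((\<lambda>x. D i (fst x)) has_derivative (\<lambda>x. D i (fst x))) (at a)" for i and a :: "(real^'v^'v) \<times> 'c::real_normed_vector"
    by (intro bounded_linear_imp_has_derivative bounded_linear_compose[of "D i" fst] bounded_linear_fst)
      (simp add: Dlin linear_linear flip: linear_conv_bounded_linear)
  have Rder: "((\<lambda>x. fst (snd x) $ i $ j) has_derivative (\<lambda>x. fst (snd x) $ i $ j)) (at a)"
    for i j and a :: "(real^'v^'v) \<times> (real^'v^'v) \<times> real"
    by (intro bounded_linear_imp_has_derivative bounded_linear_compose[OF bounded_linear_vec_nth]
        bounded_linear_compose[OF bounded_linear_fst] bounded_linear_snd)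
  have hder: "((\<lambda>x. snd (snd x)) has_derivative (\<lambda>x. snd (snd x))) (at a)"
    for a :: "(real^'v^'v) \<times> (real^'v^'v) \<times> real"
    by (intro bounded_linear_imp_has_derivative bounded_linear_compose[OF bounded_linear_snd] bounded_linear_snd)
  have der: "(f has_derivative f') (at 0)"
    unfolding f_def f'_def
  proof (intro has_derivative_Pair has_derivative_vecI hder)
    fix i j
    show "((\<lambda>x. (\<chi> i j. if P i j then \<Theta> i j (fst x) (snd (snd x)) + fst (snd x) $ i $ j - fst (snd x) $ j $ i
        else fst (snd x) $ i $ j) $ i $ j) has_derivative
      (\<lambda>x. (\<chi> i j. if P i j then b i \<bullet> D j (fst x) + D i (fst x) \<bullet> b j + snd (snd x) * \<kappa> i j
          + fst (snd x) $ i $ j - fst (snd x) $ j $ i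
        else fst (snd x) $ i $ j) $ i $ j)) (at 0)"
    proof (cases "P i j")
      case True
      show ?thesis
        unfolding \<Theta>_def \<kappa>_def using True
        by (auto intro!: derivative_eq_intros Dder Rder hder simp: algebra_simps inner_commute)
    next
      case False
      then show ?thesis
        using Rder by simp
    qed
  qed
  have f'_lin: "linear f'"
    using der has_derivative_linear by blast
  have surj: "surj f'"
  proof (rule ccontr)
    assume "\<not> surj f'"
    moreover have "span (range f') = range f'"
      using linear_subspace_image[OF f'_lin subspace_UNIV] span_eq_iff by blast
    ultimately have "span (range f') \<noteq> UNIV"
      by metis
    \<comment> \<open>A vector orthogonal to the image of \<open>f'\<close> is a Lagrange
      multiplier; its matrix part will turn out to be one of the matrices that \<open>sap\<close>
      excludes.\<close>
    then obtain a where a: "a \<noteq> 0" "\<And>x. a \<bullet> f' x = 0"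
      using span_not_UNIV_orthogonal[of "range f'"] by (metis rangeI span_base)
    obtain N \<nu> where N: "a = (N, \<nu>)"
      by (cases a)
    have eq: "(\<Sum>i\<in>UNIV. \<Sum>j\<in>UNIV. N $ i $ j * fst (f' x) $ i $ j) + \<nu> * snd (snd x) = 0" for x
      using a(2)[of x] by (simp add: N inner_prod_def inner_vec_def f'_def)
    have pick: "(\<Sum>k\<in>UNIV. \<Sum>l\<in>UNIV. N $ k $ l * (if k = i \<and> l = j then 1 else 0)) = N $ i $ j" for i j
    proof -
      have "(\<Sum>l\<in>UNIV. N $ k $ l * (if k = i \<and> l = j then 1 else 0)) = (if k = i then N $ i $ j else 0)" for k
        by (cases "k = i") (simp_all add: if_distrib[of "\<lambda>x. _ * x"] cong: if_cong)
      then show ?thesis by simp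
    qed
    \<comment> \<open>Test with the free matrix: off \<open>P\<close> it reaches a single entry, on
      \<open>P\<close> the difference of two mirrored entries. So the multiplier is supported on
      \<open>P\<close> and symmetric.\<close>
    have N_P: "N $ i $ j = 0" if "\<not> P i j" for i j
    proof -
      have "fst (f' (0, axis i (axis j 1), 0)) $ k $ l = (if k = i \<and> l = j then 1 else 0)" for k l
        using that P_sym by (auto simp: f'_def axis_def)
      then show ?thesis
        using eq[of "(0, axis i (axis j 1), 0)"] pick[of i j]
        by (simp only:) simp
    qed
    have N_sym: "N $ i $ j = N $ j $ i" for i j
    proof (cases "P i j")
      case True
      then have ij: "i \<noteq> j" "P j i"
        using P_sym by (auto simp: P_def)
      have "fst (f' (0, axis i (axis j 1), 0)) $ k $ l =
          (if k = i \<and> l = j then 1 else 0) - (if k = j \<and> l = i then 1 else 0)" for k l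
        using True ij by (auto simp: f'_def axis_def)
      then show ?thesis
        using eq[of "(0, axis i (axis j 1), 0)"] pick[of i j] pick[of j i]
        by (simp only: right_diff_distrib sum_subtractf) simp
    next
      case False
      then show ?thesis
        using P_sym N_P by metis
    qed
    define g where "g = (\<lambda>i. \<Sum>j\<in>V. N $ i $ j *\<^sub>R b j)"
    have gD: "(\<Sum>i\<in>V. D i Z \<bullet> g i) = 0" for Z
    proof -
      have Nf: "N $ i $ j * fst (f' (Z, 0, 0)) $ i $ j = N $ i $ j * (b i \<bullet> D j Z) + N $ i $ j * (D i Z \<bullet> b j)" for i j
        using N_P[of i j] by (auto simp: f'_def algebra_simps)
      have restr: "(\<Sum>i\<in>UNIV. \<Sum>j\<in>UNIV. N $ i $ j * h i j) = (\<Sum>i\<in>V. \<Sum>j\<in>V. N $ i $ j * h i j)" for h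
      proof -
        have "(\<Sum>j\<in>UNIV. N $ i $ j * h i j) = (\<Sum>j\<in>V. N $ i $ j * h i j)" for i
          by (rule sum.mono_neutral_right) (auto simp: P_def N_P)
        moreover have "(\<Sum>i\<in>UNIV. \<Sum>j\<in>V. N $ i $ j * h i j) = (\<Sum>i\<in>V. \<Sum>j\<in>V. N $ i $ j * h i j)"
          by (rule sum.mono_neutral_right) (auto simp: P_def N_P)
        ultimately show ?thesis by simp
      qed
      have "0 = (\<Sum>i\<in>V. \<Sum>j\<in>V. N $ i $ j * (b i \<bullet> D j Z)) + (\<Sum>i\<in>V. \<Sum>j\<in>V. N $ i $ j * (D i Z \<bullet> b j))"
        using eq[of "(Z, 0, 0)"] by (simp add: Nf sum.distrib restr)
      also have "(\<Sum>i\<in>V. \<Sum>j\<in>V. N $ i $ j * (b i \<bullet> D j Z)) = (\<Sum>i\<in>V. \<Sum>j\<in>V. N $ i $ j * (D i Z \<bullet> b j))"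
        by (subst sum.swap) (simp add: N_sym inner_commute)
      also have "(\<Sum>i\<in>V. \<Sum>j\<in>V. N $ i $ j * (D i Z \<bullet> b j)) = (\<Sum>i\<in>V. D i Z \<bullet> g i)"
        by (simp add: g_def inner_sum_right)
      finally show ?thesis by simp
    qed
    define gm where "gm = (1 / n) *\<^sub>R (\<Sum>l\<in>V. g l)"
    have gb: "(g k - gm) \<bullet> b l = 0" if kl: "k \<in> V" "l \<in> V" for k l
    proof -
      \<comment> \<open>The unit matrix at \<open>(k, l)\<close> moves \<open>b k\<close> by
        \<open>b l\<close> and then every vector by \<open>- b l / n\<close>.\<close>
      have "D i (axis k (axis l 1)) = ((if i = k then 1 else 0) - 1 / n) *\<^sub>R b l" for i
      proof -
        have "(\<Sum>la\<in>V. axis k (axis l 1) $ la $ j) = (if j = l then 1 else 0::real)" for j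
          using kl by (auto simp: axis_def if_distrib[of "\<lambda>x. x $ _"] cong: if_cong)
        then have "D i (axis k (axis l 1)) = (\<Sum>j\<in>V. if j = l then ((if i = k then 1 else 0) - 1 / n) *\<^sub>R b l else 0)"
          unfolding D_def by (intro sum.cong) (auto simp: axis_def)
        then show ?thesis
          using kl by simp
      qed
      then have "0 = (\<Sum>i\<in>V. ((if i = k then 1 else 0) - 1 / n) * (b l \<bullet> g i))"
        using gD[of "axis k (axis l 1)"] by simp
      also have "\<dots> = b l \<bullet> g k - (1 / n) * (\<Sum>i\<in>V. b l \<bullet> g i)"
        using kl by (simp add: left_diff_distrib sum_subtractf if_distrib[of "\<lambda>x. x * _"]
            sum_distrib_left cong: if_cong)
      also have "\<dots> = b l \<bullet> (g k - gm)"
        by (simp add: gm_def inner_diff_right inner_sum_right)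
      finally show ?thesis
        by (simp add: inner_commute)
    qed
    have "g k = gm" if "k \<in> V" for k
    proof -
      have "g i \<in> span (b ` V)" for i
        unfolding g_def by (intro span_sum span_mul span_base) auto
      then have "g k - gm \<in> span (b ` V)"
        unfolding gm_def by (intro span_diff span_mul span_sum) auto
      then have "g k - gm = 0"
        by (rule orthogonal_span_eq_0) (use gb that in auto)
      then show ?thesis by simp
    qed
    then have "\<forall>i\<in>V. (\<Sum>j\<in>V. N $ i $ j *\<^sub>R b j) = gm"
      by (simp add: g_def)
    moreover have "\<forall>i j. N $ i $ j \<noteq> 0 \<longrightarrow> i \<in> V \<and> j \<in> V \<and> i \<noteq> j \<and> \<not> A i j"
      using N_P unfolding P_def by blast
    ultimately have "N = 0"
      using N_sym by (intro sap) auto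
    moreover have "\<nu> = 0"
      using eq[of "(0, 0, 1)"] by (simp add: \<open>N = 0\<close>)
    ultimately show False
      using a(1) by (simp add: N zero_prod_def)
  qed
  obtain g' where g': "linear g'" "f' \<circ> g' = id"
    using linear_surjective_right_inverse[OF f'_lin surj] by blast
  have cont: "continuous_on UNIV f"
    unfolding f_def
  proof (rule continuous_on_Pair, intro continuous_on_vec_lambda)
    have Dc: "continuous_on UNIV (\<lambda>x :: (real^'v^'v) \<times> (real^'v^'v) \<times> real. D i (fst x))" for i
      by (intro continuous_at_imp_continuous_on ballI has_derivative_continuous[OF Dder])
    show "continuous_on UNIV (\<lambda>x. if P i j then \<Theta> i j (fst x) (snd (snd x)) + fst (snd x) $ i $ j - fst (snd x) $ j $ i
        else fst (snd x) $ i $ j)" for i j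
      unfolding \<Theta>_def by (cases "P i j") (auto intro!: continuous_intros Dc)
  qed (intro continuous_intros)
  have f0: "f 0 = 0"
    by (auto simp: f_def \<Theta>_def P_def zero_prod_def vec_eq_iff orth)
  have ex: "\<exists>x. norm x < 1 / real (Suc m) \<and> fst (f x) = 0 \<and> 0 < snd (snd x)" for m
  proof -
    have "f 0 \<in> interior (f ` ball 0 (1 / real (Suc m)))"
      using g' by (intro sussmann_open_mapping[OF open_UNIV cont _ der])
        (auto simp: linear_conv_bounded_linear)
    then obtain r where r: "r > 0" "ball 0 r \<subseteq> f ` ball 0 (1 / real (Suc m))"
      by (auto simp: f0 mem_interior)
    \<comment> \<open>The last component of \<open>f\<close> is the parameter itself, so prescribing
      \<open>r / 2\<close> there makes the parameter positive while all relations hold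
      exactly.\<close>
    have "(0, r / 2) \<in> ball (0 :: (real^'v^'v) \<times> real) r"
      using r(1) by (simp add: dist_norm norm_Pair)
    then obtain x where "x \<in> ball 0 (1 / real (Suc m))" "(0, r / 2) = f x"
      using r(2) by blast
    then show ?thesis
      using r(1) by (intro exI[of _ x]) (auto simp: f_def)
  qed
  then obtain X where X: "\<And>m. norm (X m) < 1 / real (Suc m)" "\<And>m. fst (f (X m)) = 0" "\<And>m. 0 < snd (snd (X m))"
    by metis
  have "X \<longlonglongrightarrow> 0"
    by (rule Lim_null_comparison[OF _ LIMSEQ_inverse_real_of_nat])
      (use X(1) in \<open>auto intro!: always_eventually simp: less_imp_le inverse_eq_divide\<close>)
  show ?thesis
  proof (rule that[of "\<lambda>m. snd (snd (X m))" "\<lambda>m i. b i + D i (fst (X m))"])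
    show "(\<lambda>m. snd (snd (X m))) \<longlonglongrightarrow> 0"
      using tendsto_snd[OF tendsto_snd[OF \<open>X \<longlonglongrightarrow> 0\<close>]] by simp
    have "(\<lambda>m. fst (X m)) \<longlonglongrightarrow> 0"
      using tendsto_fst[OF \<open>X \<longlonglongrightarrow> 0\<close>] by simp
    then have "(\<lambda>m. D i (fst (X m))) \<longlonglongrightarrow> D i 0" for i
      using Dlin by (metis linear_conv_bounded_linear bounded_linear.tendsto)
    then show "(\<lambda>m. b i + D i (fst (X m))) \<longlonglongrightarrow> b i" for i
      using tendsto_add[OF tendsto_const, of _ _ _ "b i"] by fastforce
    show "(\<Sum>i\<in>V. b i + D i (fst (X m))) = 0" for m
    proof -
      have "(\<Sum>i\<in>V. D i Z) = (\<Sum>j\<in>V. (\<Sum>i\<in>V. Z $ i $ j - (\<Sum>l\<in>V. Z $ l $ j) / n) *\<^sub>R b j)" for Z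
        unfolding D_def by (subst sum.swap) (simp add: scaleR_sum_left)
      also have "\<dots> Z = 0" for Z
        using n \<open>V \<noteq> {}\<close> by (simp add: sum_subtractf n_def)
      finally show ?thesis
        by (simp add: sum.distrib sum0)
    qed
    show "b i + D i (fst (X m)) \<in> span (b ` V)" if "i \<in> V" for m i
      unfolding D_def using that by (intro span_add span_sum span_mul span_base) auto
    fix m i j assume ij: "i \<in> V" "j \<in> V" "i \<noteq> j" "\<not> A i j"
    then have "P i j" "P j i"
      using P_sym by (auto simp: P_def)
    moreover have "fst (f (X m)) $ i $ j = 0" "fst (f (X m)) $ j $ i = 0"
      using X(2)[of m] by simp_all
    moreover have "\<Theta> i j Z h = \<Theta> j i Z h" for Z h
      by (simp add: \<Theta>_def inner_commute mult_ac)
    \<comment> \<open>The mirrored entries contain the free matrix with opposite signs and the same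
      value of \<open>\<Theta>\<close>; since both entries vanish, so does
      \<open>\<Theta>\<close>.\<close>
    ultimately have "\<Theta> i j (fst (X m)) (snd (snd (X m))) = 0"
      by (simp add: f_def)
    then show "(b i + D i (fst (X m))) \<bullet> (b j + D j (fst (X m))) + snd (snd (X m)) * \<tau> i * \<tau> j *
        ((b u + D u (fst (X m))) \<bullet> (b i + D i (fst (X m)))) * ((b u + D u (fst (X m))) \<bullet> (b j + D j (fst (X m)))) = 0"
      by (simp add: \<Theta>_def)
  qed (use X(3) in auto)
qed

section \<open>Splitting a vertex\<close>

text \<open>The fourth condition says that no proper nonempty part of the star of \<open>w\<close> is in equilibrium in the
  Gale dual, and the last one is the Strong Arnold Property.\<close>

definition stable_representation ::
    "'v::finite set \<Rightarrow> ('v \<Rightarrow> 'v \<Rightarrow> bool) \<Rightarrow> ('v \<Rightarrow> 'a::euclidean_space) \<Rightarrow> bool" where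
  "stable_representation V A b \<longleftrightarrow>
     (\<Sum>i\<in>V. b i) = 0 \<and>
     (\<forall>i\<in>V. \<forall>j\<in>V. i \<noteq> j \<longrightarrow> (b i \<bullet> b j \<noteq> 0 \<longleftrightarrow> A i j)) \<and>
     (\<forall>i\<in>V. \<forall>j\<in>V. i \<noteq> j \<longrightarrow> axis i 1 \<notin> profiles b (V - {j})) \<and>
     (\<forall>w\<in>V. \<forall>X. X \<noteq> {} \<longrightarrow> X \<subset> {l \<in> V. l \<noteq> w \<and> A w l} \<longrightarrow>
        (\<chi> l. if l \<in> X then b w \<bullet> b l else 0) \<notin> profiles b (V - {w})) \<and>
     (\<forall>(N::real^'v^'v) t. (\<forall>i j. N $ i $ j = N $ j $ i) \<longrightarrow>
        (\<forall>i j. N $ i $ j \<noteq> 0 \<longrightarrow> i \<in> V \<and> j \<in> V \<and> i \<noteq> j \<and> \<not> A i j) \<longrightarrow>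
        (\<forall>i\<in>V. (\<Sum>j\<in>V. N $ i $ j *\<^sub>R b j) = t) \<longrightarrow> N = 0)"

lemma stable_representationD:
  fixes b :: "'v::finite \<Rightarrow> 'a::euclidean_space"
  assumes "stable_representation V A b"
  shows "(\<Sum>i\<in>V. b i) = 0"
    and "\<And>i j. i \<in> V \<Longrightarrow> j \<in> V \<Longrightarrow> i \<noteq> j \<Longrightarrow> b i \<bullet> b j \<noteq> 0 \<longleftrightarrow> A i j"
    and "\<And>i j. i \<in> V \<Longrightarrow> j \<in> V \<Longrightarrow> i \<noteq> j \<Longrightarrow> axis i 1 \<notin> profiles b (V - {j})"
    and "\<And>w X. w \<in> V \<Longrightarrow> X \<noteq> {} \<Longrightarrow> X \<subset> {l \<in> V. l \<noteq> w \<and> A w l} \<Longrightarrow>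
        (\<chi> l. if l \<in> X then b w \<bullet> b l else 0) \<notin> profiles b (V - {w})"
    and "\<And>(N::real^'v^'v) t. (\<forall>i j. N $ i $ j = N $ j $ i) \<Longrightarrow>
        (\<forall>i j. N $ i $ j \<noteq> 0 \<longrightarrow> i \<in> V \<and> j \<in> V \<and> i \<noteq> j \<and> \<not> A i j) \<Longrightarrow>
        (\<forall>i\<in>V. (\<Sum>j\<in>V. N $ i $ j *\<^sub>R b j) = t) \<Longrightarrow> N = 0"
proof -
  note rep = assms[unfolded stable_representation_def]
  note c2 = rep[THEN conjunct2] and c3 = rep[THEN conjunct2, THEN conjunct2]
  note c4 = c3[THEN conjunct2] and c5 = c3[THEN conjunct2, THEN conjunct2]
  show "(\<Sum>i\<in>V. b i) = 0"
    by (rule rep[THEN conjunct1])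
  show "b i \<bullet> b j \<noteq> 0 \<longleftrightarrow> A i j" if "i \<in> V" "j \<in> V" "i \<noteq> j" for i j
    using c2[THEN conjunct1] that by simp
  show "axis i 1 \<notin> profiles b (V - {j})" if "i \<in> V" "j \<in> V" "i \<noteq> j" for i j
    using c3[THEN conjunct1] that by simp
  show "(\<chi> l. if l \<in> X then b w \<bullet> b l else 0) \<notin> profiles b (V - {w})"
    if "w \<in> V" "X \<noteq> {}" "X \<subset> {l \<in> V. l \<noteq> w \<and> A w l}" for w X
    using c4[THEN conjunct1] that by simp
  show "N = 0" if "\<forall>i j. N $ i $ j = N $ j $ i"
    "\<forall>i j. N $ i $ j \<noteq> 0 \<longrightarrow> i \<in> V \<and> j \<in> V \<and> i \<noteq> j \<and> \<not> A i j"
    "\<forall>i\<in>V. (\<Sum>j\<in>V. N $ i $ j *\<^sub>R b j) = t" for N :: "real^'v^'v" and t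
    by (rule c5[THEN spec, THEN spec, THEN mp, THEN mp, THEN mp, OF that])
qed

section \<open>Dividing the common edges generically\<close>

definition merge :: "('v \<Rightarrow> 'v \<Rightarrow> bool) \<Rightarrow> 'v \<Rightarrow> 'v \<Rightarrow> 'v \<Rightarrow> 'v \<Rightarrow> bool" where
  "merge A u v i j \<longleftrightarrow> i \<noteq> j \<and> (A i j \<or> i = u \<and> A v j \<or> j = u \<and> A i v)"

lemma profiles_cong:
  assumes "\<phi> \<in> profiles b I" "\<And>l. l \<in> I \<Longrightarrow> \<phi> $ l = \<psi> $ l"
  shows "\<psi> \<in> profiles b I"
  using assms by (auto simp: profiles_def)

text \<open>A part of the star of \<open>u\<close> or \<open>v\<close> without common neighbours is
  a proper part of the star of the merged vertex, since \<open>nu\<close> and \<open>nv\<close>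
  supply a neighbour on the other side, so it is not in equilibrium by assumption. In every other
  condition the coefficient of some common neighbour moves the profile along a single axis, and this
  axis is outside the row space because the Gale dual points are distinct.\<close>

lemma generic_split:
  fixes b :: "'v::finite \<Rightarrow> 'a::euclidean_space"
  assumes sym: "\<And>i j. A i j \<longleftrightarrow> A j i" and uv: "u \<in> V" "v \<in> V" "u \<noteq> v"
    and rep: "stable_representation (V - {v}) (merge A u v) b"
    and nu: "\<exists>j\<in>V - {u, v}. A u j" and nv: "\<exists>j\<in>V - {u, v}. A v j"
  obtains \<tau> :: "'v \<Rightarrow> real" where
    "\<And>j. j \<notin> V - {u, v} \<or> \<not> A v j \<Longrightarrow> \<tau> j = 0"
    "\<And>j. j \<in> V - {u, v} \<Longrightarrow> A v j \<Longrightarrow> \<not> A u j \<Longrightarrow> \<tau> j = 1"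
    "\<And>j. j \<in> V - {u, v} \<Longrightarrow> A v j \<Longrightarrow> A u j \<Longrightarrow> 0 < \<tau> j \<and> \<tau> j < 1"
    "\<And>Y. Y \<noteq> {} \<Longrightarrow> Y \<subseteq> {j \<in> V - {u, v}. A v j} \<Longrightarrow>
       (\<chi> l. if l \<in> Y then \<tau> l * (b u \<bullet> b l) else 0) \<notin> profiles b (V - {v} - {u})"
    "\<And>Y. Y \<noteq> {} \<Longrightarrow> Y \<subseteq> {j \<in> V - {u, v}. A u j} \<Longrightarrow>
       (\<chi> l. if l \<in> Y then (1 - \<tau> l) * (b u \<bullet> b l) else 0) \<notin> profiles b (V - {v} - {u})"
    "\<And>w X \<kappa>. w \<in> V - {u, v} \<Longrightarrow> A u w \<Longrightarrow> A v w \<Longrightarrow> \<kappa> \<in> {\<tau> w, 1 - \<tau> w} \<Longrightarrow>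
       (\<chi> l. if l = u then \<kappa> * (b w \<bullet> b u) else if l \<in> X then b w \<bullet> b l else 0)
         \<notin> profiles b (V - {v} - {w})"
proof -
  define C where "C = {j \<in> V - {u, v}. A u j \<and> A v j}"
  define g where "g = (\<lambda>l. b u \<bullet> b l)"
  \<comment> \<open>Tag 0 stands for a part of the star of \<open>v\<close>, tag 1 for a part of the
    star of \<open>u\<close>. Tags 2 and 3 belong to the star of a common neighbour \<open>w\<close>
    when only the share of \<open>v\<close>, respectively of \<open>u\<close>, in the divided edge
    is taken.\<close>
  define K where "K = {(k::nat, w, Y). k = 0 \<and> w = u \<and> Y \<inter> C \<noteq> {} \<or> k = 1 \<and> w = u \<and> Y \<inter> C \<noteq> {} \<or>
    k = 2 \<and> w \<in> C \<or> k = 3 \<and> w \<in> C}"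
  define R where "R = (\<lambda>(k::nat, w, Y::'v set). profiles b (V - {v} - {w}))"
  define \<beta> where "\<beta> = (\<lambda>(k::nat, w, Y::'v set). if k = 0 then (\<chi> l. if l \<in> Y - C then g l else 0)
    else if k = 1 then (\<chi> l. if l \<in> Y then g l else 0)
    else if k = 2 then (\<chi> l. if l \<in> Y - {u} then b w \<bullet> b l else 0)
    else (\<chi> l. if l \<in> Y - {u} then b w \<bullet> b l else if l = u then g w else 0))"
  define \<gamma> where "\<gamma> = (\<lambda>(k::nat, w, Y::'v set) j. if k = 0 then (if j \<in> Y then g j *\<^sub>R axis j 1 else 0)
    else if k = 1 then (if j \<in> Y then (- g j) *\<^sub>R axis j 1 else 0)
    else if k = 2 then (if j = w then g w *\<^sub>R axis u 1 else 0)
    else (if j = w then (- g w) *\<^sub>R axis u 1 else (0::real^'v)))"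
  have axis: "r *\<^sub>R axis i 1 \<notin> profiles b (V - {v} - {j})" if "i \<in> V - {v}" "j \<in> V - {v}" "i \<noteq> j" "r \<noteq> 0" for i j r
  proof
    assume "r *\<^sub>R axis i 1 \<in> profiles b (V - {v} - {j})"
    from subspace_mul[OF subspace_profiles this, of "inverse r"] show False
      using stable_representationD(3)[OF rep that(1-3)] that(4) by simp
  qed
  have g: "g j \<noteq> 0" if "j \<in> V - {u, v}" "A u j \<or> A v j" for j
  proof -
    have "u \<in> V - {v}" "j \<in> V - {v}" "u \<noteq> j" "merge A u v u j"
      using that uv by (auto simp: merge_def)
    then show ?thesis
      using stable_representationD(2)[OF rep] by (simp add: g_def)
  qed
  have "finite K"
  proof (rule finite_subset)
    show "K \<subseteq> {0,1,2,3} \<times> UNIV"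
      by (auto simp: K_def)
  qed auto
  moreover have "subspace (R k)" for k
    by (auto simp: R_def subspace_profiles split: prod.split)
  moreover have "\<exists>j\<in>C. \<gamma> k j \<notin> R k" if "k \<in> K" for k
  proof (cases k)
    case (fields n w Y)
    consider "n = 0 \<or> n = 1" "w = u" "Y \<inter> C \<noteq> {}" | "n = 2 \<or> n = 3" "w \<in> C"
      using \<open>k \<in> K\<close> by (auto simp: K_def fields)
    then show ?thesis
    proof cases
      case 1
      then obtain j where j: "j \<in> Y" "j \<in> C" by auto
      then have "g j *\<^sub>R axis j 1 \<notin> R k" "- (g j *\<^sub>R axis j 1) \<notin> R k"
        using axis[of j u "g j"] axis[of j u "- g j"] g[of j] uv 1 by (auto simp: R_def fields C_def)
      then show ?thesis
        using 1(1) j by (intro bexI[of _ j]) (auto simp: \<gamma>_def fields)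
    next
      case 2
      then have "g w *\<^sub>R axis u 1 \<notin> R k" "- (g w *\<^sub>R axis u 1) \<notin> R k"
        using axis[of u w "g w"] axis[of u w "- g w"] g[of w] uv by (auto simp: R_def fields C_def)
      then show ?thesis
        using 2 by (intro bexI[of _ w]) (auto simp: \<gamma>_def fields)
    qed
  qed
  ultimately have "\<exists>t. (\<forall>j\<in>C. 0 < t j \<and> t j < (1::real)) \<and> (\<forall>k\<in>K. \<beta> k + (\<Sum>j\<in>C. t j *\<^sub>R \<gamma> k j) \<notin> R k)"
    by (intro generic_coefficients) simp_all
  then obtain t where t: "\<forall>j\<in>C. 0 < t j \<and> t j < (1::real)" "\<forall>k\<in>K. \<beta> k + (\<Sum>j\<in>C. t j *\<^sub>R \<gamma> k j) \<notin> R k"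
    by blast
  define \<tau> where "\<tau> = (\<lambda>j. if j \<in> C then t j else if j \<in> V - {u, v} \<and> A v j then 1 else 0)"
  have proper: "(\<chi> l. if l \<in> Y then g l else 0) \<notin> profiles b (V - {v} - {u})"
    if "Y \<noteq> {}" "Y \<subset> {l \<in> V - {v}. l \<noteq> u \<and> merge A u v u l}" for Y
    unfolding g_def using uv that by (intro stable_representationD(4)[OF rep]) auto
  have sumaxis: "(\<Sum>j\<in>C. if j \<in> Y then h j *\<^sub>R axis j 1 else 0) = (\<chi> l. if l \<in> Y \<inter> C then h l else (0::real))" for Y and h :: "'v \<Rightarrow> real"
  proof -
    have "(\<Sum>j\<in>C. (if j \<in> Y then h j *\<^sub>R axis j 1 else (0::real^'v)) $ l) = (\<Sum>j\<in>C. if j = l then (if l \<in> Y then h l else 0) else 0)" for l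
      by (intro sum.cong) (auto simp: axis_def)
    then show ?thesis
      by (auto simp: vec_eq_iff sum_component)
  qed
  show ?thesis
  proof (rule that[of \<tau>])
    show "\<tau> j = 0" if "j \<notin> V - {u, v} \<or> \<not> A v j" for j
      using that by (auto simp: \<tau>_def C_def)
    show "\<tau> j = 1" if "j \<in> V - {u, v}" "A v j" "\<not> A u j" for j
      using that by (auto simp: \<tau>_def C_def)
    show "0 < \<tau> j \<and> \<tau> j < 1" if "j \<in> V - {u, v}" "A v j" "A u j" for j
      using that t(1) by (auto simp: \<tau>_def C_def)
    show "(\<chi> l. if l \<in> Y then \<tau> l * (b u \<bullet> b l) else 0) \<notin> profiles b (V - {v} - {u})"
      if Y: "Y \<noteq> {}" "Y \<subseteq> {j \<in> V - {u, v}. A v j}" for Y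
    proof (cases "Y \<inter> C = {}")
      case True
      have "Y \<subset> {l \<in> V - {v}. l \<noteq> u \<and> merge A u v u l}"
        using True Y(2) nu by (auto simp: C_def merge_def)
      moreover have "(\<chi> l. if l \<in> Y then \<tau> l * (b u \<bullet> b l) else 0) = (\<chi> l. if l \<in> Y then g l else 0)"
        using True Y by (auto simp: vec_eq_iff \<tau>_def g_def)
      ultimately show ?thesis
        using proper[OF Y(1)] by simp
    next
      case False
      have "(\<Sum>j\<in>C. t j *\<^sub>R \<gamma> (0, u, Y) j) = (\<Sum>j\<in>C. if j \<in> Y then (t j * g j) *\<^sub>R axis j 1 else 0)"
        by (intro sum.cong) (auto simp: \<gamma>_def)
      then have "\<beta> (0, u, Y) + (\<Sum>j\<in>C. t j *\<^sub>R \<gamma> (0, u, Y) j) =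
          (\<chi> l. if l \<in> Y then \<tau> l * (b u \<bullet> b l) else 0)"
        using Y(2) unfolding sumaxis by (auto simp: \<beta>_def vec_eq_iff \<tau>_def g_def)
      moreover have "(0, u, Y) \<in> K"
        using False by (simp add: K_def)
      ultimately show ?thesis
        using bspec[OF t(2), of "(0, u, Y)"] by (simp add: R_def)
    qed
    show "(\<chi> l. if l \<in> Y then (1 - \<tau> l) * (b u \<bullet> b l) else 0) \<notin> profiles b (V - {v} - {u})"
      if Y: "Y \<noteq> {}" "Y \<subseteq> {j \<in> V - {u, v}. A u j}" for Y
    proof (cases "Y \<inter> C = {}")
      case True
      have "Y \<subset> {l \<in> V - {v}. l \<noteq> u \<and> merge A u v u l}"
        using True Y(2) nv by (auto simp: C_def merge_def)
      moreover have "(\<chi> l. if l \<in> Y then (1 - \<tau> l) * (b u \<bullet> b l) else 0) = (\<chi> l. if l \<in> Y then g l else 0)"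
        using True Y by (auto simp: vec_eq_iff \<tau>_def g_def C_def)
      ultimately show ?thesis
        using proper[OF Y(1)] by simp
    next
      case False
      have "(\<Sum>j\<in>C. t j *\<^sub>R \<gamma> (1, u, Y) j) = (\<Sum>j\<in>C. if j \<in> Y then (- (t j * g j)) *\<^sub>R axis j 1 else 0)"
        by (intro sum.cong) (auto simp: \<gamma>_def)
      then have "\<beta> (1, u, Y) + (\<Sum>j\<in>C. t j *\<^sub>R \<gamma> (1, u, Y) j) =
          (\<chi> l. if l \<in> Y then (1 - \<tau> l) * (b u \<bullet> b l) else 0)"
        using Y(2) unfolding sumaxis by (auto simp: \<beta>_def vec_eq_iff \<tau>_def g_def C_def left_diff_distrib)
      moreover have "(1, u, Y) \<in> K"
        using False by (simp add: K_def)
      ultimately show ?thesis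
        using bspec[OF t(2), of "(1, u, Y)"] by (simp add: R_def)
    qed
    show "(\<chi> l. if l = u then \<kappa> * (b w \<bullet> b u) else if l \<in> X then b w \<bullet> b l else 0) \<notin> profiles b (V - {v} - {w})"
      if w: "w \<in> V - {u, v}" "A u w" "A v w" "\<kappa> \<in> {\<tau> w, 1 - \<tau> w}" for w X \<kappa>
    proof -
      have "w \<in> C"
        using w by (simp add: C_def)
      then have K: "(2, w, X) \<in> K" "(3, w, X) \<in> K"
        by (auto simp: K_def)
      have sumw: "(\<Sum>j\<in>C. if j = w then t j *\<^sub>R x else 0) = \<tau> w *\<^sub>R x" for x :: "real^'v"
        using \<open>w \<in> C\<close> by (simp add: \<tau>_def)
      have "(\<Sum>j\<in>C. t j *\<^sub>R \<gamma> (2, w, X) j) = (\<Sum>j\<in>C. if j = w then t j *\<^sub>R g w *\<^sub>R axis u 1 else 0)"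
        by (intro sum.cong) (auto simp: \<gamma>_def)
      then have "\<beta> (2, w, X) + (\<Sum>j\<in>C. t j *\<^sub>R \<gamma> (2, w, X) j) =
          (\<chi> l. if l = u then \<tau> w * (b w \<bullet> b u) else if l \<in> X then b w \<bullet> b l else 0)"
        by (simp add: sumw \<beta>_def vec_eq_iff axis_def g_def inner_commute[of "b u"])
      moreover have "(\<Sum>j\<in>C. t j *\<^sub>R \<gamma> (3, w, X) j) = (\<Sum>j\<in>C. if j = w then t j *\<^sub>R (- g w) *\<^sub>R axis u 1 else 0)"
        by (intro sum.cong) (auto simp: \<gamma>_def)
      then have "\<beta> (3, w, X) + (\<Sum>j\<in>C. t j *\<^sub>R \<gamma> (3, w, X) j) =
          (\<chi> l. if l = u then (1 - \<tau> w) * (b w \<bullet> b u) else if l \<in> X then b w \<bullet> b l else 0)"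
        by (simp add: sumw \<beta>_def vec_eq_iff axis_def g_def inner_commute[of "b u"] left_diff_distrib)
      ultimately show ?thesis
        using bspec[OF t(2) K(1)] bspec[OF t(2) K(2)] w(4) by (auto simp: R_def)
    qed
  qed
qed

text \<open>\<open>\<tau> j\<close> is the share of the edge from the merged vertex to \<open>j\<close> that goes to \<open>v\<close>, and \<open>1 / \<rho>\<^sup>2\<close> is
  roughly the stress on the new edge \<open>uv\<close>.\<close>

locale vertex_splitting =
  fixes V :: "'v::finite set" and A :: "'v \<Rightarrow> 'v \<Rightarrow> bool" and u v :: 'v and \<tau> :: "'v \<Rightarrow> real"
    and e :: "'a::euclidean_space" and B :: "'v \<Rightarrow> 'a" and \<rho> :: real
  assumes A_sym: "A i j \<longleftrightarrow> A j i"
    and uv: "u \<in> V" "v \<in> V" "u \<noteq> v" "A u v"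
    and tau_0: "j \<notin> V - {u, v} \<or> \<not> A v j \<Longrightarrow> \<tau> j = 0"
    and tau_1: "j \<in> V - {u, v} \<Longrightarrow> A v j \<Longrightarrow> \<not> A u j \<Longrightarrow> \<tau> j = 1"
    and tau_mid: "j \<in> V - {u, v} \<Longrightarrow> A v j \<Longrightarrow> A u j \<Longrightarrow> 0 < \<tau> j \<and> \<tau> j < 1"
    and B_sum: "(\<Sum>i\<in>V - {v}. B i) = 0"
    and B_e: "i \<in> V - {v} \<Longrightarrow> B i \<bullet> e = 0" and e_unit: "e \<bullet> e = 1"
    and rho: "0 < \<rho>" "\<rho>\<^sup>2 * (\<Sum>j\<in>V - {u, v}. \<tau> j * (B u \<bullet> B j)) < 1"
    and B_gram: "i \<in> V - {v} \<Longrightarrow> j \<in> V - {v} \<Longrightarrow> i \<noteq> j \<Longrightarrow>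
      B i \<bullet> B j + \<rho>\<^sup>2 * \<tau> i * \<tau> j * (B u \<bullet> B i) * (B u \<bullet> B j) \<noteq> 0 \<longleftrightarrow> merge A u v i j"
begin

section \<open>Explicit vectors after a split, and the meaning of their degeneracies\<close>

definition a :: "'v \<Rightarrow> real" where "a j = \<tau> j * (B u \<bullet> B j)"

text \<open>The value forced by the vanishing of the sum of all \<open>c i\<close>; the second part
  of \<open>rho\<close> makes it positive.\<close>

definition s :: real where "s = 1 / \<rho> - \<rho> * (\<Sum>j\<in>V - {u, v}. a j)"

text \<open>The coefficients \<open>- 1 / \<rho>\<close> and \<open>\<rho> * a i\<close> of
  \<open>e\<close> multiply to \<open>- a i\<close>, so \<open>c u\<close> gives away exactly the
  share \<open>a i\<close> of its product with \<open>i\<close>. As \<open>s\<close> is about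
  \<open>1 / \<rho>\<close>, the vector \<open>c v\<close> receives nearly the same amount. Products
  of two other vertices change by \<open>\<rho>\<^sup>2 * a i * a j\<close>, which
  \<open>B_gram\<close> takes into account.\<close>

definition c :: "'v \<Rightarrow> 'a" where
  "c i = (if i = v then s *\<^sub>R e else if i = u then B u - (1 / \<rho>) *\<^sub>R e else B i + (\<rho> * a i) *\<^sub>R e)"

lemma c_simps: "c v = s *\<^sub>R e" "c u = B u - (1 / \<rho>) *\<^sub>R e"
    "i \<in> V - {u, v} \<Longrightarrow> c i = B i + (\<rho> * a i) *\<^sub>R e"
  using uv by (auto simp: c_def)

lemma sum_W: "(\<Sum>i\<in>V - {v}. f i) = f u + (\<Sum>i\<in>V - {u, v}. f i)" for f :: "'v \<Rightarrow> 'b::comm_monoid_add"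
proof -
  have "V - {v} = insert u (V - {u, v})"
    using uv by auto
  then show ?thesis by simp
qed

lemma sum_V: "(\<Sum>i\<in>V. f i) = f v + (f u + (\<Sum>i\<in>V - {u, v}. f i))" for f :: "'v \<Rightarrow> 'b::comm_monoid_add"
  using sum.remove[of V v f] uv by (simp add: sum_W)

lemma sum_c: "(\<Sum>i\<in>V. c i) = 0"
proof -
  have "(\<Sum>i\<in>V. c i) = (\<Sum>i\<in>V - {v}. B i) + (s - 1 / \<rho> + \<rho> * (\<Sum>i\<in>V - {u, v}. a i)) *\<^sub>R e"
    by (simp add: sum_V sum_W c_simps sum.distrib scaleR_left_distrib scaleR_left_diff_distrib
        scaleR_sum_left sum_distrib_left)
  then show ?thesis
    by (simp add: B_sum s_def)
qed

lemma s_rho: "s * \<rho> = 1 - \<rho>\<^sup>2 * (\<Sum>j\<in>V - {u, v}. a j)"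
  using rho by (simp add: s_def field_simps power2_eq_square)

lemma s_pos: "0 < s"
proof -
  have "0 < s * \<rho>"
    using rho by (simp add: s_rho a_def)
  then show ?thesis
    using rho(1) by (simp add: zero_less_mult_iff)
qed

lemma inner_e:
  assumes "i \<in> V - {v}"
  shows "B i \<bullet> e = 0" "e \<bullet> B i = 0"
  using B_e[OF assms] by (simp_all add: inner_commute)

lemma inner_c:
  shows "i \<in> V - {u, v} \<Longrightarrow> j \<in> V - {u, v} \<Longrightarrow> c i \<bullet> c j = B i \<bullet> B j + \<rho>\<^sup>2 * a i * a j"
    and "j \<in> V - {u, v} \<Longrightarrow> c u \<bullet> c j = B u \<bullet> B j - a j"
    and "j \<in> V - {u, v} \<Longrightarrow> c j \<bullet> c u = B j \<bullet> B u - a j"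
    and "j \<in> V - {u, v} \<Longrightarrow> c v \<bullet> c j = s * (\<rho> * a j)"
    and "j \<in> V - {u, v} \<Longrightarrow> c j \<bullet> c v = s * (\<rho> * a j)"
    and "c u \<bullet> c v = - s / \<rho>" and "c v \<bullet> c u = - s / \<rho>"
  using rho uv
  by (auto simp: c_simps inner_e e_unit inner_add_left inner_add_right inner_diff_left inner_diff_right
      power2_eq_square)

lemma gram_c:
  assumes "i \<in> V" "j \<in> V" "i \<noteq> j"
  shows "c i \<bullet> c j \<noteq> 0 \<longleftrightarrow> A i j"
proof -
  have uU: "c u \<bullet> c j \<noteq> 0 \<longleftrightarrow> A u j" if j: "j \<in> V - {u, v}" for j
  proof -
    have eq: "c u \<bullet> c j = (1 - \<tau> j) * (B u \<bullet> B j)"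
      using j by (simp add: inner_c a_def algebra_simps)
    have B: "B u \<bullet> B j \<noteq> 0 \<longleftrightarrow> A u j \<or> A v j"
      using B_gram[of u j] j uv tau_0[of u] by (auto simp: merge_def)
    show ?thesis
      using eq B j tau_0[of j] tau_1[of j] tau_mid[of j] by (cases "A v j"; cases "A u j") auto
  qed
  have vU: "c v \<bullet> c j \<noteq> 0 \<longleftrightarrow> A v j" if j: "j \<in> V - {u, v}" for j
  proof -
    have B: "B u \<bullet> B j \<noteq> 0 \<longleftrightarrow> A u j \<or> A v j"
      using B_gram[of u j] j uv tau_0[of u] by (auto simp: merge_def)
    show ?thesis
      using B j tau_0[of j] tau_1[of j] tau_mid[of j] s_pos rho(1)
      by (cases "A v j"; cases "A u j") (auto simp: inner_c a_def)
  qed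
  have uv': "c u \<bullet> c v \<noteq> 0" "c v \<bullet> c u \<noteq> 0"
    using s_pos rho(1) by (simp_all add: inner_c)
  have UU: "c i \<bullet> c j \<noteq> 0 \<longleftrightarrow> A i j" if "i \<in> V - {u, v}" "j \<in> V - {u, v}"
    using B_gram[of i j] that assms by (simp add: inner_c a_def merge_def mult_ac)
  consider "i \<in> V - {u, v}" "j \<in> V - {u, v}" | "i = u" "j \<in> V - {u, v}" | "i = v" "j \<in> V - {u, v}"
    | "i \<in> V - {u, v}" "j = u" | "i \<in> V - {u, v}" "j = v" | "i = u" "j = v" | "i = v" "j = u"
    using assms by blast
  then show ?thesis
    using UU uU[of j] vU[of j] uU[of i] vU[of i] uv' uv A_sym inner_commute[of "c i" "c j"] by cases auto
qed

lemma span_c: "span (c ` V) = span (insert e (B ` (V - {v})))"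
proof (rule subset_antisym)
  let ?S = "span (insert e (B ` (V - {v})))"
  have e: "e \<in> ?S"
    by (simp add: span_base)
  have B: "B i \<in> ?S" if "i \<in> V - {v}" for i
    using that by (intro span_base) auto
  have "c i \<in> ?S" if "i \<in> V" for i
    unfolding c_def using that uv e B by (auto intro!: span_add span_diff span_mul)
  then show "span (c ` V) \<subseteq> ?S"
    by (intro span_minimal) auto
  have c: "c i \<in> span (c ` V)" if "i \<in> V" for i
    using that by (intro span_base) auto
  have e': "e \<in> span (c ` V)"
    using span_mul[OF c[OF uv(2)], of "inverse s"] s_pos by (simp add: c_simps)
  have "B i \<in> span (c ` V)" if "i \<in> V - {v}" for i
  proof (cases "i = u")
    case True
    then show ?thesis
      using span_add[OF c[OF uv(1)] span_mul[OF e', of "1 / \<rho>"]] by (simp add: c_simps)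
  next
    case False
    then show ?thesis
      using span_diff[OF c[of i] span_mul[OF e', of "\<rho> * a i"]] that by (simp add: c_simps)
  qed
  then show "?S \<subseteq> span (c ` V)"
    using e' by (intro span_minimal) auto
qed

lemma inner_c_right:
  shows "y \<bullet> c v = s * (y \<bullet> e)" and "y \<bullet> c u = y \<bullet> B u - (y \<bullet> e) / \<rho>"
    and "i \<in> V - {u, v} \<Longrightarrow> y \<bullet> c i = y \<bullet> B i + \<rho> * a i * (y \<bullet> e)"
  by (simp_all add: c_simps inner_add_right inner_diff_right)

lemma inner_sum_eq_0: "y \<bullet> B u + (\<Sum>i\<in>V - {u, v}. y \<bullet> B i) = 0"
  using B_sum by (metis sum_W inner_sum_right inner_add_right inner_zero_right)

text \<open>Coincidence of two points is symmetric: all values \<open>y \<bullet> c l\<close> sum to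
  0, so the missing value at \<open>j\<close> is -1 and \<open>- y\<close> exchanges the two
  vertices.\<close>

lemma axis_profiles_c_swap:
  assumes "axis i 1 \<in> profiles c (V - {j})" "i \<in> V" "j \<in> V" "i \<noteq> j"
  shows "axis j 1 \<in> profiles c (V - {i})"
proof -
  obtain y where y: "\<And>l. l \<in> V - {j} \<Longrightarrow> y \<bullet> c l = axis i 1 $ l"
    using assms by (auto simp: profiles_def)
  have "0 = (\<Sum>l\<in>V. y \<bullet> c l)"
    using sum_c by (simp flip: inner_sum_right)
  also have "\<dots> = y \<bullet> c j + (\<Sum>l\<in>V - {j}. y \<bullet> c l)"
    using assms(3) by (simp add: sum.remove[of V j])
  also have "(\<Sum>l\<in>V - {j}. y \<bullet> c l) = (\<Sum>l\<in>V - {j}. axis i 1 $ l)"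
    using y by simp
  also have "\<dots> = 1"
    using assms by (simp add: axis_def)
  finally have "y \<bullet> c j = -1"
    by simp
  then have "\<forall>l\<in>V - {i}. (- y) \<bullet> c l = axis j 1 $ l"
    using y by (auto simp: axis_def)
  then show ?thesis
    unfolding profiles_def mem_Collect_eq by (rule exI)
qed

lemma axis_profiles_c_old:
  assumes "axis i 1 \<in> profiles c (V - {j})" "i \<in> V - {v}" "j \<in> V - {v}" "i \<noteq> j"
  shows "axis i 1 \<in> profiles B (V - {v} - {j})"
proof -
  obtain y where y: "\<And>l. l \<in> V - {j} \<Longrightarrow> y \<bullet> c l = axis i 1 $ l"
    using assms by (auto simp: profiles_def)
  have "y \<bullet> e = 0"
    using y[of v] assms(2-) s_pos uv by (auto simp: inner_c_right axis_def)
  then have "y \<bullet> c l = y \<bullet> B l" if "l \<in> V - {v}" for l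
    using that by (cases "l = u") (simp_all add: inner_c_right)
  then have "\<forall>l\<in>V - {v} - {j}. y \<bullet> B l = axis i 1 $ l"
    using y by force
  then show ?thesis
    unfolding profiles_def mem_Collect_eq by (rule exI)
qed

text \<open>If the points at \<open>v\<close> and at an old vertex \<open>i\<close> coincide after
  the split, then before it the points at \<open>u\<close> and \<open>i\<close> coincide up to an
  error of order \<open>\<rho>\<^sup>2\<close>; the scaling factor is
  \<open>\<rho> / (y \<bullet> e)\<close>.\<close>

lemma axis_profiles_c_neighbour:
  assumes "axis i 1 \<in> profiles c (V - {v})" "i \<in> V - {u, v}"
  shows "(\<chi> l. if l = u then 1 else - (\<rho>\<^sup>2 * a l)) \<in> profiles B (V - {v} - {i})"
proof -
  obtain y where y: "\<And>l. l \<in> V - {v} \<Longrightarrow> y \<bullet> c l = axis i 1 $ l"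
    using assms by (auto simp: profiles_def)
  have yu: "y \<bullet> B u = (y \<bullet> e) / \<rho>"
    using y[of u] uv assms(2) by (auto simp: inner_c_right axis_def)
  have yl: "y \<bullet> B l = - (\<rho> * a l * (y \<bullet> e))" if "l \<in> V - {u, v}" "l \<noteq> i" for l
    using y[of l] that by (simp add: inner_c_right axis_def)
  \<comment> \<open>Otherwise \<open>y\<close> only sees the vectors \<open>B l\<close>; it vanishes
    on all of them except possibly \<open>B i\<close>, and the zero sum removes this
    exception.\<close>
  have "y \<bullet> e \<noteq> 0"
  proof
    assume 0: "y \<bullet> e = 0"
    have "(\<Sum>l\<in>V - {u, v}. y \<bullet> B l) = (\<Sum>l\<in>V - {u, v}. if l = i then y \<bullet> B i else 0)"
      by (intro sum.cong) (auto simp: yl 0)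
    then have "y \<bullet> B i = 0"
      using inner_sum_eq_0[of y] assms(2) by (simp add: yu 0)
    then show False
      using y[of i] assms(2) by (simp add: inner_c_right 0)
  qed
  then have "\<forall>l\<in>V - {v} - {i}. ((\<rho> / (y \<bullet> e)) *\<^sub>R y) \<bullet> B l = (\<chi> l. if l = u then 1 else - (\<rho>\<^sup>2 * a l)) $ l"
    using rho(1) yu yl by (auto simp: power2_eq_square)
  then show ?thesis
    unfolding profiles_def mem_Collect_eq by (rule exI)
qed

text \<open>The points at \<open>u\<close> and \<open>v\<close> can coincide only if the edges
  handed over to \<open>v\<close> are in equilibrium at \<open>u\<close> before the split. This
  condition has no error term and survives in the limit, where the coincidence itself cannot be
  excluded.\<close>

lemma axis_profiles_c_edge:
  assumes "axis u 1 \<in> profiles c (V - {v})"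
  shows "(\<chi> l. a l) \<in> profiles B (V - {v} - {u})"
proof -
  obtain y where y: "\<And>l. l \<in> V - {v} \<Longrightarrow> y \<bullet> c l = axis u 1 $ l"
    using assms by (auto simp: profiles_def)
  have yl: "y \<bullet> B l = - (\<rho> * a l * (y \<bullet> e))" if "l \<in> V - {u, v}" for l
    using y[of l] that by (simp add: inner_c_right axis_def)
  have "y \<bullet> e \<noteq> 0"
  proof
    assume 0: "y \<bullet> e = 0"
    then have "y \<bullet> B u = 0"
      using inner_sum_eq_0[of y] by (simp add: yl)
    then show False
      using y[of u] uv by (simp add: inner_c_right 0)
  qed
  then have "\<forall>l\<in>V - {v} - {u}. ((- 1 / (\<rho> * (y \<bullet> e))) *\<^sub>R y) \<bullet> B l = (\<chi> l. a l) $ l"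
    using rho(1) yl by auto
  then show ?thesis
    unfolding profiles_def mem_Collect_eq by (rule exI)
qed

text \<open>As \<open>\<rho>\<close> tends to 0, this becomes a part of the star of \<open>w\<close>
  before the split, except that the two shares of the edge from \<open>w\<close> to \<open>u\<close>
  may be present separately.\<close>

lemma star_profiles_c_old:
  assumes w: "w \<in> V - {u, v}" and X: "w \<notin> X"
    and "(\<chi> l. if l \<in> X then c w \<bullet> c l else 0) \<in> profiles c (V - {w})"
  shows "(\<chi> l. if l = u then (if v \<in> X then a w else 0) + (if u \<in> X then B w \<bullet> B u - a w else 0)
      else (if l \<in> X then B w \<bullet> B l + \<rho>\<^sup>2 * a w * a l else 0) - (if v \<in> X then \<rho>\<^sup>2 * a w * a l else 0))
    \<in> profiles B (V - {v} - {w})"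
proof -
  obtain y where y: "\<And>l. l \<in> V - {w} \<Longrightarrow> y \<bullet> c l = (if l \<in> X then c w \<bullet> c l else 0)"
    using assms by (auto simp: profiles_def)
  have ye: "y \<bullet> e = (if v \<in> X then \<rho> * a w else 0)"
    using y[of v] w uv s_pos by (auto simp: inner_c_right[where y = y] inner_c split: if_splits)
  have yu: "y \<bullet> B u = (if v \<in> X then a w else 0) + (if u \<in> X then B w \<bullet> B u - a w else 0)"
    using y[of u] w uv rho(1) by (auto simp: inner_c_right[where y = y] inner_c ye split: if_splits)
  have yl: "y \<bullet> B l = (if l \<in> X then B w \<bullet> B l + \<rho>\<^sup>2 * a w * a l else 0) - (if v \<in> X then \<rho>\<^sup>2 * a w * a l else 0)"
    if "l \<in> V - {u, v}" "l \<noteq> w" for l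
    using y[of l] w that by (auto simp: inner_c_right[where y = y] inner_c ye power2_eq_square algebra_simps split: if_splits)
  show ?thesis
    unfolding profiles_def mem_Collect_eq using yu yl by (intro exI[of _ y]) auto
qed

lemma star_profiles_c_u:
  assumes X: "u \<notin> X" and "(\<chi> l. if l \<in> X then c u \<bullet> c l else 0) \<in> profiles c (V - {u})"
  shows "(\<chi> l. (if l \<in> X then B u \<bullet> B l - a l else 0) + (if v \<in> X then a l else 0)) \<in> profiles B (V - {v} - {u})"
proof -
  obtain y where y: "\<And>l. l \<in> V - {u} \<Longrightarrow> y \<bullet> c l = (if l \<in> X then c u \<bullet> c l else 0)"
    using assms by (auto simp: profiles_def)
  have "s * (y \<bullet> e) = s * (if v \<in> X then - 1 / \<rho> else 0)"
    using y[of v] uv by (auto simp: inner_c_right[where y = y] inner_c split: if_splits)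
  then have ye: "y \<bullet> e = (if v \<in> X then - 1 / \<rho> else 0)"
    using s_pos by simp
  have yl: "y \<bullet> B l = (if l \<in> X then B u \<bullet> B l - a l else 0) + (if v \<in> X then a l else 0)"
    if "l \<in> V - {u, v}" for l
    using y[of l] that rho(1) by (auto simp: inner_c_right[where y = y] inner_c ye split: if_splits)
  show ?thesis
    unfolding profiles_def mem_Collect_eq using yl by (intro exI[of _ y]) auto
qed

text \<open>Here the coordinate at \<open>v\<close>, from which \<open>y \<bullet> e\<close> could
  be read off, is the one that is not prescribed. It is recovered from the vanishing sum of all
  coordinates, and multiplication by \<open>\<rho>\<close> removes the pole.\<close>

lemma star_profiles_c_v:
  assumes X: "v \<notin> X" "X \<subseteq> V" and "(\<chi> l. if l \<in> X then c v \<bullet> c l else 0) \<in> profiles c (V - {v})"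
  shows "(\<chi> l. (if l \<in> X then a l * (1 - \<rho>\<^sup>2 * (\<Sum>j\<in>V - {u, v}. a j)) else 0)
      - a l * ((if u \<in> X then 1 else 0) - \<rho>\<^sup>2 * (\<Sum>j\<in>X - {u}. a j))) \<in> profiles B (V - {v} - {u})"
proof -
  obtain y where y: "\<And>l. l \<in> V - {v} \<Longrightarrow> y \<bullet> c l = (if l \<in> X then c v \<bullet> c l else 0)"
    using assms by (auto simp: profiles_def)
  have "(\<Sum>i\<in>V - {u, v}. y \<bullet> c i) = (\<Sum>i\<in>V - {u, v}. if i \<in> X then s * (\<rho> * a i) else 0)"
    by (intro sum.cong) (auto simp: y inner_c)
  also have "\<dots> = (\<Sum>i\<in>(V - {u, v}) \<inter> X. s * (\<rho> * a i))"
    by (simp add: sum.If_cases)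
  also have "(V - {u, v}) \<inter> X = X - {u}"
    using X by auto
  finally have U: "(\<Sum>i\<in>V - {u, v}. y \<bullet> c i) = s * \<rho> * (\<Sum>i\<in>X - {u}. a i)"
    by (simp add: sum_distrib_left mult.assoc)
  have "0 = (\<Sum>l\<in>V. y \<bullet> c l)"
    using sum_c by (simp flip: inner_sum_right)
  also have "\<dots> = s * (y \<bullet> e + (if u \<in> X then - 1 / \<rho> else 0) + \<rho> * (\<Sum>i\<in>X - {u}. a i))"
    using y[of u] uv by (simp add: sum_V U inner_c_right(1) inner_c algebra_simps)
  finally have ye: "y \<bullet> e = (if u \<in> X then 1 / \<rho> else 0) - \<rho> * (\<Sum>i\<in>X - {u}. a i)"
    using s_pos by (auto split: if_splits)
  have yr: "\<rho> * (y \<bullet> e) = (if u \<in> X then 1 else 0) - \<rho>\<^sup>2 * (\<Sum>i\<in>X - {u}. a i)"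
    using rho(1) by (simp add: ye right_diff_distrib power2_eq_square)
  have yl: "y \<bullet> B l = (if l \<in> X then a l * (s * \<rho>) else 0) - a l * (\<rho> * (y \<bullet> e))"
    if "l \<in> V - {u, v}" for l
    using y[of l] that by (auto simp: inner_c_right[where y = y] inner_c mult_ac split: if_splits)
  show ?thesis
    unfolding profiles_def mem_Collect_eq using yl unfolding yr s_rho by (intro exI[of _ y]) auto
qed

text \<open>The two relations are the components orthogonal to \<open>e\<close> and along
  \<open>e\<close>. Row \<open>v\<close> shows that \<open>t\<close> has no component along
  \<open>e\<close>, since nonneighbours of \<open>v\<close> have share 0. As \<open>\<rho>\<close>
  tends to 0, the second relation becomes \<open>N $ i $ v = N $ i $ u\<close>.\<close>

lemma self_stress_c:
  fixes N :: "real^'v^'v"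
  assumes sym: "\<And>i j. N $ i $ j = N $ j $ i"
    and supp: "\<And>i j. N $ i $ j \<noteq> 0 \<Longrightarrow> i \<in> V \<and> j \<in> V \<and> i \<noteq> j \<and> \<not> A i j"
    and stress: "\<And>i. i \<in> V \<Longrightarrow> (\<Sum>j\<in>V. N $ i $ j *\<^sub>R c j) = t"
  shows "i \<in> V - {v} \<Longrightarrow> (\<Sum>j\<in>V - {v}. N $ i $ j *\<^sub>R B j) = (\<Sum>j\<in>V - {v}. N $ v $ j *\<^sub>R B j)"
    and "i \<in> V - {u, v} \<Longrightarrow> N $ i $ v * (1 - \<rho>\<^sup>2 * (\<Sum>j\<in>V - {u, v}. a j)) - N $ i $ u
       + \<rho>\<^sup>2 * (\<Sum>j\<in>V - {u, v}. N $ i $ j * a j) = 0"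
proof -
  have N0: "N $ v $ v = 0" "N $ v $ u = 0" "N $ u $ v = 0"
    using supp uv A_sym by blast+
  have Nva: "N $ v $ j * a j = 0" for j
    using supp[of v j] tau_0[of j] by (auto simp: a_def)
  have comp: "(\<Sum>j\<in>V. N $ i $ j *\<^sub>R c j) = (\<Sum>j\<in>V - {v}. N $ i $ j *\<^sub>R B j) +
     (N $ i $ v * s - N $ i $ u / \<rho> + \<rho> * (\<Sum>j\<in>V - {u, v}. N $ i $ j * a j)) *\<^sub>R e" for i
    by (simp add: sum_V sum_W c_simps scaleR_right_distrib scaleR_right_diff_distrib sum.distrib
        scaleR_left_distrib scaleR_left_diff_distrib scaleR_sum_left sum_distrib_left mult_ac)
  have tB: "t = (\<Sum>j\<in>V - {v}. N $ v $ j *\<^sub>R B j)"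
    using comp[of v] stress[OF uv(2)] by (simp add: N0 Nva)
  have Be: "(\<Sum>j\<in>V - {v}. N $ i $ j *\<^sub>R B j) \<bullet> e = 0" for i
    by (simp add: inner_sum_left B_e)
  have te: "t \<bullet> e = 0"
    by (simp only: tB Be)
  have z: "N $ i $ v * s - N $ i $ u / \<rho> + \<rho> * (\<Sum>j\<in>V - {u, v}. N $ i $ j * a j) = 0" if "i \<in> V" for i
    using arg_cong[OF stress[OF that], of "\<lambda>x. x \<bullet> e"] by (simp only: comp inner_add_left Be te) (simp add: e_unit)
  show "(\<Sum>j\<in>V - {v}. N $ i $ j *\<^sub>R B j) = (\<Sum>j\<in>V - {v}. N $ v $ j *\<^sub>R B j)" if "i \<in> V - {v}"
    using comp[of i] z[of i] stress[of i] that tB by simp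
  show "N $ i $ v * (1 - \<rho>\<^sup>2 * (\<Sum>j\<in>V - {u, v}. a j)) - N $ i $ u
       + \<rho>\<^sup>2 * (\<Sum>j\<in>V - {u, v}. N $ i $ j * a j) = 0" if "i \<in> V - {u, v}"
  proof -
    have "N $ i $ v * (s * \<rho>) - N $ i $ u + \<rho>\<^sup>2 * (\<Sum>j\<in>V - {u, v}. N $ i $ j * a j) = 0"
      using arg_cong[OF z[of i], of "\<lambda>x. \<rho> * x"] that rho(1)
      by (simp add: right_diff_distrib distrib_left power2_eq_square mult_ac)
    then show ?thesis
      by (simp only: s_rho)
  qed
qed

end

section \<open>The limit argument for a split\<close>

lemma profiles_uminus_cong:
  assumes "\<phi> \<in> profiles b I" "\<And>l. l \<in> I \<Longrightarrow> \<psi> $ l = - \<phi> $ l"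
  shows "\<psi> \<in> profiles b I"
  using profiles_cong[OF subspace_neg[OF subspace_profiles assms(1)]] assms(2) by simp

lemma split_representation:
  fixes b :: "'v::finite \<Rightarrow> 'a::euclidean_space"
  assumes sym: "\<And>i j. A i j \<longleftrightarrow> A j i" and uv: "u \<in> V" "v \<in> V" "u \<noteq> v" "A u v"
    and rep: "stable_representation (V - {v}) (merge A u v) b"
    and dim: "dim (b ` (V - {v})) < DIM('a)"
    and nu: "\<exists>j\<in>V - {u, v}. A u j" and nv: "\<exists>j\<in>V - {u, v}. A v j"
  obtains c :: "'v \<Rightarrow> 'a" where "stable_representation V A c" "dim (c ` V) = Suc (dim (b ` (V - {v})))"
proof -
  let ?W = "V - {v}" and ?U = "V - {u, v}" and ?M = "merge A u v"
  obtain \<tau> where tau: "\<And>j. j \<notin> ?U \<or> \<not> A v j \<Longrightarrow> \<tau> j = (0::real)"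
      "\<And>j. j \<in> ?U \<Longrightarrow> A v j \<Longrightarrow> \<not> A u j \<Longrightarrow> \<tau> j = 1"
      "\<And>j. j \<in> ?U \<Longrightarrow> A v j \<Longrightarrow> A u j \<Longrightarrow> 0 < \<tau> j \<and> \<tau> j < 1"
    and gen_v: "\<And>Y. Y \<noteq> {} \<Longrightarrow> Y \<subseteq> {j \<in> ?U. A v j} \<Longrightarrow>
       (\<chi> l. if l \<in> Y then \<tau> l * (b u \<bullet> b l) else 0) \<notin> profiles b (?W - {u})"
    and gen_u: "\<And>Y. Y \<noteq> {} \<Longrightarrow> Y \<subseteq> {j \<in> ?U. A u j} \<Longrightarrow>
       (\<chi> l. if l \<in> Y then (1 - \<tau> l) * (b u \<bullet> b l) else 0) \<notin> profiles b (?W - {u})"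
    and gen_w: "\<And>w X \<kappa>. w \<in> ?U \<Longrightarrow> A u w \<Longrightarrow> A v w \<Longrightarrow> \<kappa> \<in> {\<tau> w, 1 - \<tau> w} \<Longrightarrow>
       (\<chi> l. if l = u then \<kappa> * (b w \<bullet> b u) else if l \<in> X then b w \<bullet> b l else 0) \<notin> profiles b (?W - {w})"
    by (rule generic_split[OF sym uv(1-3) rep nu nv]) (rule that; assumption)
  obtain e0 where e0: "e0 \<noteq> 0" "span (b ` ?W) \<subseteq> {x. e0 \<bullet> x = 0}"
    using lowdim_subset_hyperplane[OF dim] by blast
  define e where "e = e0 /\<^sub>R norm e0"
  have e: "e \<bullet> e = 1" "\<And>x. x \<in> span (b ` ?W) \<Longrightarrow> x \<bullet> e = 0"
    using e0 by (auto simp: e_def dot_square_norm power2_eq_square inner_commute)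
  have M_sym: "?M i j \<longleftrightarrow> ?M j i" for i j
    using sym by (auto simp: merge_def)
  note rep_sum = stable_representationD(1)[OF rep]
    and rep_gram = stable_representationD(2)[OF rep]
    and rep_axis = stable_representationD(3)[OF rep]
    and rep_star = stable_representationD(4)[OF rep]
    and rep_sap = stable_representationD(5)[OF rep]
  obtain b' \<eta> where eta: "\<And>m. 0 < \<eta> m" "\<eta> \<longlonglongrightarrow> 0" and lim_b: "\<And>i. (\<lambda>m. b' m i) \<longlonglongrightarrow> b i"
    and b'_sum: "\<And>m. (\<Sum>i\<in>?W. b' m i) = 0" and b'_span: "\<And>m i. i \<in> ?W \<Longrightarrow> b' m i \<in> span (b ` ?W)"
    and b'_orth: "\<And>m i j. i \<in> ?W \<Longrightarrow> j \<in> ?W \<Longrightarrow> i \<noteq> j \<Longrightarrow> \<not> ?M i j \<Longrightarrow>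
       b' m i \<bullet> b' m j + \<eta> m * \<tau> i * \<tau> j * (b' m u \<bullet> b' m i) * (b' m u \<bullet> b' m j) = 0"
  proof (rule perturbed_representation[of ?W b ?M \<tau> u])
    show "?W \<noteq> {}"
      using uv by auto
    show "b i \<bullet> b j = 0" if "i \<in> ?W" "j \<in> ?W" "i \<noteq> j" "\<not> ?M i j" for i j
      using rep_gram[of i j] that by simp
  qed (rule rep_sum, rule M_sym, rule rep_sap, assumption, assumption, assumption, rule that, assumption+)
  define \<rho> where "\<rho> = (\<lambda>m. sqrt (\<eta> m))"
  have rho: "0 < \<rho> m" "(\<rho> m)\<^sup>2 = \<eta> m" for m
    using eta(1)[of m] by (simp_all add: \<rho>_def)
  note rho_eta = rho(2)
  define \<alpha> where "\<alpha> = (\<lambda>m l. \<tau> l * (b' m u \<bullet> b' m l))"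
  define \<alpha>0 where "\<alpha>0 = (\<lambda>l. \<tau> l * (b u \<bullet> b l))"
  have lim_a: "(\<lambda>m. \<alpha> m l) \<longlonglongrightarrow> \<alpha>0 l" for l
    unfolding \<alpha>_def \<alpha>0_def by (intro tendsto_intros lim_b)
  \<comment> \<open>The zero sum makes each single vector redundant, so leaving out
    \<open>b w\<close> does not lower the rank and \<open>eventually_notin_profiles\<close> applies
    to \<open>?W - {w}\<close>.\<close>
  have span_W: "span (b ` (?W - {w})) = span (b ` ?W)" if "w \<in> ?W" for w
  proof (rule subset_antisym)
    have "b w = - (\<Sum>l\<in>?W - {w}. b l)"
      using rep_sum that by (simp add: sum.remove[of ?W w] eq_neg_iff_add_eq_0)
    then have w: "b w \<in> span (b ` (?W - {w}))"
      by (auto intro!: span_neg span_sum intro: span_base)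
    show "span (b ` ?W) \<subseteq> span (b ` (?W - {w}))"
    proof (rule span_minimal)
      show "b ` ?W \<subseteq> span (b ` (?W - {w}))"
        using w by (auto intro: span_base)
    qed auto
  qed (intro span_mono, auto)
  have ev_profiles: "\<forall>\<^sub>F m in sequentially. (\<chi> l. f m l) \<notin> profiles (b' m) (?W - {w})"
    if "w \<in> ?W" "\<And>l. (\<lambda>m. f m l) \<longlonglongrightarrow> f0 l" "(\<chi> l. f0 l) \<notin> profiles b (?W - {w})" for w f f0
  proof (rule eventually_notin_profiles[OF _ _ _ that(3)])
    show "b' m l \<in> span (b ` (?W - {w}))" if "l \<in> ?W - {w}" for m l
      using b'_span[of l m] that span_W[OF \<open>w \<in> ?W\<close>] by simp
  qed (use that(2) lim_b in auto)
  have ev_locale: "\<forall>\<^sub>F m in sequentially. vertex_splitting V A u v \<tau> e (b' m) (\<rho> m)"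
  proof -
    have "(\<lambda>m. \<eta> m * (\<Sum>j\<in>?U. \<tau> j * (b' m u \<bullet> b' m j))) \<longlonglongrightarrow> 0 * (\<Sum>j\<in>?U. \<tau> j * (b u \<bullet> b j))"
      by (intro tendsto_intros lim_b eta(2))
    then have "\<forall>\<^sub>F m in sequentially. \<eta> m * (\<Sum>j\<in>?U. \<tau> j * (b' m u \<bullet> b' m j)) < 1"
      by (rule order_tendstoD) simp
    moreover have "\<forall>\<^sub>F m in sequentially. \<forall>i\<in>?W. \<forall>j\<in>?W. ?M i j \<longrightarrow>
        b' m i \<bullet> b' m j + \<eta> m * \<tau> i * \<tau> j * (b' m u \<bullet> b' m i) * (b' m u \<bullet> b' m j) \<noteq> 0"
    proof (intro eventually_ball_finite finite ballI)
      fix i j assume ij: "i \<in> ?W" "j \<in> ?W"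
      show "\<forall>\<^sub>F m in sequentially. ?M i j \<longrightarrow>
        b' m i \<bullet> b' m j + \<eta> m * \<tau> i * \<tau> j * (b' m u \<bullet> b' m i) * (b' m u \<bullet> b' m j) \<noteq> 0"
      proof (cases "?M i j")
        case True
        have "(\<lambda>m. b' m i \<bullet> b' m j + \<eta> m * \<tau> i * \<tau> j * (b' m u \<bullet> b' m i) * (b' m u \<bullet> b' m j))
            \<longlonglongrightarrow> b i \<bullet> b j + 0 * \<tau> i * \<tau> j * (b u \<bullet> b i) * (b u \<bullet> b j)"
          by (intro tendsto_intros lim_b eta(2))
        then show ?thesis
          using tendsto_imp_eventually_ne True rep_gram[OF ij] by (fastforce simp: merge_def)
      qed simp
    qed
    ultimately show ?thesis
    proof eventually_elim
      case (elim m)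
      show ?case
      proof
        show "b' m i \<bullet> b' m j + (\<rho> m)\<^sup>2 * \<tau> i * \<tau> j * (b' m u \<bullet> b' m i) * (b' m u \<bullet> b' m j) \<noteq> 0 \<longleftrightarrow> ?M i j"
          if "i \<in> ?W" "j \<in> ?W" "i \<noteq> j" for i j
          using elim(2) b'_orth[OF that] that unfolding rho by blast
      qed (use elim(1) sym uv tau b'_sum b'_span e rho in auto)
    qed
  qed
  have ev_axis: "\<forall>\<^sub>F m in sequentially. \<forall>i\<in>?W. \<forall>j\<in>?W. i \<noteq> j \<longrightarrow> axis i 1 \<notin> profiles (b' m) (?W - {j})"
  proof (intro eventually_ball_finite finite ballI)
    fix i j assume ij: "i \<in> ?W" "j \<in> ?W"
    show "\<forall>\<^sub>F m in sequentially. i \<noteq> j \<longrightarrow> axis i 1 \<notin> profiles (b' m) (?W - {j})"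
      using rep_axis[OF ij] unfolding axis_def by (cases "i = j") (auto intro!: ev_profiles[OF ij(2)])
  qed
  have ev_nb: "\<forall>\<^sub>F m in sequentially. \<forall>i\<in>?U.
      (\<chi> l. if l = u then 1 else - (\<eta> m * \<alpha> m l)) \<notin> profiles (b' m) (?W - {i})"
  proof (intro eventually_ball_finite finite ballI)
    fix i assume i: "i \<in> ?U"
    show "\<forall>\<^sub>F m in sequentially. (\<chi> l. if l = u then 1 else - (\<eta> m * \<alpha> m l)) \<notin> profiles (b' m) (?W - {i})"
    proof (rule ev_profiles[where ?f0.0 = "\<lambda>l. if l = u then 1 else 0"])
      have "(\<lambda>m. - (\<eta> m * \<alpha> m l)) \<longlonglongrightarrow> - (0 * \<alpha>0 l)" for l
        by (intro tendsto_intros eta lim_a)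
      then show "(\<lambda>m. if l = u then 1 else - (\<eta> m * \<alpha> m l)) \<longlonglongrightarrow> (if l = u then 1 else 0)" for l
        by simp
      show "(\<chi> l. if l = u then 1 else 0) \<notin> profiles b (?W - {i})"
        using rep_axis[of u i] i uv by (auto simp: axis_def)
    qed (use i in auto)
  qed
  \<comment> \<open>This is what separates \<open>u\<close> from \<open>v\<close>: the set of all
    edges that \<open>v\<close> takes over is one of the star parts covered by \<open>gen_v\<close>,
    nonempty by \<open>nv\<close>.\<close>
  have ev_edge: "\<forall>\<^sub>F m in sequentially. (\<chi> l. \<alpha> m l) \<notin> profiles (b' m) (?W - {u})"
  proof (rule ev_profiles[OF _ lim_a])
    show "(\<chi> l. \<alpha>0 l) \<notin> profiles b (?W - {u})"
    proof
      assume "(\<chi> l. \<alpha>0 l) \<in> profiles b (?W - {u})"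
      then have "(\<chi> l. if l \<in> {j \<in> ?U. A v j} then \<tau> l * (b u \<bullet> b l) else 0) \<in> profiles b (?W - {u})"
        by (rule profiles_cong) (use tau(1) in \<open>auto simp: \<alpha>0_def\<close>)
      then show False
        using gen_v[of "{j \<in> ?U. A v j}"] nv by auto
    qed
  qed (use uv in auto)
  have ev_star: "\<forall>\<^sub>F m in sequentially. \<forall>w\<in>?U. \<forall>X\<in>{X. X \<noteq> {} \<and> X \<subset> {l \<in> V. l \<noteq> w \<and> A w l}}.
    (\<chi> l. if l = u then (if v \<in> X then \<alpha> m w else 0) + (if u \<in> X then b' m w \<bullet> b' m u - \<alpha> m w else 0)
      else (if l \<in> X then b' m w \<bullet> b' m l + \<eta> m * \<alpha> m w * \<alpha> m l else 0) - (if v \<in> X then \<eta> m * \<alpha> m w * \<alpha> m l else 0))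
    \<notin> profiles (b' m) (?W - {w})"
  proof (intro eventually_ball_finite finite ballI)
    fix w X assume w: "w \<in> ?U" and "X \<in> {X. X \<noteq> {} \<and> X \<subset> {l \<in> V. l \<noteq> w \<and> A w l}}"
    then have X: "X \<noteq> {}" "X \<subseteq> {l \<in> V. l \<noteq> w \<and> A w l}" "\<exists>z\<in>V. z \<noteq> w \<and> A w z \<and> z \<notin> X"
      by auto
    define f0 where "f0 = (\<lambda>l. if l = u then (if v \<in> X then \<alpha>0 w else 0) + (if u \<in> X then b w \<bullet> b u - \<alpha>0 w else 0)
      else if l \<in> X then b w \<bullet> b l else 0)"
    show "\<forall>\<^sub>F m in sequentially.
    (\<chi> l. if l = u then (if v \<in> X then \<alpha> m w else 0) + (if u \<in> X then b' m w \<bullet> b' m u - \<alpha> m w else 0)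
      else (if l \<in> X then b' m w \<bullet> b' m l + \<eta> m * \<alpha> m w * \<alpha> m l else 0) - (if v \<in> X then \<eta> m * \<alpha> m w * \<alpha> m l else 0))
    \<notin> profiles (b' m) (?W - {w})"
    proof (rule ev_profiles[where ?f0.0 = f0])
      fix l
      have z: "(\<lambda>m. \<eta> m * \<alpha> m w * \<alpha> m l) \<longlonglongrightarrow> 0 * \<alpha>0 w * \<alpha>0 l"
        by (intro tendsto_intros eta lim_a)
      have "(\<lambda>m. b' m w \<bullet> b' m l + \<eta> m * \<alpha> m w * \<alpha> m l) \<longlonglongrightarrow> b w \<bullet> b l + 0"
        using z by (intro tendsto_intros lim_b) simp
      moreover have "(\<lambda>m. b' m w \<bullet> b' m u - \<alpha> m w) \<longlonglongrightarrow> b w \<bullet> b u - \<alpha>0 w"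
        by (intro tendsto_intros lim_a lim_b)
      moreover have "(\<lambda>m. if l \<in> X then b' m w \<bullet> b' m l + \<eta> m * \<alpha> m w * \<alpha> m l else 0)
          \<longlonglongrightarrow> (if l \<in> X then b w \<bullet> b l else 0)"
        using calculation(1) by simp
      moreover have "(\<lambda>m. if v \<in> X then \<eta> m * \<alpha> m w * \<alpha> m l else 0) \<longlonglongrightarrow> 0"
        using z by (cases "v \<in> X") simp_all
      moreover have "(\<lambda>m. (if l \<in> X then b' m w \<bullet> b' m l + \<eta> m * \<alpha> m w * \<alpha> m l else 0) - (if v \<in> X then \<eta> m * \<alpha> m w * \<alpha> m l else 0))
          \<longlonglongrightarrow> (if l \<in> X then b w \<bullet> b l else 0) - 0"
        by (intro tendsto_diff calculation)
      moreover have "(\<lambda>m. (if v \<in> X then \<alpha> m w else 0) + (if u \<in> X then b' m w \<bullet> b' m u - \<alpha> m w else 0)) \<longlonglongrightarrow>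
          (if v \<in> X then \<alpha>0 w else 0) + (if u \<in> X then b w \<bullet> b u - \<alpha>0 w else 0)"
        using calculation(2) lim_a[of w] by (intro tendsto_add) (simp_all split: if_splits)
      ultimately show "(\<lambda>m. if l = u then (if v \<in> X then \<alpha> m w else 0) + (if u \<in> X then b' m w \<bullet> b' m u - \<alpha> m w else 0)
        else (if l \<in> X then b' m w \<bullet> b' m l + \<eta> m * \<alpha> m w * \<alpha> m l else 0) - (if v \<in> X then \<eta> m * \<alpha> m w * \<alpha> m l else 0))
        \<longlonglongrightarrow> f0 l"
        by (cases "l = u") (simp_all add: f0_def)
    next
      show "(\<chi> l. f0 l) \<notin> profiles b (?W - {w})"
      \<comment> \<open>If exactly one share of a divided edge is present, the generic choice of
        \<open>\<tau>\<close> applies. Otherwise the limit is the profile of a part of the old star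
        of \<open>w\<close>, namely of \<open>X\<close> with \<open>v\<close> replaced by
        \<open>u\<close>.\<close>
      proof (cases "A u w \<and> A v w \<and> (u \<in> X \<longleftrightarrow> v \<notin> X)")
        case True
        have "(\<chi> l. f0 l) = (\<chi> l. if l = u then (if v \<in> X then \<tau> w else 1 - \<tau> w) * (b w \<bullet> b u) else if l \<in> X then b w \<bullet> b l else 0)"
          using True by (auto simp: f0_def \<alpha>0_def vec_eq_iff inner_commute[of "b u"] left_diff_distrib)
        then show ?thesis
          using gen_w[of w "if v \<in> X then \<tau> w else 1 - \<tau> w" X] w True by (simp split: if_splits)
      next
        case False
        define X' where "X' = (X - {v}) \<union> (if v \<in> X then {u} else {})"
        have "X' \<noteq> {}"
          using X(1) by (auto simp: X'_def)
        moreover have "X' \<subset> {l \<in> ?W. l \<noteq> w \<and> ?M w l}"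
        proof
          show "X' \<subseteq> {l \<in> ?W. l \<noteq> w \<and> ?M w l}"
            using X(2) w uv by (auto simp: X'_def merge_def)
          obtain z where z: "z \<in> V" "z \<noteq> w" "A w z" "z \<notin> X"
            using X(3) by auto
          show "X' \<noteq> {l \<in> ?W. l \<noteq> w \<and> ?M w l}"
          proof (cases "z = v")
            case True
            then have "u \<in> {l \<in> ?W. l \<noteq> w \<and> ?M w l}"
              using z w uv by (auto simp: merge_def)
            moreover have "u \<notin> X'"
              using True z False X(2) sym by (auto simp: X'_def)
            ultimately show ?thesis by auto
          next
            case z_v: False
            then have "z \<in> {l \<in> ?W. l \<noteq> w \<and> ?M w l}"
              using z by (auto simp: merge_def)
            moreover have "z \<notin> X'"
              using z False X(2) sym by (auto simp: X'_def)
            ultimately show ?thesis by auto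
          qed
        qed
        ultimately have star: "(\<chi> l. if l \<in> X' then b w \<bullet> b l else 0) \<notin> profiles b (?W - {w})"
          using w by (intro rep_star) auto
        have fu: "f0 u = (if u \<in> X' then b w \<bullet> b u else 0)"
        proof -
          have "u \<in> X \<Longrightarrow> A u w" "v \<in> X \<Longrightarrow> A v w"
            using X(2) sym by auto
          then show ?thesis
            using False w uv tau(1)[of w] tau(2)[of w]
            by (cases "A u w"; cases "A v w") (auto simp: f0_def \<alpha>0_def X'_def inner_commute[of "b u"])
        qed
        have f0_eq: "f0 l = (if l \<in> X' then b w \<bullet> b l else 0)" if "l \<in> ?W" for l
          using fu that by (cases "l = u") (auto simp: f0_def X'_def)
        show ?thesis
        proof
          assume "(\<chi> l. f0 l) \<in> profiles b (?W - {w})"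
          then have "(\<chi> l. if l \<in> X' then b w \<bullet> b l else 0) \<in> profiles b (?W - {w})"
            by (rule profiles_cong) (use f0_eq in auto)
          then show False
            using star by contradiction
        qed
      qed
    qed (use w in auto)
  qed
  have ev_star_u: "\<forall>\<^sub>F m in sequentially. \<forall>X\<in>{X. X \<noteq> {} \<and> X \<subset> {l \<in> V. l \<noteq> u \<and> A u l}}.
    (\<chi> l. (if l \<in> X then b' m u \<bullet> b' m l - \<alpha> m l else 0) + (if v \<in> X then \<alpha> m l else 0)) \<notin> profiles (b' m) (?W - {u})"
  proof (intro eventually_ball_finite finite ballI)
    fix X assume "X \<in> {X. X \<noteq> {} \<and> X \<subset> {l \<in> V. l \<noteq> u \<and> A u l}}"
    then have X: "X \<noteq> {}" "X \<subseteq> {l \<in> V. l \<noteq> u \<and> A u l}" "\<exists>z\<in>V. z \<noteq> u \<and> A u z \<and> z \<notin> X"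
      by auto
    let ?f0 = "\<lambda>l. (if l \<in> X then b u \<bullet> b l - \<alpha>0 l else 0) + (if v \<in> X then \<alpha>0 l else 0)"
    show "\<forall>\<^sub>F m in sequentially. (\<chi> l. (if l \<in> X then b' m u \<bullet> b' m l - \<alpha> m l else 0) + (if v \<in> X then \<alpha> m l else 0)) \<notin> profiles (b' m) (?W - {u})"
    proof (rule ev_profiles[where ?f0.0 = ?f0])
      have "(\<lambda>m. b' m u \<bullet> b' m l - \<alpha> m l) \<longlonglongrightarrow> b u \<bullet> b l - \<alpha>0 l" for l
        by (intro tendsto_intros lim_a lim_b)
      then show "(\<lambda>m. (if l \<in> X then b' m u \<bullet> b' m l - \<alpha> m l else 0) + (if v \<in> X then \<alpha> m l else 0)) \<longlonglongrightarrow> ?f0 l" for l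
        using lim_a[of l] by (intro tendsto_add) (cases "l \<in> X"; cases "v \<in> X"; simp)+
      show "(\<chi> l. ?f0 l) \<notin> profiles b (?W - {u})"
      proof
        assume f0: "(\<chi> l. ?f0 l) \<in> profiles b (?W - {u})"
        show False
        proof (cases "v \<in> X")
          case False
          then have "X \<subseteq> {j \<in> ?U. A u j}"
            using X(2) by auto
          moreover have "(\<chi> l. if l \<in> X then (1 - \<tau> l) * (b u \<bullet> b l) else 0) \<in> profiles b (?W - {u})"
            by (rule profiles_cong[OF f0]) (use False in \<open>auto simp: \<alpha>0_def left_diff_distrib\<close>)
          ultimately show False
            using gen_u X(1) by blast
        next
          case True
          let ?Y = "{j \<in> ?U. A u j} - X"
          \<comment> \<open>If \<open>X\<close> contains the new edge, pass to the complement: the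
            whole old star of \<open>u\<close> is in equilibrium, with \<open>y = b u\<close> as
            witness, and subtracting leaves the edges of \<open>u\<close> missing from
            \<open>X\<close>.\<close>
          have "(\<chi> l. b u \<bullet> b l) \<in> profiles b (?W - {u})"
            unfolding profiles_def by auto
          from subspace_diff[OF subspace_profiles this f0]
          have "(\<chi> l. if l \<in> ?Y then (1 - \<tau> l) * (b u \<bullet> b l) else 0) \<in> profiles b (?W - {u})"
          proof (rule profiles_cong)
            fix l assume "l \<in> ?W - {u}"
            then have l: "l \<in> ?U" by auto
            have "\<not> A u l \<Longrightarrow> \<not> A v l \<Longrightarrow> b u \<bullet> b l = 0"
              using rep_gram[of u l] l uv by (auto simp: merge_def)
            then show "((\<chi> l. b u \<bullet> b l) - (\<chi> l. ?f0 l)) $ l = (\<chi> l. if l \<in> ?Y then (1 - \<tau> l) * (b u \<bullet> b l) else 0) $ l"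
              using True l tau(2)[of l] by (cases "A u l"; cases "A v l") (auto simp: \<alpha>0_def left_diff_distrib)
          qed
          moreover have "?Y \<noteq> {}"
            using X(3) True by auto
          ultimately show False
            using gen_u[of ?Y] by blast
        qed
      qed
    qed (use uv in auto)
  qed
  have ev_star_v: "\<forall>\<^sub>F m in sequentially. \<forall>X\<in>{X. X \<noteq> {} \<and> X \<subset> {l \<in> V. l \<noteq> v \<and> A v l}}.
    (\<chi> l. (if l \<in> X then \<alpha> m l * (1 - \<eta> m * (\<Sum>j\<in>?U. \<alpha> m j)) else 0)
      - \<alpha> m l * ((if u \<in> X then 1 else 0) - \<eta> m * (\<Sum>j\<in>X - {u}. \<alpha> m j))) \<notin> profiles (b' m) (?W - {u})"
  proof (intro eventually_ball_finite finite ballI)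
    fix X assume "X \<in> {X. X \<noteq> {} \<and> X \<subset> {l \<in> V. l \<noteq> v \<and> A v l}}"
    then have X: "X \<noteq> {}" "X \<subseteq> {l \<in> V. l \<noteq> v \<and> A v l}" "\<exists>z\<in>V. z \<noteq> v \<and> A v z \<and> z \<notin> X"
      by auto
    let ?f0 = "\<lambda>l. (if l \<in> X then \<alpha>0 l * (1 - 0 * (\<Sum>j\<in>?U. \<alpha>0 j)) else 0)
      - \<alpha>0 l * ((if u \<in> X then 1 else 0) - 0 * (\<Sum>j\<in>X - {u}. \<alpha>0 j))"
    show "\<forall>\<^sub>F m in sequentially. (\<chi> l. (if l \<in> X then \<alpha> m l * (1 - \<eta> m * (\<Sum>j\<in>?U. \<alpha> m j)) else 0)
      - \<alpha> m l * ((if u \<in> X then 1 else 0) - \<eta> m * (\<Sum>j\<in>X - {u}. \<alpha> m j))) \<notin> profiles (b' m) (?W - {u})"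
    proof (rule ev_profiles[where ?f0.0 = ?f0])
      have "(\<lambda>m. \<alpha> m l * (1 - \<eta> m * (\<Sum>j\<in>?U. \<alpha> m j))) \<longlonglongrightarrow> \<alpha>0 l * (1 - 0 * (\<Sum>j\<in>?U. \<alpha>0 j))" for l
        by (intro tendsto_intros lim_a eta)
      moreover have "(\<lambda>m. \<alpha> m l * ((if u \<in> X then 1 else 0) - \<eta> m * (\<Sum>j\<in>X - {u}. \<alpha> m j))) \<longlonglongrightarrow>
          \<alpha>0 l * ((if u \<in> X then 1 else 0) - 0 * (\<Sum>j\<in>X - {u}. \<alpha>0 j))" for l
        by (intro tendsto_intros lim_a eta)
      ultimately show "(\<lambda>m. (if l \<in> X then \<alpha> m l * (1 - \<eta> m * (\<Sum>j\<in>?U. \<alpha> m j)) else 0)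
        - \<alpha> m l * ((if u \<in> X then 1 else 0) - \<eta> m * (\<Sum>j\<in>X - {u}. \<alpha> m j))) \<longlonglongrightarrow> ?f0 l" for l
        by (intro tendsto_diff) simp_all
      show "(\<chi> l. ?f0 l) \<notin> profiles b (?W - {u})"
      proof
        assume f0: "(\<chi> l. ?f0 l) \<in> profiles b (?W - {u})"
        show False
        proof (cases "u \<in> X")
          case False
          then have "X \<subseteq> {j \<in> ?U. A v j}"
            using X(2) by auto
          moreover have "(\<chi> l. if l \<in> X then \<tau> l * (b u \<bullet> b l) else 0) \<in> profiles b (?W - {u})"
            by (rule profiles_cong[OF f0]) (use False in \<open>auto simp: \<alpha>0_def\<close>)
          ultimately show False
            using gen_v X(1) by blast
        next
          case True
          let ?Y = "{j \<in> ?U. A v j} - X"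
          \<comment> \<open>The new edge contributes minus the whole vector
            \<open>\<alpha>0\<close>, so what remains is the negative of the edges of
            \<open>v\<close> missing from \<open>X\<close>.\<close>
          have "(\<chi> l. if l \<in> ?Y then \<tau> l * (b u \<bullet> b l) else 0) \<in> profiles b (?W - {u})"
            by (rule profiles_uminus_cong[OF f0]) (use True tau(1) in \<open>auto simp: \<alpha>0_def\<close>)
          moreover have "?Y \<noteq> {}"
            using X(3) True by auto
          ultimately show False
            using gen_v[of ?Y] by blast
        qed
      qed
    qed (use uv in auto)
  qed
  \<comment> \<open>The perturbed vectors must not lose rank either: the final dimension count needs
    that they still span the old space.\<close>
  have ev_span: "\<forall>\<^sub>F m in sequentially. \<forall>y\<in>span (b ` ?W). (\<chi> l. if l \<in> ?W then y \<bullet> b' m l else 0) = (0::real^'v) \<longrightarrow> y = 0"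
  proof (rule eventually_inj_on_subspace[where ?T0.0 = "\<lambda>y. \<chi> l. if l \<in> ?W then y \<bullet> b l else 0"])
    show "linear (\<lambda>y. (\<chi> l. if l \<in> ?W then y \<bullet> b l else 0) :: real^'v)"
      by (rule linearI) (auto simp: vec_eq_iff inner_add_left)
    show "linear (\<lambda>y. (\<chi> l. if l \<in> ?W then y \<bullet> b' m l else 0) :: real^'v)" for m
      by (rule linearI) (auto simp: vec_eq_iff inner_add_left)
    show "(\<lambda>m. (\<chi> l. if l \<in> ?W then y \<bullet> b' m l else 0) :: real^'v) \<longlonglongrightarrow> (\<chi> l. if l \<in> ?W then y \<bullet> b l else 0)" for y
    proof (rule vec_tendstoI)
      show "(\<lambda>m. (\<chi> l. if l \<in> ?W then y \<bullet> b' m l else 0) $ i) \<longlonglongrightarrow> (\<chi> l. if l \<in> ?W then y \<bullet> b l else 0) $ i" for i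
        using tendsto_inner[OF tendsto_const lim_b[of i], of y] by (cases "i \<in> ?W") auto
    qed
    show "y = 0" if "y \<in> span (b ` ?W)" "(\<chi> l. if l \<in> ?W then y \<bullet> b l else 0) = (0::real^'v)" for y
      using that(1)
    proof (rule orthogonal_span_eq_0)
      fix x assume "x \<in> b ` ?W"
      then obtain l where l: "l \<in> ?W" "x = b l" by blast
      have "(\<chi> l. if l \<in> ?W then y \<bullet> b l else 0) $ l = (0::real)"
        by (simp only: that(2) zero_index)
      then show "y \<bullet> x = 0"
        using l by simp
    qed
  qed auto
  define S where "S = {N :: real^'v^'v. (\<forall>i j. N $ i $ j = N $ j $ i) \<and>
    (\<forall>i j. N $ i $ j \<noteq> 0 \<longrightarrow> i \<in> V \<and> j \<in> V \<and> i \<noteq> j \<and> \<not> A i j)}"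
  \<comment> \<open>The two relations of \<open>self_stress_c\<close> as one linear map, with
    \<open>h\<close> for \<open>\<rho>\<^sup>2\<close>. They are rescaled so that they remain
    meaningful at \<open>h = 0\<close>, and the domain \<open>S\<close>, built from the adjacency
    after the split, is the same for all \<open>m\<close>.\<close>
  define T :: "real \<Rightarrow> ('v \<Rightarrow> real) \<Rightarrow> ('v \<Rightarrow> 'a) \<Rightarrow> real^'v^'v \<Rightarrow> ('a^'v) \<times> (real^'v)" where
    "T = (\<lambda>h a B N.
      (\<chi> i. if i \<in> ?W then (\<Sum>j\<in>?W. N $ i $ j *\<^sub>R B j) - (\<Sum>j\<in>?W. N $ v $ j *\<^sub>R B j) else 0,
       \<chi> i. if i \<in> ?U then N $ i $ v * (1 - h * (\<Sum>j\<in>?U. a j)) - N $ i $ u + h * (\<Sum>j\<in>?U. N $ i $ j * a j) else 0))"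
  have T_lin: "linear (T h a B)" for h a B
    by (rule linearI)
      (auto simp: T_def vec_eq_iff scaleR_left_distrib sum.distrib algebra_simps scaleR_sum_right sum_distrib_left)
  have ev_sap: "\<forall>\<^sub>F m in sequentially. \<forall>N\<in>S. T (\<eta> m) (\<alpha> m) (b' m) N = 0 \<longrightarrow> N = 0"
  proof (rule eventually_inj_on_subspace[OF _ T_lin[of 0 \<alpha>0 b] T_lin])
    show "subspace S"
    proof (rule subspaceI)
      show "x + y \<in> S" if "x \<in> S" "y \<in> S" for x y
      proof -
        have "i \<in> V \<and> j \<in> V \<and> i \<noteq> j \<and> \<not> A i j" if "(x + y) $ i $ j \<noteq> 0" for i j
        proof -
          have "x $ i $ j \<noteq> 0 \<or> y $ i $ j \<noteq> 0"
            using that by auto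
          then show ?thesis
            using \<open>x \<in> S\<close> \<open>y \<in> S\<close> unfolding S_def by blast
        qed
        moreover have "(x + y) $ i $ j = (x + y) $ j $ i" for i j
          using that by (simp add: S_def)
        ultimately show ?thesis
          unfolding S_def by blast
      qed
    qed (auto simp: S_def)
    show "(\<lambda>m. T (\<eta> m) (\<alpha> m) (b' m) N) \<longlonglongrightarrow> T 0 \<alpha>0 b N" for N
      unfolding T_def
    proof (intro tendsto_Pair vec_tendstoI)
      fix i
      have "(\<lambda>m. (\<Sum>j\<in>?W. N $ i $ j *\<^sub>R b' m j) - (\<Sum>j\<in>?W. N $ v $ j *\<^sub>R b' m j)) \<longlonglongrightarrow>
          (\<Sum>j\<in>?W. N $ i $ j *\<^sub>R b j) - (\<Sum>j\<in>?W. N $ v $ j *\<^sub>R b j)"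
        by (intro tendsto_intros lim_b)
      then show "(\<lambda>m. (\<chi> i. if i \<in> ?W then (\<Sum>j\<in>?W. N $ i $ j *\<^sub>R b' m j) - (\<Sum>j\<in>?W. N $ v $ j *\<^sub>R b' m j) else 0) $ i) \<longlonglongrightarrow>
          (\<chi> i. if i \<in> ?W then (\<Sum>j\<in>?W. N $ i $ j *\<^sub>R b j) - (\<Sum>j\<in>?W. N $ v $ j *\<^sub>R b j) else 0) $ i"
        by (cases "i \<in> ?W") auto
      have "(\<lambda>m. N $ i $ v * (1 - \<eta> m * (\<Sum>j\<in>?U. \<alpha> m j)) - N $ i $ u + \<eta> m * (\<Sum>j\<in>?U. N $ i $ j * \<alpha> m j)) \<longlonglongrightarrow>
          N $ i $ v * (1 - 0 * (\<Sum>j\<in>?U. \<alpha>0 j)) - N $ i $ u + 0 * (\<Sum>j\<in>?U. N $ i $ j * \<alpha>0 j)"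
        by (intro tendsto_intros lim_a eta)
      then show "(\<lambda>m. (\<chi> i. if i \<in> ?U then N $ i $ v * (1 - \<eta> m * (\<Sum>j\<in>?U. \<alpha> m j)) - N $ i $ u + \<eta> m * (\<Sum>j\<in>?U. N $ i $ j * \<alpha> m j) else 0) $ i) \<longlonglongrightarrow>
          (\<chi> i. if i \<in> ?U then N $ i $ v * (1 - 0 * (\<Sum>j\<in>?U. \<alpha>0 j)) - N $ i $ u + 0 * (\<Sum>j\<in>?U. N $ i $ j * \<alpha>0 j) else 0) $ i"
        by (cases "i \<in> ?U") auto
    qed
    show "N = 0" if N: "N \<in> S" "T 0 \<alpha>0 b N = 0" for N
    proof -
      have Nsym: "N $ i $ j = N $ j $ i" for i j
        using N(1) by (simp add: S_def)
      have Nsupp: "N $ i $ j = 0" if "i \<notin> V \<or> j \<notin> V \<or> i = j \<or> A i j" for i j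
        using N(1) that unfolding S_def by blast
      have T1: "fst (T 0 \<alpha>0 b N) $ i = 0" and T2: "snd (T 0 \<alpha>0 b N) $ i = 0" for i
        by (simp_all add: N(2))
      have eq1: "(\<Sum>j\<in>?W. N $ i $ j *\<^sub>R b j) = (\<Sum>j\<in>?W. N $ v $ j *\<^sub>R b j)" if "i \<in> ?W" for i
        using T1[of i] that by (simp add: T_def)
      \<comment> \<open>One side vanishes at the neighbours of \<open>v\<close>, the other at the
        neighbours of \<open>u\<close>. By equality both vanish at every neighbour of the merged
        vertex, so the restriction of \<open>N\<close> to \<open>?W\<close> respects the merged
        graph and \<open>rep_sap\<close> applies.\<close>
      have eq2: "N $ i $ v = N $ i $ u" if "i \<in> ?U" for i
        using T2[of i] that by (simp add: T_def)
      define N' :: "real^'v^'v" where "N' = (\<chi> i j. if i \<in> ?W \<and> j \<in> ?W then N $ i $ j else 0)"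
      have "N' = 0"
      proof (rule rep_sap)
        show "\<forall>i j. N' $ i $ j = N' $ j $ i"
          using Nsym by (auto simp: N'_def)
        show "\<forall>i\<in>?W. (\<Sum>j\<in>?W. N' $ i $ j *\<^sub>R b j) = (\<Sum>j\<in>?W. N $ v $ j *\<^sub>R b j)"
          using eq1 by (simp add: N'_def)
        show "\<forall>i j. N' $ i $ j \<noteq> 0 \<longrightarrow> i \<in> ?W \<and> j \<in> ?W \<and> i \<noteq> j \<and> \<not> ?M i j"
        proof (intro allI impI)
          fix i j assume ij: "N' $ i $ j \<noteq> 0"
          then have W: "i \<in> ?W" "j \<in> ?W" and n: "N $ i $ j \<noteq> 0"
            by (auto simp: N'_def split: if_splits)
          have "i \<noteq> j" "\<not> A i j"
            using n Nsupp by blast+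
          moreover have "\<not> A v j" if "i = u"
            using n that eq2[of j] W Nsym Nsupp[of v j] \<open>i \<noteq> j\<close> by auto
          moreover have "\<not> A i v" if "j = u"
            using n that eq2[of i] W Nsupp[of i v] \<open>i \<noteq> j\<close> by auto
          ultimately show "i \<in> ?W \<and> j \<in> ?W \<and> i \<noteq> j \<and> \<not> ?M i j"
            using W by (auto simp: merge_def)
        qed
      qed
      then have NW: "N $ i $ j = 0" if "i \<in> ?W" "j \<in> ?W" for i j
        using that by (auto simp: N'_def vec_eq_iff split: if_splits)
      have Nv: "N $ i $ v = 0" for i
        using eq2[of i] NW[of i u] Nsupp[of i v] Nsupp[of u v] uv by (cases "i \<in> ?U") auto
      have "N $ i $ j = 0" for i j
        using NW[of i j] Nv[of i] Nv[of j] Nsym[of v j] Nsupp[of i j] by (cases "i \<in> ?W \<and> j \<in> ?W") auto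
      then show ?thesis
        by (simp add: vec_eq_iff)
    qed
  qed
  have "\<forall>\<^sub>F m in sequentially. \<exists>c :: 'v \<Rightarrow> 'a. stable_representation V A c \<and> dim (c ` V) = Suc (dim (b ` ?W))"
    using ev_locale ev_axis ev_nb ev_edge ev_star ev_star_u ev_star_v ev_span ev_sap
  proof eventually_elim
    case (elim m)
    interpret vertex_splitting V A u v \<tau> e "b' m" "\<rho> m"
      by (rule elim(1))
    have a: "a = \<alpha> m"
      by (simp add: a_def \<alpha>_def fun_eq_iff)
    have span: "span (b' m ` ?W) = span (b ` ?W)"
    proof (rule subset_antisym)
      show "span (b' m ` ?W) \<subseteq> span (b ` ?W)"
        using b'_span by (intro span_minimal) auto
      show "span (b ` ?W) \<subseteq> span (b' m ` ?W)"
      proof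
        fix x assume x: "x \<in> span (b ` ?W)"
        obtain z z' where z: "z \<in> span (b' m ` ?W)" "\<And>w. w \<in> span (b' m ` ?W) \<Longrightarrow> orthogonal z' w" "x = z + z'"
          using orthogonal_subspace_decomp_exists[of "b' m ` ?W" x] by metis
        have "z' \<in> span (b ` ?W)"
          using span_diff[OF x, of z] z(1,3) \<open>span (b' m ` ?W) \<subseteq> span (b ` ?W)\<close> by auto
        moreover have "(\<chi> l. if l \<in> ?W then z' \<bullet> b' m l else 0) = (0::real^'v)"
          using z(2) by (auto simp: vec_eq_iff orthogonal_def span_base)
        ultimately have "z' = 0"
          using elim(8) by blast
        then show "x \<in> span (b' m ` ?W)"
          using z by simp
      qed
    qed
    have "e \<notin> span (b ` ?W)"
      using e by auto
    moreover have "span (c ` V) = span (insert e (b ` ?W))"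
      by (simp only: span_c span_insert span)
    then have "dim (c ` V) = dim (insert e (b ` ?W))"
      by (metis dim_span)
    ultimately have "dim (c ` V) = Suc (dim (b ` ?W))"
      by (simp add: dim_insert)
    moreover have "stable_representation V A c"
      unfolding stable_representation_def
    proof (intro conjI ballI allI impI)
      show "(\<Sum>i\<in>V. c i) = 0"
        by (rule sum_c)
      show "c i \<bullet> c j \<noteq> 0 \<longleftrightarrow> A i j" if "i \<in> V" "j \<in> V" "i \<noteq> j" for i j
        by (rule gram_c[OF that])
      have no_v: "axis i 1 \<notin> profiles c (V - {v})" if "i \<in> ?W" for i
      proof (cases "i = u")
        case True
        then show ?thesis
          using axis_profiles_c_edge elim(4) a by auto
      next
        case False
        then show ?thesis
          using axis_profiles_c_neighbour[of i, unfolded a rho_eta] elim(3) that by auto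
      qed
      show "axis i 1 \<notin> profiles c (V - {j})" if ij: "i \<in> V" "j \<in> V" "i \<noteq> j" for i j
      proof -
        consider "i \<in> ?W" "j \<in> ?W" | "i \<in> ?W" "j = v" | "i = v" "j \<in> ?W"
          using ij by auto
        then show ?thesis
        proof cases
          case 1
          then show ?thesis
            using elim(2) axis_profiles_c_old ij by blast
        next
          case 2
          then show ?thesis
            using no_v by simp
        next
          case 3
          then show ?thesis
            using no_v axis_profiles_c_swap ij by blast
        qed
      qed
      show "(\<chi> l. if l \<in> X then c w \<bullet> c l else 0) \<notin> profiles c (V - {w})"
        if w: "w \<in> V" and X: "X \<noteq> {}" "X \<subset> {l \<in> V. l \<noteq> w \<and> A w l}" for w X
      proof -
        consider "w \<in> ?U" | "w = u" | "w = v"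
          using w by auto
        then show ?thesis
        proof cases
          case 1
          then show ?thesis
            using star_profiles_c_old[of w X, unfolded a rho_eta] elim(5) X by blast
        next
          case 2
          then show ?thesis
            using star_profiles_c_u[of X, unfolded a rho_eta] elim(6) X by blast
        next
          case 3
          then show ?thesis
            using star_profiles_c_v[of X, unfolded a rho_eta] elim(7) X by blast
        qed
      qed
      show "N = 0" if N: "\<forall>i j. N $ i $ j = N $ j $ i"
        "\<forall>i j. N $ i $ j \<noteq> 0 \<longrightarrow> i \<in> V \<and> j \<in> V \<and> i \<noteq> j \<and> \<not> A i j"
        "\<forall>i\<in>V. (\<Sum>j\<in>V. N $ i $ j *\<^sub>R c j) = t" for N :: "real^'v^'v" and t
      proof -
        have "T (\<eta> m) (\<alpha> m) (b' m) N = 0"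
        proof -
          have Ns: "N $ i $ j = N $ j $ i" "N $ i $ j \<noteq> 0 \<Longrightarrow> i \<in> V \<and> j \<in> V \<and> i \<noteq> j \<and> \<not> A i j" for i j
            using N(1,2) by blast+
          have Nt: "(\<Sum>j\<in>V. N $ i $ j *\<^sub>R c j) = t" if "i \<in> V" for i
            using N(3) that by blast
          note self_stress = self_stress_c[OF Ns Nt, unfolded a rho_eta]
          have "fst (T (\<eta> m) (\<alpha> m) (b' m) N) = 0"
            using self_stress(1) by (simp only: T_def fst_conv vec_eq_iff vec_lambda_beta zero_index) auto
          moreover have "snd (T (\<eta> m) (\<alpha> m) (b' m) N) = 0"
            using self_stress(2) by (simp only: T_def snd_conv vec_eq_iff vec_lambda_beta zero_index) auto
          ultimately show ?thesis
            by (simp add: prod_eq_iff)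
        qed
        moreover have "N \<in> S"
          unfolding S_def mem_Collect_eq using N(1,2) by (rule conjI)
        ultimately show ?thesis
          using elim(9) by blast
      qed
    qed
    ultimately show ?case
      by blast
  qed
  then show ?thesis
    using that eventually_happens' sequentially_bot by blast
qed

section \<open>Contractible edges and clique minors\<close>

text \<open>Connectedness by cuts fits merging and deletion of vertices better than paths do. The
  empty set counts as connected, which covers the classes with index at least \<open>m\<close> in a
  clique partition.\<close>

definition connected_on :: "('v \<Rightarrow> 'v \<Rightarrow> bool) \<Rightarrow> 'v set \<Rightarrow> bool" where
  "connected_on A S \<longleftrightarrow> (\<forall>T\<subseteq>S. T \<noteq> {} \<longrightarrow> T \<noteq> S \<longrightarrow> (\<exists>x\<in>T. \<exists>y\<in>S - T. A x y))"

lemma connected_onE: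
  assumes "connected_on A S" "T \<subseteq> S" "T \<noteq> {}" "T \<noteq> S"
  obtains x y where "x \<in> T" "y \<in> S" "y \<notin> T" "A x y"
proof -
  have "\<exists>x\<in>T. \<exists>y\<in>S - T. A x y"
    using assms(1)[unfolded connected_on_def, rule_format, OF assms(2-)] .
  then show ?thesis
    using that by blast
qed

lemma connected_on_Un:
  assumes sym: "\<And>i j. A i j \<longleftrightarrow> A j i" and S: "connected_on A S" and T: "connected_on A T"
    and xy: "x \<in> S" "y \<in> T" "A x y"
  shows "connected_on A (S \<union> T)"
  unfolding connected_on_def
proof (intro allI impI)
  fix R assume R: "R \<subseteq> S \<union> T" "R \<noteq> {}" "R \<noteq> S \<union> T"
  consider "R \<inter> S \<noteq> {}" "R \<inter> S \<noteq> S" | "R \<inter> T \<noteq> {}" "R \<inter> T \<noteq> T"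
    | "S \<subseteq> R" "R \<inter> T = {}" | "T \<subseteq> R" "R \<inter> S = {}"
    using R by blast
  then show "\<exists>p\<in>R. \<exists>q\<in>S \<union> T - R. A p q"
  proof cases
    case 1
    then obtain p q where "p \<in> R \<inter> S" "q \<in> S" "q \<notin> R \<inter> S" "A p q"
      using connected_onE[OF S, of "R \<inter> S"] by blast
    then show ?thesis by blast
  next
    case 2
    then obtain p q where "p \<in> R \<inter> T" "q \<in> T" "q \<notin> R \<inter> T" "A p q"
      using connected_onE[OF T, of "R \<inter> T"] by blast
    then show ?thesis by blast
  next
    case 3
    then show ?thesis using xy by blast
  next
    case 4
    then show ?thesis using xy sym by blast
  qed
qed

lemma connected_on_singleton: "connected_on A {x}"
  by (auto simp: connected_on_def)

lemma connected_on_rtrancl: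
  assumes "\<And>u v. u \<in> S \<Longrightarrow> v \<in> S \<Longrightarrow> (u, v) \<in> {(x, y). A x y}\<^sup>*"
    and "\<And>x y. x \<in> S \<Longrightarrow> A x y \<Longrightarrow> y \<in> S"
  shows "connected_on A S"
  unfolding connected_on_def
proof (intro allI impI, rule ccontr)
  fix T assume T: "T \<subseteq> S" "T \<noteq> {}" "T \<noteq> S" and no: "\<not> (\<exists>x\<in>T. \<exists>y\<in>S - T. A x y)"
  then obtain u v where uv: "u \<in> T" "v \<in> S" "v \<notin> T"
    by blast
  have "(u, v) \<in> {(x, y). A x y}\<^sup>*"
    using T(1) uv by (intro assms(1)) auto
  then have "v \<in> T"
  proof (induction rule: rtrancl_induct)
    case (step y z)
    then show ?case
      using no T(1) assms(2)[of y z] by blast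
  qed (rule uv(1))
  then show False
    using uv(3) by contradiction
qed

text \<open>A cut of the merged set pulls back to a cut that does not separate \<open>u\<close> from
  \<open>v\<close>, so an edge across it is not lost by merging.\<close>

lemma connected_on_merge:
  assumes S: "connected_on A S" and uv: "u \<in> S" "v \<in> S" "u \<noteq> v"
  shows "connected_on (merge A u v) (S - {v})"
  unfolding connected_on_def
proof (intro allI impI)
  fix T assume T: "T \<subseteq> S - {v}" "T \<noteq> {}" "T \<noteq> S - {v}"
  define T' where "T' = (if u \<in> T then insert v T else T)"
  have "T' \<subseteq> S" "T' \<noteq> {}" "T' \<noteq> S"
    using T uv by (auto simp: T'_def split: if_splits)
  then obtain x y where xy: "x \<in> T'" "y \<in> S" "y \<notin> T'" "A x y"
    using connected_onE[OF S] by blast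
  define r where "r = (\<lambda>z. if z = v then u else z)"
  have "r x \<in> T" "r y \<in> S - {v} - T" "merge A u v (r x) (r y)"
    using xy T uv by (auto simp: r_def T'_def merge_def split: if_splits)
  then show "\<exists>x\<in>T. \<exists>y\<in>S - {v} - T. merge A u v x y"
    by blast
qed

lemma connected_on_merge_same: "connected_on A S \<Longrightarrow> connected_on (merge A u v) S"
  unfolding connected_on_def merge_def by (metis DiffD2)

section \<open>Partitions into connected, pairwise adjacent classes\<close>

definition clique_partition :: "'v set \<Rightarrow> ('v \<Rightarrow> 'v \<Rightarrow> bool) \<Rightarrow> nat \<Rightarrow> ('v \<Rightarrow> nat) \<Rightarrow> bool" where
  "clique_partition V A m f \<longleftrightarrow> f ` V = {..<m} \<and> (\<forall>k. connected_on A {x \<in> V. f x = k}) \<and>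
     (\<forall>k<m. \<forall>l<m. k \<noteq> l \<longrightarrow> (\<exists>x\<in>V. \<exists>y\<in>V. f x = k \<and> f y = l \<and> A x y))"

lemma clique_partition_merge:
  assumes cp: "clique_partition V A m f" and uv: "u \<in> V" "v \<in> V" "u \<noteq> v" "f u = f v"
  shows "clique_partition (V - {v}) (merge A u v) m f"
  unfolding clique_partition_def
proof (intro conjI allI impI)
  have "V = insert v (V - {v})" using uv by auto
  then have "f ` V = insert (f v) (f ` (V - {v}))" by (metis image_insert)
  also have "\<dots> = f ` (V - {v})"
    using uv imageI[of u "V - {v}" f] by (simp add: insert_absorb)
  finally show "f ` (V - {v}) = {..<m}"
    using cp by (simp add: clique_partition_def)
  show "connected_on (merge A u v) {x \<in> V - {v}. f x = k}" for k
  proof (cases "k = f u")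
    case True
    then show ?thesis
      using cp uv connected_on_merge[of A "{x \<in> V. f x = k}" u v]
      by (simp add: clique_partition_def set_diff_eq conj_commute conj_left_commute)
  next
    case False
    then have "{x \<in> V - {v}. f x = k} = {x \<in> V. f x = k}"
      using uv by auto
    then show ?thesis
      using cp connected_on_merge_same by (metis clique_partition_def)
  qed
  fix k l :: nat assume "k < m" "l < m" "k \<noteq> l"
  then obtain x y where xy: "x \<in> V" "y \<in> V" "f x = k" "f y = l" "A x y"
    using cp unfolding clique_partition_def by blast
  define r where "r = (\<lambda>z. if z = v then u else z)"
  have "r x \<in> V - {v}" "r y \<in> V - {v}" "f (r x) = k" "f (r y) = l" "merge A u v (r x) (r y)"
    using xy uv \<open>k \<noteq> l\<close> by (auto simp: r_def merge_def)
  then show "\<exists>x\<in>V - {v}. \<exists>y\<in>V - {v}. f x = k \<and> f y = l \<and> merge A u v x y"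
    by blast
qed

text \<open>A class other than that of \<open>u\<close> and \<open>v\<close> is connected and avoids
  both vertices, so it lies on one side of the cut. Two such classes are joined by an edge and hence
  lie on the same side; the other side is left to the class of \<open>u\<close>.\<close>

lemma clique_partition_cut:
  assumes sym: "\<And>i j. A i j \<longleftrightarrow> A j i" and cp: "clique_partition V A m f"
    and "f u = f v" and T: "T \<subseteq> V - {u, v}"
    and cut: "\<And>x y. x \<in> T \<Longrightarrow> y \<in> V - {u, v} - T \<Longrightarrow> \<not> A x y"
  shows "(\<forall>x\<in>T. f x = f u) \<or> (\<forall>x\<in>V - {u, v} - T. f x = f u)"
proof (rule ccontr)
  assume "\<not> ?thesis"
  then obtain p q where p: "p \<in> T" "f p \<noteq> f u" and q: "q \<in> V - {u, v} - T" "f q \<noteq> f u"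
    by auto
  have pq: "p \<in> V" "q \<in> V" using p q T by auto
  have classes: "{x \<in> V. f x = k} \<subseteq> T \<or> {x \<in> V. f x = k} \<inter> T = {}" if "k \<noteq> f u" for k
  proof (rule ccontr)
    assume "\<not> ?thesis"
    then have "{x \<in> V. f x = k} \<inter> T \<noteq> {}" "{x \<in> V. f x = k} \<inter> T \<noteq> {x \<in> V. f x = k}"
      by auto
    moreover have "connected_on A {x \<in> V. f x = k}"
      using cp by (simp add: clique_partition_def)
    ultimately obtain x y where "x \<in> {x \<in> V. f x = k} \<inter> T" "y \<in> {x \<in> V. f x = k}" "y \<notin> {x \<in> V. f x = k} \<inter> T" "A x y"
      using connected_onE[of A "{x \<in> V. f x = k}" "{x \<in> V. f x = k} \<inter> T"] by blast
    then show False
      using cut[of x y] that \<open>f u = f v\<close> by auto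
  qed
  have P: "{x \<in> V. f x = f p} \<subseteq> T" and Q: "{x \<in> V. f x = f q} \<inter> T = {}"
    using classes[OF p(2)] classes[OF q(2)] p q pq by blast+
  then have "f p \<noteq> f q"
    using p pq by auto
  moreover have "f p < m" "f q < m"
    using cp pq by (auto simp: clique_partition_def)
  ultimately obtain x y where xy: "x \<in> V" "y \<in> V" "f x = f p" "f y = f q" "A x y"
    using cp unfolding clique_partition_def by blast
  then have "x \<in> T" "y \<notin> T"
    using P Q by blast+
  moreover have "y \<noteq> u" "y \<noteq> v"
    using xy(4) q(2) \<open>f u = f v\<close> by auto
  ultimately show False
    using cut[of x y] xy by blast
qed

lemma exists_contractible_edge:
  fixes V :: "'v::finite set"
  assumes sym: "\<And>i j. A i j \<longleftrightarrow> A j i" and conn: "\<And>x. x \<in> V \<Longrightarrow> connected_on A (V - {x})"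
    and cp: "clique_partition V A m f" and m: "m < card V"
  shows "\<exists>u v. u \<in> V \<and> v \<in> V \<and> u \<noteq> v \<and> A u v \<and> f u = f v \<and> connected_on A (V - {u, v})"
proof (rule ccontr)
  assume contra: "\<not> ?thesis"
  \<comment> \<open>Take an edge \<open>uv\<close> inside a class that cuts off a piece \<open>C\<close> of this class with \<open>C\<close> as small as
    possible. An edge from \<open>u\<close> into \<open>C\<close> then cuts off an even smaller piece.\<close>
  define P where "P = (\<lambda>(u, v, C). u \<in> V \<and> v \<in> V \<and> u \<noteq> v \<and> A u v \<and> f u = f v \<and> C \<noteq> {} \<and>
    C \<subseteq> V - {u, v} \<and> (\<forall>x\<in>C. f x = f u) \<and> (\<forall>x\<in>C. \<forall>y\<in>V - {u, v} - C. \<not> A x y))"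
  have cut: "\<exists>T\<subseteq>V - {u, v}. T \<noteq> {} \<and> T \<noteq> V - {u, v} \<and> (\<forall>x\<in>T. \<forall>y\<in>V - {u, v} - T. \<not> A x y)"
    if "u \<in> V" "v \<in> V" "u \<noteq> v" "A u v" "f u = f v" for u v
  proof -
    have "\<not> connected_on A (V - {u, v})"
      using contra that by blast
    then show ?thesis
      by (simp add: connected_on_def)
  qed
  have "\<not> inj_on f V"
  proof
    assume "inj_on f V"
    then have "card V = card (f ` V)"
      by (simp add: card_image)
    then show False
      using cp m by (simp add: clique_partition_def)
  qed
  then obtain u0 w where uw: "u0 \<in> V" "w \<in> V" "u0 \<noteq> w" "f u0 = f w"
    by (auto simp: inj_on_def)
  have "connected_on A {x \<in> V. f x = f u0}"
    using cp by (simp add: clique_partition_def)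
  then obtain x v0 where "x \<in> {u0}" "v0 \<in> {x \<in> V. f x = f u0}" "v0 \<notin> {u0}" "A x v0"
  proof (rule connected_onE[where T = "{u0}"])
    have "w \<in> {x \<in> V. f x = f u0}"
      using uw by simp
    then show "{u0} \<noteq> {x \<in> V. f x = f u0}"
      using uw(3) by (metis singletonD)
  qed (use uw(1) in auto)
  then have v0: "v0 \<in> V" "u0 \<noteq> v0" "A u0 v0" "f u0 = f v0"
    by auto
  obtain T where T: "T \<subseteq> V - {u0, v0}" "T \<noteq> {}" "T \<noteq> V - {u0, v0}" "\<forall>x\<in>T. \<forall>y\<in>V - {u0, v0} - T. \<not> A x y"
    using cut[OF uw(1) v0] by blast
  \<comment> \<open>It is not known which of the two sides lies inside the class, so both must be
    available as candidates.\<close>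
  define T' where "T' = V - {u0, v0} - T"
  have T': "T' \<noteq> {}" "T' \<subseteq> V - {u0, v0}" "\<forall>x\<in>T'. \<forall>y\<in>V - {u0, v0} - T'. \<not> A x y"
    using T(1,3,4) sym[THEN iffD1] unfolding T'_def by blast+
  have "(\<forall>x\<in>T. f x = f u0) \<or> (\<forall>x\<in>T'. f x = f u0)"
    using clique_partition_cut[OF sym cp v0(4) T(1)] T(4) unfolding T'_def by blast
  then have "P (u0, v0, T) \<or> P (u0, v0, T')"
    using T T' uw(1) v0 unfolding P_def by blast
  then have "\<exists>t. P t" by blast
  then obtain t where t: "P t" "\<And>t'. P t' \<Longrightarrow> card (snd (snd t)) \<le> card (snd (snd t'))"
    using ex_has_least_nat[of P _ "\<lambda>t. card (snd (snd t))"] by blast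
  obtain u v C where t_eq: "t = (u, v, C)"
    by (cases t)
  have uv: "u \<in> V" "v \<in> V" "u \<noteq> v" "A u v" "f u = f v"
    and C: "C \<noteq> {}" "C \<subseteq> V - {u, v}" "\<And>x. x \<in> C \<Longrightarrow> f x = f u"
      "\<And>x y. x \<in> C \<Longrightarrow> y \<in> V - {u, v} - C \<Longrightarrow> \<not> A x y"
    using t(1) by (auto simp: t_eq P_def)
  \<comment> \<open>Deleting \<open>v\<close> alone leaves the graph connected, so some edge leaves
    \<open>C\<close> without meeting \<open>v\<close>; its only possible target is
    \<open>u\<close>.\<close>
  obtain x y where "x \<in> C" "y \<in> V - {v}" "y \<notin> C" "A x y"
    using connected_onE[OF conn[OF uv(2)], of C] C uv by blast
  then have x: "x \<in> C" "A u x"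
    using C(4)[of x y] sym by auto
  then have xV: "x \<in> V" "u \<noteq> x" "x \<noteq> v" "f u = f x"
    using C by auto
  obtain R where R: "R \<subseteq> V - {u, x}" "R \<noteq> {}" "R \<noteq> V - {u, x}" "\<forall>p\<in>R. \<forall>q\<in>V - {u, x} - R. \<not> A p q"
    using cut[OF uv(1) xV(1,2) x(2) xV(4)] by blast
  \<comment> \<open>Of the two sides of the cut \<open>{u, x}\<close>, the one that misses
    \<open>v\<close>.\<close>
  define D where "D = (if v \<in> R then V - {u, x} - R else R)"
  have D: "D \<subseteq> V - {u, x}" "D \<noteq> {}" "v \<notin> D" and D_cut: "\<forall>p\<in>D. \<forall>q\<in>V - {u, x} - D. \<not> A p q"
    using R sym[THEN iffD1] unfolding D_def by (cases "v \<in> R"; simp; blast)+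
  have "D \<subseteq> C"
  proof (rule ccontr)
    assume "\<not> D \<subseteq> C"
    then have "D - C \<noteq> {}" by auto
    \<comment> \<open>With only \<open>u\<close> deleted, some edge leaves \<open>D - C\<close>. It
      cannot enter \<open>C\<close>, whose outside neighbours are just \<open>u\<close> and
      \<open>v\<close>. So it leaves \<open>D\<close> and avoids \<open>x\<close>, an element of
      \<open>C\<close>, against the cut property of \<open>D\<close>.\<close>
    then obtain p q where "p \<in> D - C" "q \<in> V - {u}" "q \<notin> D - C" "A p q"
      using connected_onE[OF conn[OF uv(1)], of "D - C"] D uv by blast
    moreover then have "q \<notin> C"
      using C(4)[of q p] sym D by auto
    ultimately show False
      using D_cut x(1) D(1) by blast
  qed
  then have "P (u, x, D)"
    unfolding P_def prod.case using uv(1) xV x(2) D C(3) D_cut by blast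
  moreover have "card D < card C"
    using \<open>D \<subseteq> C\<close> x(1) D(1) by (intro psubset_card_mono) auto
  ultimately show False
    using t(2) by (fastforce simp: t_eq)
qed

section \<open>Building the representation by induction\<close>

lemma complete_representation:
  fixes V :: "'v::finite set"
  assumes V: "3 \<le> card V" and complete: "\<And>i j. i \<in> V \<Longrightarrow> j \<in> V \<Longrightarrow> i \<noteq> j \<Longrightarrow> A i j"
  shows "\<exists>b :: 'v \<Rightarrow> 'a::euclidean_space. stable_representation V A b \<and> dim (b ` V) = 1"
proof -
  obtain e :: 'a where e: "e \<in> Basis"
    using nonempty_Basis by blast
  then have ee: "e \<bullet> e = 1"
    by simp
  obtain z where z: "z \<in> V"
    using V by fastforce
  \<comment> \<open>Any numbers without zeros and with sum 0 would do. In rank 1 every profile is a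
    multiple of them, so it cannot have both a zero and a nonzero entry. The profiles to be excluded
    have both; for \<open>axis i 1\<close> this takes a third vertex.\<close>
  define r where "r = (\<lambda>i. if i = z then - real (card V - 1) else 1)"
  define b where "b = (\<lambda>i. r i *\<^sub>R e)"
  have r: "r i \<noteq> 0" for i
    using V by (auto simp: r_def)
  have no: "False" if R: "\<phi> \<in> profiles b I" "l \<in> I" "\<phi> $ l = 0" "k \<in> I" "\<phi> $ k \<noteq> 0" for \<phi> I l k
  proof -
    obtain y where "\<forall>l\<in>I. y \<bullet> b l = \<phi> $ l"
      using R(1) by (auto simp: profiles_def)
    then have "r l * (y \<bullet> e) = 0" "r k * (y \<bullet> e) \<noteq> 0"
      using R by (auto simp: b_def)
    then show False
      using r by auto
  qed
  have "stable_representation V A b"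
    unfolding stable_representation_def
  proof (intro conjI ballI allI impI)
    have "(\<Sum>i\<in>V. r i) = 0"
      using z V by (simp add: sum.remove r_def)
    then show "(\<Sum>i\<in>V. b i) = 0"
      by (simp add: b_def flip: scaleR_sum_left)
    show "b i \<bullet> b j \<noteq> 0 \<longleftrightarrow> A i j" if "i \<in> V" "j \<in> V" "i \<noteq> j" for i j
      using complete[OF that] r by (simp add: b_def ee)
    show "axis i 1 \<notin> profiles b (V - {j})" if "i \<in> V" "j \<in> V" "i \<noteq> j" for i j
    proof
      assume R: "axis i 1 \<in> profiles b (V - {j})"
      have "\<not> V \<subseteq> {i, j}"
        using V card_mono[of "{i, j}" V] by (auto simp: card_insert_if split: if_splits)
      then obtain l where "l \<in> V" "l \<noteq> i" "l \<noteq> j" by auto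
      then show False
        using no[OF R, of l i] that by (simp add: axis_def)
    qed
    show "(\<chi> l. if l \<in> X then b w \<bullet> b l else 0) \<notin> profiles b (V - {w})"
      if X: "w \<in> V" "X \<noteq> {}" "X \<subset> {l \<in> V. l \<noteq> w \<and> A w l}" for w X
    proof
      assume R: "(\<chi> l. if l \<in> X then b w \<bullet> b l else 0) \<in> profiles b (V - {w})"
      obtain l k where lk: "l \<in> V" "l \<noteq> w" "l \<notin> X" "k \<in> X"
        using X by auto
      then show False
        using no[OF R, of l k] X r lk by (auto simp: b_def ee)
    qed
    show "N = 0" if "\<forall>i j. N $ i $ j \<noteq> 0 \<longrightarrow> i \<in> V \<and> j \<in> V \<and> i \<noteq> j \<and> \<not> A i j" for N :: "real^'v^'v"
      using that complete by (auto simp: vec_eq_iff)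
  qed
  moreover have "span (b ` V) = span {e}"
  proof (rule subset_antisym)
    show "span (b ` V) \<subseteq> span {e}"
      by (intro span_minimal) (auto simp: b_def intro: span_mul span_base)
    have "e = (1 / r z) *\<^sub>R b z"
      using r by (simp add: b_def)
    also have "\<dots> \<in> span (b ` V)"
      using z by (intro span_mul span_base) auto
    finally show "span {e} \<subseteq> span (b ` V)"
      by (intro span_minimal) auto
  qed
  then have "dim (b ` V) = 1"
    using e by (metis dim_span dim_singleton nonzero_Basis)
  ultimately show ?thesis by blast
qed

text \<open>Rank and number of vertices grow together, so the corank remains \<open>d + 1\<close>.
  The bound by \<open>DIM('a)\<close> guarantees a free direction at every split, and
  \<open>1 \<le> d\<close> gives the base case its three vertices.\<close>

lemma representation_exists:
  fixes V :: "'v::finite set"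
  assumes "\<And>i j. A i j \<longleftrightarrow> A j i" and "\<And>x. x \<in> V \<Longrightarrow> connected_on A (V - {x})"
    and "clique_partition V A (d + 2) f" and "1 \<le> d" and "card V \<le> DIM('a)"
  shows "\<exists>b :: 'v \<Rightarrow> 'a::euclidean_space. stable_representation V A b \<and> dim (b ` V) = card V - (d + 1)"
  using assms
proof (induction "card V" arbitrary: V A rule: less_induct)
  case less
  note sym = less.prems(1) and conn = less.prems(2) and cp = less.prems(3)
  have fV: "f ` V = {..<d + 2}"
    using cp by (simp add: clique_partition_def)
  then have dV: "d + 2 \<le> card V"
    using card_image_le[of V f] by simp
  show ?case
  proof (cases "card V = d + 2")
    case True
    have inj: "inj_on f V"
      using fV True by (intro eq_card_imp_inj_on) auto
    have "A i j" if "i \<in> V" "j \<in> V" "i \<noteq> j" for i j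
    proof -
      have "f i \<noteq> f j" "f i < d + 2" "f j < d + 2"
        using inj that fV by (auto simp: inj_on_def)
      then obtain x y where "x \<in> V" "y \<in> V" "f x = f i" "f y = f j" "A x y"
        using cp unfolding clique_partition_def by blast
      then show ?thesis
        using inj that by (auto dest: inj_onD)
    qed
    then show ?thesis
      using complete_representation[of V A] True less.prems(4) by auto
  next
    case False
    then have big: "d + 2 < card V"
      using dV by simp
    obtain u v where uv: "u \<in> V" "v \<in> V" "u \<noteq> v" "A u v" "f u = f v" "connected_on A (V - {u, v})"
      using exists_contractible_edge[OF sym conn cp big] by blast
    have card: "card (V - {v}) = card V - 1"
      using uv by simp
    \<comment> \<open>Deleting one end leaves a connected set with more than one vertex, so the
      other end has a further neighbour.\<close>
    have ex: "\<exists>j\<in>V - {u, v}. A x j" if xy: "x \<in> V" "y \<in> V" "x \<noteq> y" "{x, y} = {u, v}" for x y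
    proof -
      have "V - {y} \<noteq> {x}"
      proof
        assume "V - {y} = {x}"
        then have "card (V - {y}) = 1" by simp
        then show False
          using big xy by simp
      qed
      then obtain p q where "p \<in> {x}" "q \<in> V - {y}" "q \<notin> {x}" "A p q"
        using connected_onE[OF conn[OF xy(2)], of "{x}"] xy by blast
      then show ?thesis
        using xy by blast
    qed
    have nu: "\<exists>j\<in>V - {u, v}. A u j" and nv: "\<exists>j\<in>V - {u, v}. A v j"
      using ex[of u v] ex[of v u] uv by auto
    have "\<exists>b :: 'v \<Rightarrow> 'a. stable_representation (V - {v}) (merge A u v) b \<and> dim (b ` (V - {v})) = card (V - {v}) - (d + 1)"
    proof (rule less.hyps)
      show "card (V - {v}) < card V"
        using card big by simp
      show "merge A u v i j \<longleftrightarrow> merge A u v j i" for i j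
        using sym by (auto simp: merge_def)
      show "connected_on (merge A u v) (V - {v} - {x})" if "x \<in> V - {v}" for x
      proof (cases "x = u")
        \<comment> \<open>Deleting the merged vertex amounts to deleting both ends; this is where
          the choice of a contractible edge enters.\<close>
        case True
        then have "V - {v} - {x} = V - {u, v}" by auto
        then show ?thesis
          using connected_on_merge_same[OF uv(6)] by simp
      next
        case False
        have "V - {v} - {x} = V - {x} - {v}" by auto
        then show ?thesis
          using connected_on_merge[OF conn[of x], of u v] False that uv by auto
      qed
      show "clique_partition (V - {v}) (merge A u v) (d + 2) f"
        by (rule clique_partition_merge[OF cp uv(1-3,5)])
    qed (use less.prems card in auto)
    then obtain b :: "'v \<Rightarrow> 'a" where b: "stable_representation (V - {v}) (merge A u v) b"
        "dim (b ` (V - {v})) = card (V - {v}) - (d + 1)"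
      by blast
    have "dim (b ` (V - {v})) < DIM('a)"
      using b(2) card big less.prems(5) by simp
    from split_representation[OF sym uv(1-4) b(1) this nu nv]
    obtain c :: "'v \<Rightarrow> 'a" where "stable_representation V A c" "dim (c ` V) = Suc (dim (b ` (V - {v})))"
      by blast
    then show ?thesis
      using b(2) card big by (intro exI[of _ c]) simp
  qed
qed

section \<open>From a clique minor to a partition of all vertices\<close>

lemma clique_partition_extend:
  fixes V :: "'v::finite set"
  assumes "\<And>i j. A i j \<longleftrightarrow> A j i" and "connected_on A V" and "0 < m"
    and "\<And>k. k < m \<Longrightarrow> C k \<noteq> {} \<and> C k \<subseteq> V \<and> connected_on A (C k)"
    and "\<And>k l. k < m \<Longrightarrow> l < m \<Longrightarrow> k \<noteq> l \<Longrightarrow> C k \<inter> C l = {} \<and> (\<exists>x\<in>C k. \<exists>y\<in>C l. A x y)"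
  shows "\<exists>f. clique_partition V A m f"
  using assms(4,5)
proof (induction "card (V - (\<Union>k<m. C k))" arbitrary: C rule: less_induct)
  case less
  note C = less.prems
  show ?case
  proof (cases "(\<Union>k<m. C k) = V")
    case True
    define f where "f = (\<lambda>x. if x \<in> V then SOME k. k < m \<and> x \<in> C k else m)"
    have f: "f x < m \<and> x \<in> C (f x)" if "x \<in> V" for x
    proof -
      have "\<exists>k. k < m \<and> x \<in> C k"
        using that True by auto
      from someI_ex[OF this] show ?thesis
        using that by (simp add: f_def)
    qed
    have f_eq: "f x = k" if "k < m" "x \<in> C k" for x k
      using f[of x] C(2)[of k "f x"] C(1)[OF that(1)] that by auto
    have cls: "{x \<in> V. f x = k} = (if k < m then C k else {})" for k
    proof (cases "k < m")
      case True
      then have "C k \<subseteq> V"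
        using C(1) by blast
      then show ?thesis
        using f f_eq True by auto
    qed (use f in auto)
    have "clique_partition V A m f"
      unfolding clique_partition_def
    proof (intro conjI allI impI)
      show "f ` V = {..<m}"
      proof (intro equalityI subsetI)
        fix k assume "k \<in> {..<m}"
        then obtain x where "x \<in> C k" using C(1) by auto
        then show "k \<in> f ` V"
          using f_eq[of k x] C(1)[of k] \<open>k \<in> {..<m}\<close> by auto
      qed (use f in auto)
      show "connected_on A {x \<in> V. f x = k}" for k
        unfolding cls using C(1) by (simp add: connected_on_def)
      show "\<exists>x\<in>V. \<exists>y\<in>V. f x = k \<and> f y = l \<and> A x y" if kl: "k < m" "l < m" "k \<noteq> l" for k l
      proof -
        obtain x y where "x \<in> C k" "y \<in> C l" "A x y"
          using C(2)[OF kl] by blast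
        then show ?thesis
          using f_eq kl C(1)[OF kl(1)] C(1)[OF kl(2)] by blast
      qed
    qed
    then show ?thesis by blast
  next
    case False
    have "(\<Union>k<m. C k) \<subseteq> V"
      using C(1) by (intro UN_least) simp
    moreover have "(\<Union>k<m. C k) \<noteq> {}"
      using C(1)[of 0] assms(3) by auto
    ultimately obtain x y where xy: "x \<in> (\<Union>k<m. C k)" "y \<in> V" "y \<notin> (\<Union>k<m. C k)" "A x y"
      using False by (rule connected_onE[OF assms(2)])
    then obtain k where k: "k < m" "x \<in> C k" by auto
    define C' where "C' = C(k := C k \<union> {y})"
    have Un: "(\<Union>l<m. C' l) = insert y (\<Union>l<m. C l)"
      using k by (auto simp: C'_def)
    show ?thesis
    proof (rule less.hyps[of C'])
      show "card (V - (\<Union>l<m. C' l)) < card (V - (\<Union>l<m. C l))"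
        unfolding Un using xy by (intro psubset_card_mono) auto
      show "C' l \<noteq> {} \<and> C' l \<subseteq> V \<and> connected_on A (C' l)" if "l < m" for l
        using C(1)[OF that] xy k connected_on_Un[where A = A and S = "C k" and T = "{y}" and x = x and y = y, OF assms(1)]
          connected_on_singleton[of A y]
        by (auto simp: C'_def)
      show "C' i \<inter> C' j = {} \<and> (\<exists>x\<in>C' i. \<exists>y\<in>C' j. A x y)" if ij: "i < m" "j < m" "i \<noteq> j" for i j
      proof -
        have "y \<notin> C i" "y \<notin> C j" using xy ij by auto
        then show ?thesis
          using C(2)[OF ij] ij unfolding C'_def by auto
      qed
    qed
  qed
qed

definition adjacent :: "('v, 'e) multigraph \<Rightarrow> 'v \<Rightarrow> 'v \<Rightarrow> bool" where
  "adjacent G x y \<longleftrightarrow> (\<exists>e\<in>edges G. ends G e = {x, y})"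

lemma adjacent_sym: "adjacent G x y \<longleftrightarrow> adjacent G y x"
  by (simp add: adjacent_def insert_commute)

text \<open>The first condition is the part of being a multigraph that has to be carried through the
  reductions. The last one speaks about pairs of distinct endpoints instead of a set
  \<open>{x, y}\<close>, so that it passes easily to the renamed endpoints of a contraction.\<close>

definition branch_sets :: "('v, 'e) multigraph \<Rightarrow> ('v, 'e) multigraph \<Rightarrow> ('v \<Rightarrow> 'v set) \<Rightarrow> bool" where
  "branch_sets G H B \<longleftrightarrow>
     (\<forall>e\<in>edges H. ends H e \<subseteq> verts H) \<and>
     (\<forall>x\<in>verts H. B x \<noteq> {} \<and> B x \<subseteq> verts G \<and> connected_on (adjacent G) (B x)) \<and>
     (\<forall>x\<in>verts H. \<forall>y\<in>verts H. x \<noteq> y \<longrightarrow> B x \<inter> B y = {}) \<and>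
     (\<forall>e\<in>edges H. \<forall>x\<in>ends H e. \<forall>y\<in>ends H e. x \<noteq> y \<longrightarrow> (\<exists>p\<in>B x. \<exists>q\<in>B y. adjacent G p q))"

lemma branch_setsD:
  assumes "branch_sets G H B"
  shows "\<And>e. e \<in> edges H \<Longrightarrow> ends H e \<subseteq> verts H"
    and "\<And>x. x \<in> verts H \<Longrightarrow> B x \<noteq> {} \<and> B x \<subseteq> verts G \<and> connected_on (adjacent G) (B x)"
    and "\<And>x y. x \<in> verts H \<Longrightarrow> y \<in> verts H \<Longrightarrow> x \<noteq> y \<Longrightarrow> B x \<inter> B y = {}"
    and "\<And>e x y. e \<in> edges H \<Longrightarrow> x \<in> ends H e \<Longrightarrow> y \<in> ends H e \<Longrightarrow> x \<noteq> y \<Longrightarrow>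
      \<exists>p\<in>B x. \<exists>q\<in>B y. adjacent G p q"
  using assms unfolding branch_sets_def by simp_all

lemma reduces_to_branch_sets:
  assumes "reduces_to G H" and "multigraph G"
  shows "\<exists>B. branch_sets G H B"
  using assms(1)
proof (induction rule: reduces_to.induct)
  case refl
  have "\<exists>p\<in>{x}. \<exists>q\<in>{y}. adjacent G p q" if "e \<in> edges G" "x \<in> ends G e" "y \<in> ends G e" "x \<noteq> y" for e x y
  proof -
    have "card (ends G e) = 2"
      using that assms(2) by (simp add: multigraph_def)
    then have "ends G e = {x, y}"
      using that by (auto simp: card_2_iff)
    then show ?thesis
      using that by (auto simp: adjacent_def)
  qed
  then have "branch_sets G G (\<lambda>x. {x})"
    using assms(2) by (auto simp: branch_sets_def connected_on_singleton multigraph_def)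
  then show ?case by blast
next
  case (del_vertex H v)
  then obtain B where "branch_sets G H B" by blast
  then have "branch_sets G (delete_vertex H v) B"
    unfolding branch_sets_def delete_vertex_def by auto
  then show ?case by blast
next
  case (del_edge H e)
  then obtain B where "branch_sets G H B" by blast
  then have "branch_sets G (delete_edge H e) B"
    unfolding branch_sets_def delete_edge_def by auto
  then show ?case by blast
next
  case (contraction H e u v)
  then obtain B where "branch_sets G H B" by blast
  note sub = branch_setsD(1)[OF this] and B = branch_setsD(2-)[OF this]
  define r where "r = (\<lambda>w. if w = v then u else w)"
  have uv: "u \<in> verts H" "v \<in> verts H"
    using sub[OF contraction.hyps(2)] contraction.hyps(3) by auto
  have ct: "verts (contract H u v) = verts H - {v}" "edges (contract H u v) = {e \<in> edges H. ends H e \<noteq> {u, v}}"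
    "ends (contract H u v) = (\<lambda>e. r ` ends H e)"
    by (simp_all add: contract_def r_def)
  obtain p q where pq: "p \<in> B u" "q \<in> B v" "adjacent G p q"
    using B(3)[of e u v] contraction.hyps by auto
  define B' where "B' = B(u := B u \<union> B v)"
  have Br: "B w \<subseteq> B' (r w)" if "w \<in> verts H" for w
    by (auto simp: B'_def r_def)
  have "branch_sets G (contract H u v) B'"
    unfolding branch_sets_def ct
  proof (intro conjI ballI impI)
    show "r ` ends H e \<subseteq> verts H - {v}" if "e \<in> {e \<in> edges H. ends H e \<noteq> {u, v}}" for e
      using sub[of e] that uv contraction.hyps(4) by (auto simp: r_def)
    fix x assume x: "x \<in> verts H - {v}"
    show "B' x \<noteq> {}" "B' x \<subseteq> verts G" "connected_on (adjacent G) (B' x)"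
      using B(1)[of x] B(1)[OF uv(1)] B(1)[OF uv(2)] x
        connected_on_Un[where A = "adjacent G" and S = "B u" and T = "B v" and x = p and y = q, OF adjacent_sym] pq by (auto simp: B'_def)
    fix y assume "y \<in> verts H - {v}" "x \<noteq> y"
    then show "B' x \<inter> B' y = {}"
      using B(2)[of x y] B(2)[of v y] B(2)[of x v] x uv by (auto simp: B'_def)
  next
    fix e x y assume e: "e \<in> {e \<in> edges H. ends H e \<noteq> {u, v}}" "x \<in> r ` ends H e" "y \<in> r ` ends H e" "x \<noteq> y"
    then obtain x' y' where xy: "x' \<in> ends H e" "y' \<in> ends H e" "x = r x'" "y = r y'" "x' \<noteq> y'"
      by auto
    obtain p q where "p \<in> B x'" "q \<in> B y'" "adjacent G p q"
      using B(3)[of e x' y'] e(1) xy by auto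
    moreover have "x' \<in> verts H" "y' \<in> verts H"
      using sub[of e] e(1) xy(1,2) by auto
    then have "B x' \<subseteq> B' x" "B y' \<subseteq> B' y"
      using Br xy(3,4) by simp_all
    ultimately show "\<exists>p\<in>B' x. \<exists>q\<in>B' y. adjacent G p q"
      by blast
  qed
  then show ?case by blast
qed

lemma complete_minor_partition:
  fixes G :: "('v::finite, 'e) multigraph"
  assumes G: "multigraph G" and conn: "connected_on (adjacent G) (verts G)"
    and minor: "has_minor G (complete_graph m)" and "0 < m"
  shows "\<exists>f. clique_partition (verts G) (adjacent G) m f"
proof -
  obtain H f g where H: "reduces_to G H" and f: "bij_betw f (verts H) {..<m}"
    and g: "bij_betw g (edges H) {A. A \<subseteq> {..<m} \<and> card A = 2}"
    and fg: "\<And>e. e \<in> edges H \<Longrightarrow> g e = f ` ends H e"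
    using minor by (auto simp: has_minor_def isomorphic_def complete_graph_def)
  obtain B where "branch_sets G H B"
    using reduces_to_branch_sets[OF H G] by blast
  note sub = branch_setsD(1)[OF this] and B = branch_setsD(2-)[OF this]
  define h where "h = inv_into (verts H) f"
  have h: "h k \<in> verts H" "f (h k) = k" if "k < m" for k
    using f that unfolding h_def bij_betw_def by (auto simp: inv_into_into f_inv_into_f)
  have hf: "h (f x) = x" if "x \<in> verts H" for x
    using f that by (simp add: h_def bij_betw_def)
  show ?thesis
  proof (rule clique_partition_extend[OF adjacent_sym conn \<open>0 < m\<close>])
    show "B (h k) \<noteq> {} \<and> B (h k) \<subseteq> verts G \<and> connected_on (adjacent G) (B (h k))" if "k < m" for k
      using B(1) h that by blast
    fix k l assume kl: "k < m" "l < m" "k \<noteq> l"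
    then have ne: "h k \<noteq> h l"
      using h by metis
    have "{k, l} \<in> {A. A \<subseteq> {..<m} \<and> card A = 2}"
      using kl by auto
    then obtain e where e: "e \<in> edges H" "g e = {k, l}"
      using g unfolding bij_betw_def by (metis imageE)
    then have im: "f ` ends H e = {k, l}"
      using fg by simp
    have "h k \<in> ends H e" "h l \<in> ends H e"
    proof -
      have "i \<in> f ` ends H e \<Longrightarrow> h i \<in> ends H e" for i
        using sub[OF e(1)] hf by auto
      then show "h k \<in> ends H e" "h l \<in> ends H e"
        using im by auto
    qed
    then show "B (h k) \<inter> B (h l) = {} \<and> (\<exists>x\<in>B (h k). \<exists>y\<in>B (h l). adjacent G x y)"
      using B(2)[of "h k" "h l"] B(3)[OF e(1), of "h k" "h l"] h kl ne by auto
  qed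
qed

section \<open>From representations to tensegrities\<close>

lemma multigraph_edge:
  assumes "multigraph G" "e \<in> edges G"
  obtains i j where "ends G e = {i, j}" "i \<noteq> j" "i \<in> verts G" "j \<in> verts G"
proof -
  have "card (ends G e) = 2" "ends G e \<subseteq> verts G"
    using assms by (auto simp: multigraph_def)
  then show ?thesis
    using that by (auto simp: card_2_iff)
qed

text \<open>Every edge occurs at both orders of its endpoints, which explains the factor 2; sums
  over ordered pairs are the form in which bilinear expansions are easy.\<close>

lemma sum_edges_by_pairs:
  fixes G :: "('v, 'e) multigraph" and F :: "'e \<Rightarrow> real"
  assumes G: "multigraph G"
  shows "(\<Sum>i\<in>verts G. \<Sum>j\<in>verts G. \<Sum>e\<in>{e \<in> edges G. ends G e = {i, j}}. F e) = 2 * (\<Sum>e\<in>edges G. F e)"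
proof -
  have fin: "finite (edges G)" "finite (verts G)"
    using G by (auto simp: multigraph_def)
  have "(\<Sum>i\<in>verts G. \<Sum>j\<in>verts G. if ends G e = {i, j} then F e else 0) = 2 * F e" if e: "e \<in> edges G" for e
  proof -
    obtain a b where ab: "ends G e = {a, b}" "a \<noteq> b" "a \<in> verts G" "b \<in> verts G"
      using multigraph_edge[OF G e] by blast
    have "(\<Sum>j\<in>verts G. if ends G e = {i, j} then F e else 0) = (if i = a then F e else 0) + (if i = b then F e else 0)" for i
    proof -
      have "(\<Sum>j\<in>verts G. if ends G e = {i, j} then F e else 0) =
          (\<Sum>j\<in>verts G. (if j = b then if i = a then F e else 0 else 0) + (if j = a then if i = b then F e else 0 else 0))"
        by (intro sum.cong) (use ab in \<open>auto simp: doubleton_eq_iff\<close>)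
      then show ?thesis
        using fin ab by (simp add: sum.distrib)
    qed
    then show ?thesis
      using fin ab by (simp add: sum.distrib)
  qed
  then have "2 * (\<Sum>e\<in>edges G. F e) = (\<Sum>e\<in>edges G. \<Sum>i\<in>verts G. \<Sum>j\<in>verts G. if ends G e = {i, j} then F e else 0)"
    by (simp add: sum_distrib_left)
  also have "\<dots> = (\<Sum>i\<in>verts G. \<Sum>j\<in>verts G. \<Sum>e\<in>edges G. if ends G e = {i, j} then F e else 0)"
    by (subst sum.swap) (intro sum.cong refl sum.swap)
  also have "\<dots> = (\<Sum>i\<in>verts G. \<Sum>j\<in>verts G. \<Sum>e\<in>{e \<in> edges G. ends G e = {i, j}}. F e)"
    by (simp only: sum.inter_filter[OF fin(1)])
  finally show ?thesis by simp
qed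

lemma inner_edge_matrix:
  fixes x z :: "real^'v::finite"
  shows "x \<bullet> (edge_matrix {i, j} *v z) = (x $ i - x $ j) * (z $ i - z $ j)"
proof -
  define y :: "real^'v" where "y = axis i 1 - axis j 1"
  have y: "w \<bullet> y = w $ i - w $ j" for w
    by (simp add: y_def inner_diff_right inner_axis)
  have "(edge_matrix {i, j} *v z) $ k = y $ k * (y \<bullet> z)" for k
    unfolding edge_matrix_eq y_def[symmetric]
    by (simp add: matrix_vector_mult_def matrix_matrix_mult_def columnvector_def rowvector_def inner_vec_def
        sum_distrib_left mult.assoc)
  then have "edge_matrix {i, j} *v z = (y \<bullet> z) *\<^sub>R y"
    by (simp add: vec_eq_iff mult.commute)
  then show ?thesis
    using y[of x] y[of z] by (simp add: inner_commute mult.commute)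
qed

lemma inner_laplacian:
  fixes x z :: "real^'v::finite"
  shows "x \<bullet> (laplacian G \<omega> *v z) = (\<Sum>e\<in>edges G. \<omega> e * (x \<bullet> (edge_matrix (ends G e) *v z)))"
proof -
  have lin: "linear (\<lambda>M :: real^'v^'v. x \<bullet> (M *v z))"
    by (rule linearI) (simp_all add: matrix_vector_mult_add_rdistrib inner_add_right scaleR_matrix_vector_assoc[symmetric])
  show ?thesis
    unfolding laplacian_def linear_sum[OF lin] by (simp add: scaleR_matrix_vector_assoc[symmetric])
qed

text \<open>Parallel edges share the stress equally; polarization avoids choosing an order of the endpoints.\<close>

definition gram_stress :: "('v::finite, 'e) multigraph \<Rightarrow> ('v \<Rightarrow> 'a::real_inner) \<Rightarrow> 'e \<Rightarrow> real" where
  "gram_stress G b e = ((\<Sum>i\<in>ends G e. (norm (b i))\<^sup>2) - (norm (\<Sum>i\<in>ends G e. b i))\<^sup>2) / 2 /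
     real (card {e' \<in> edges G. ends G e' = ends G e})"

lemma gram_stress_eq:
  assumes "ends G e = {i, j}" "i \<noteq> j"
  shows "gram_stress G b e = - (b i \<bullet> b j) / real (card {e' \<in> edges G. ends G e' = {i, j}})"
  using assms by (simp add: gram_stress_def power2_norm_eq_inner inner_add_left inner_add_right inner_commute)

lemma sum_gram_stress:
  fixes b :: "'v::finite \<Rightarrow> 'a::euclidean_space"
  assumes G: "multigraph G" and rep: "stable_representation (verts G) (adjacent G) b"
    and ij: "i \<in> verts G" "j \<in> verts G" "i \<noteq> j"
  shows "(\<Sum>e\<in>{e \<in> edges G. ends G e = {i, j}}. gram_stress G b e) = - (b i \<bullet> b j)"
proof (cases "adjacent G i j")
  case True
  have "finite {e \<in> edges G. ends G e = {i, j}}" "{e \<in> edges G. ends G e = {i, j}} \<noteq> {}"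
    using G True by (auto simp: multigraph_def adjacent_def)
  then have "card {e \<in> edges G. ends G e = {i, j}} \<noteq> 0"
    by simp
  moreover have "(\<Sum>e\<in>{e \<in> edges G. ends G e = {i, j}}. gram_stress G b e) =
     (\<Sum>e\<in>{e \<in> edges G. ends G e = {i, j}}. - (b i \<bullet> b j) / real (card {e' \<in> edges G. ends G e' = {i, j}}))"
    using ij by (intro sum.cong refl gram_stress_eq) auto
  ultimately show ?thesis
    by simp
next
  case False
  then have "{e \<in> edges G. ends G e = {i, j}} = {}" "b i \<bullet> b j = 0"
    using stable_representationD(2)[OF rep ij] by (auto simp: adjacent_def)
  then show ?thesis
    by (simp del: Collect_empty_eq)
qed

lemma no_loops:
  assumes "multigraph G"
  shows "{e \<in> edges G. ends G e = {i, i}} = {}"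
  using assms by (auto simp: multigraph_def)

text \<open>The rows of the Gram matrix sum to 0 together with the vectors, so the matrix is the
  Laplacian of its negated off-diagonal entries. In the expansion the two pure sums vanish for this
  reason, and each mixed sum gives the Gram form once.\<close>

lemma inner_laplacian_gram:
  fixes b :: "'v::finite \<Rightarrow> 'a::euclidean_space"
  assumes G: "multigraph G" and rep: "stable_representation (verts G) (adjacent G) b"
  shows "x \<bullet> (laplacian G (gram_stress G b) *v z) =
    (\<Sum>i\<in>verts G. x $ i *\<^sub>R b i) \<bullet> (\<Sum>i\<in>verts G. z $ i *\<^sub>R b i)"
proof -
  let ?V = "verts G"
  have b0: "(\<Sum>i\<in>?V. b i) = 0"
    by (rule stable_representationD(1)[OF rep])
  have pair: "(\<Sum>e\<in>{e \<in> edges G. ends G e = {i, j}}. gram_stress G b e * (x \<bullet> (edge_matrix (ends G e) *v z))) =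
      - (b i \<bullet> b j) * ((x $ i - x $ j) * (z $ i - z $ j))" if "i \<in> ?V" "j \<in> ?V" for i j
  proof (cases "i = j")
    case True
    then show ?thesis
      using no_loops[OF G, of i] by (simp del: Collect_empty_eq)
  next
    case False
    have "(\<Sum>e\<in>{e \<in> edges G. ends G e = {i, j}}. gram_stress G b e * (x \<bullet> (edge_matrix (ends G e) *v z))) =
      (\<Sum>e\<in>{e \<in> edges G. ends G e = {i, j}}. gram_stress G b e * ((x $ i - x $ j) * (z $ i - z $ j)))"
      by (intro sum.cong refl) (auto simp: inner_edge_matrix)
    also have "\<dots> = (\<Sum>e\<in>{e \<in> edges G. ends G e = {i, j}}. gram_stress G b e) * ((x $ i - x $ j) * (z $ i - z $ j))"
      by (simp only: sum_distrib_right)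
    finally show ?thesis
      by (simp only: sum_gram_stress[OF G rep that False])
  qed
  have diag: "(\<Sum>i\<in>?V. \<Sum>j\<in>?V. (b i \<bullet> b j) * (y $ i * w $ i)) = 0" for y w :: "real^'v"
  proof -
    have "(\<Sum>j\<in>?V. (b i \<bullet> b j) * (y $ i * w $ i)) = (b i \<bullet> (\<Sum>j\<in>?V. b j)) * (y $ i * w $ i)" for i
      by (simp only: inner_sum_right sum_distrib_right)
    then show ?thesis by (simp add: b0)
  qed
  have diag': "(\<Sum>i\<in>?V. \<Sum>j\<in>?V. (b i \<bullet> b j) * (y $ j * w $ j)) = 0" for y w :: "real^'v"
    by (subst sum.swap) (simp only: inner_commute diag)
  have mixed: "(\<Sum>i\<in>?V. \<Sum>j\<in>?V. (b i \<bullet> b j) * (y $ i * w $ j)) = (\<Sum>i\<in>?V. y $ i *\<^sub>R b i) \<bullet> (\<Sum>i\<in>?V. w $ i *\<^sub>R b i)"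
    for y w :: "real^'v"
    by (simp only: inner_sum_left) (simp add: inner_sum_right sum_distrib_left mult_ac)
  have mixed': "(\<Sum>i\<in>?V. \<Sum>j\<in>?V. (b i \<bullet> b j) * (y $ j * w $ i)) = (\<Sum>i\<in>?V. y $ i *\<^sub>R b i) \<bullet> (\<Sum>i\<in>?V. w $ i *\<^sub>R b i)"
    for y w :: "real^'v"
    by (subst sum.swap) (simp only: inner_commute[of "b _" "b _"] mixed)
  have "2 * (x \<bullet> (laplacian G (gram_stress G b) *v z)) =
     (\<Sum>i\<in>?V. \<Sum>j\<in>?V. - (b i \<bullet> b j) * ((x $ i - x $ j) * (z $ i - z $ j)))"
    by (simp add: inner_laplacian sum_edges_by_pairs[OF G, symmetric] pair cong: sum.cong)
  also have "\<dots> = (\<Sum>i\<in>?V. \<Sum>j\<in>?V. (b i \<bullet> b j) * (x $ i * z $ j)) + (\<Sum>i\<in>?V. \<Sum>j\<in>?V. (b i \<bullet> b j) * (x $ j * z $ i))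
     - (\<Sum>i\<in>?V. \<Sum>j\<in>?V. (b i \<bullet> b j) * (x $ i * z $ i)) - (\<Sum>i\<in>?V. \<Sum>j\<in>?V. (b i \<bullet> b j) * (x $ j * z $ j))"
    by (simp add: sum.distrib[symmetric] sum_subtractf[symmetric] algebra_simps)
  finally show ?thesis
    by (simp only: diag diag' mixed mixed')
qed

section \<open>Gale duality\<close>

definition gale_kernel :: "'v set \<Rightarrow> ('v::finite \<Rightarrow> 'a::euclidean_space) \<Rightarrow> (real^'v) set" where
  "gale_kernel V b = {x. (\<forall>i. i \<notin> V \<longrightarrow> x $ i = 0) \<and> (\<Sum>i\<in>V. x $ i *\<^sub>R b i) = 0}"

definition row_vector :: "'v set \<Rightarrow> ('v::finite \<Rightarrow> 'a::euclidean_space) \<Rightarrow> 'a \<Rightarrow> real^'v" where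
  "row_vector V b y = (\<chi> l. if l \<in> V then y \<bullet> b l else 0)"

lemma linear_row_vector: "linear (row_vector V b)"
  by (rule linearI) (auto simp: row_vector_def vec_eq_iff inner_add_left)

lemma inner_row_vector: "row_vector V b y \<bullet> x = y \<bullet> (\<Sum>i\<in>V. x $ i *\<^sub>R b i)"
proof -
  have "row_vector V b y \<bullet> x = (\<Sum>l\<in>UNIV. if l \<in> V then (y \<bullet> b l) * x $ l else 0)"
    unfolding row_vector_def inner_vec_def by (intro sum.cong) auto
  also have "\<dots> = (\<Sum>l\<in>V. (y \<bullet> b l) * x $ l)"
    by (simp add: sum.If_cases)
  finally show ?thesis
    by (simp add: inner_sum_right mult.commute)
qed

lemma gale_kernel_eq:
  "gale_kernel V b = {x \<in> {x. \<forall>i. i \<notin> V \<longrightarrow> x $ i = 0}. \<forall>r\<in>row_vector V b ` span (b ` V). orthogonal r x}"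
proof -
  have "(\<Sum>i\<in>V. x $ i *\<^sub>R b i) = 0" if "\<forall>y\<in>span (b ` V). y \<bullet> (\<Sum>i\<in>V. x $ i *\<^sub>R b i) = 0" for x
  proof -
    have "(\<Sum>i\<in>V. x $ i *\<^sub>R b i) \<in> span (b ` V)"
      by (intro span_sum span_mul span_base) auto
    then show ?thesis
      using that by (metis inner_eq_zero_iff)
  qed
  then show ?thesis
    by (auto simp: gale_kernel_def orthogonal_def inner_row_vector)
qed

lemma dim_gale_kernel:
  fixes b :: "'v::finite \<Rightarrow> 'a::euclidean_space"
  shows "dim (gale_kernel V b) + dim (b ` V) = card V"
proof -
  let ?U = "{x :: real^'v. \<forall>i. i \<notin> V \<longrightarrow> x $ i = 0}"
  have "subspace ?U"
    by (rule subspaceI) auto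
  moreover have "row_vector V b ` span (b ` V) \<subseteq> ?U"
    by (auto simp: row_vector_def)
  moreover have "subspace (row_vector V b ` span (b ` V))"
    by (intro linear_subspace_image linear_row_vector subspace_span)
  ultimately have "dim (gale_kernel V b) + dim (row_vector V b ` span (b ` V)) = dim ?U"
    unfolding gale_kernel_eq by (intro dim_subspace_orthogonal_to_vectors)
  moreover have "dim (row_vector V b ` span (b ` V)) = dim (span (b ` V))"
  proof (rule dim_image_eq[OF linear_row_vector])
    have "y = 0" if "y \<in> span (b ` V)" "row_vector V b y = 0" for y
    proof (rule orthogonal_span_eq_0[OF that(1)])
      fix x assume "x \<in> b ` V"
      then obtain l where "l \<in> V" "x = b l" by blast
      moreover have "row_vector V b y $ l = 0"
        by (simp add: that(2))
      ultimately show "y \<bullet> x = 0"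
        by (simp add: row_vector_def)
    qed
    then show "inj_on (row_vector V b) (span (span (b ` V)))"
      unfolding span_span by (subst linear_injective_on_subspace_0[OF linear_row_vector subspace_span]) blast
  qed
  moreover have "dim ?U = card V"
  proof -
    let ?d = "(\<lambda>i. axis i (1::real)) ` V"
    have "?U = {x. \<forall>k\<in>Basis. k \<notin> ?d \<longrightarrow> x \<bullet> k = 0}"
      by (auto simp: Basis_vec_def inner_axis axis_eq_axis)
    moreover have "dim {x :: real^'v. \<forall>k\<in>Basis. k \<notin> ?d \<longrightarrow> x \<bullet> k = 0} = card ?d"
      by (rule dim_substandard) (auto simp: Basis_vec_def)
    moreover have "card ?d = card V"
      by (intro card_image inj_onI) (simp add: axis_eq_axis)
    ultimately show ?thesis
      by simp
  qed
  ultimately show ?thesis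
    by (simp add: dim_span)
qed

text \<open>Decompose \<open>axis i 1 - axis j 1\<close> into a row space part and a kernel part
  \<open>x\<close>. If \<open>x\<close> took equal values at \<open>i\<close> and \<open>j\<close>,
  it would be orthogonal to both the difference and its row space part, hence 0, and the difference
  would lie in the row space.\<close>

lemma gale_kernel_separates:
  fixes b :: "'v::finite \<Rightarrow> 'a::euclidean_space"
  assumes ij: "i \<in> V" "j \<in> V" "i \<noteq> j" and nr: "axis i 1 \<notin> profiles b (V - {j})"
  obtains x where "x \<in> gale_kernel V b" "x $ i \<noteq> x $ j"
proof -
  define a :: "real^'v" where "a = axis i 1 - axis j 1"
  have sub: "subspace (row_vector V b ` span (b ` V))"
    by (intro linear_subspace_image linear_row_vector subspace_span)
  obtain r x where rx: "r \<in> row_vector V b ` span (b ` V)" "a = r + x"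
      "\<And>w. w \<in> row_vector V b ` span (b ` V) \<Longrightarrow> orthogonal x w"
    using orthogonal_subspace_decomp_exists[of "row_vector V b ` span (b ` V)" a] span_eq_iff[THEN iffD2, OF sub]
    by metis
  have supp: "x $ l = 0" if "l \<notin> V" for l
  proof -
    have "a $ l = 0" "r $ l = 0"
      using that ij rx(1) by (auto simp: a_def axis_def row_vector_def)
    then show ?thesis
      by (simp add: rx(2))
  qed
  then have "x \<in> gale_kernel V b"
    using rx(3) orthogonal_commute[of x] unfolding gale_kernel_eq by blast
  moreover have "x $ i \<noteq> x $ j"
  proof
    assume "x $ i = x $ j"
    then have "x \<bullet> a = 0"
      by (simp add: a_def inner_diff_right inner_axis)
    moreover have "x \<bullet> r = 0"
      using rx(1,3) by (simp add: orthogonal_def)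
    ultimately have "x = 0"
      by (simp add: rx(2) inner_add_right)
    then obtain y where "a = row_vector V b y"
      using rx by auto
    then have "y \<bullet> b l = a $ l" if "l \<in> V" for l
      using that by (simp add: row_vector_def)
    then have "\<forall>l\<in>V - {j}. y \<bullet> b l = axis i 1 $ l"
      by (auto simp: a_def axis_def)
    then show False
      using nr unfolding profiles_def by blast
  qed
  ultimately show ?thesis
    using that by blast
qed

text \<open>The constant vector is completed to a basis of the kernel, and the remaining basis
  vectors serve as coordinate functions of the points. The kernel thus consists of the affine
  functions of the points, restricted to \<open>V\<close>.\<close>

lemma gale_coordinates:
  fixes b :: "'v::finite \<Rightarrow> 'a::euclidean_space"
  assumes "V \<noteq> {}" and b0: "(\<Sum>i\<in>V. b i) = 0" and dim: "dim (b ` V) + (CARD('d::finite) + 1) = card V"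
  obtains p :: "'v \<Rightarrow> real^'d" where
    "\<And>w. (\<Sum>i\<in>V. (w \<bullet> p i) *\<^sub>R b i) = 0"
    "\<And>x i j. x \<in> gale_kernel V b \<Longrightarrow> i \<in> V \<Longrightarrow> j \<in> V \<Longrightarrow> p i = p j \<Longrightarrow> x $ i = x $ j"
    "\<And>a c. \<forall>i\<in>V. a \<bullet> p i = c \<Longrightarrow> a = 0"
proof -
  let ?K = "gale_kernel V b"
  define o1 :: "real^'v" where "o1 = (\<chi> i. if i \<in> V then 1 else 0)"
  have "o1 \<in> ?K"
    using b0 by (simp add: o1_def gale_kernel_def)
  moreover have "o1 \<noteq> 0"
    using \<open>V \<noteq> {}\<close> by (auto simp: o1_def vec_eq_iff)
  ultimately obtain Bs where Bs: "{o1} \<subseteq> Bs" "Bs \<subseteq> ?K" "independent Bs" "?K \<subseteq> span Bs"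
    using maximal_independent_subset_extend[of "{o1}" ?K] by auto
  have finBs: "finite Bs"
    using Bs(3) by (rule independent_imp_finite)
  have "card Bs = dim ?K"
    using Bs by (intro basis_card_eq_dim) auto
  then have cardBs: "card Bs = CARD('d) + 1"
    using dim_gale_kernel[of V b] dim by simp
  have "card (Bs - {o1}) = CARD('d)"
    using cardBs Bs(1) by simp
  then obtain h where h: "bij_betw h (UNIV :: 'd set) (Bs - {o1})"
    using finite_same_card_bij[of "UNIV :: 'd set" "Bs - {o1}"] finBs by auto
  have hK: "h r \<in> ?K" for r
    using h Bs(2) by (auto simp: bij_betw_def)
  define p where "p = (\<lambda>i. (\<chi> r. h r $ i) :: real^'d)"
  have Bs_eq: "Bs = insert o1 (range h)"
    using h Bs(1) by (auto simp: bij_betw_def)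
  have inj: "inj h" and o1: "o1 \<notin> range h"
    using h by (auto simp: bij_betw_def)
  show ?thesis
  proof (rule that[of p])
    show "(\<Sum>i\<in>V. (w \<bullet> p i) *\<^sub>R b i) = 0" for w
    proof -
      have "(\<Sum>i\<in>V. (w \<bullet> p i) *\<^sub>R b i) = (\<Sum>i\<in>V. \<Sum>r\<in>UNIV. w $ r *\<^sub>R h r $ i *\<^sub>R b i)"
        by (simp add: p_def inner_vec_def scaleR_sum_left)
      also have "\<dots> = (\<Sum>r\<in>UNIV. w $ r *\<^sub>R (\<Sum>i\<in>V. h r $ i *\<^sub>R b i))"
        by (subst sum.swap) (simp add: scaleR_sum_right)
      also have "\<dots> = 0"
        using hK by (simp add: gale_kernel_def)
      finally show ?thesis .
    qed
    show "x $ i = x $ j" if "x \<in> ?K" "i \<in> V" "j \<in> V" "p i = p j" for x i j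
    proof -
      have "x \<in> span Bs"
        using Bs(4) that(1) by blast
      moreover have "span Bs \<subseteq> {x. x $ i = x $ j}"
      proof (rule span_minimal)
        show "subspace {x :: real^'v. x $ i = x $ j}"
          by (rule subspaceI) auto
        have "h r $ i = h r $ j" for r
          using arg_cong[OF that(4), of "\<lambda>y. y $ r"] by (simp add: p_def)
        then show "Bs \<subseteq> {x. x $ i = x $ j}"
          using that(2,3) by (auto simp: Bs_eq o1_def)
      qed
      ultimately show ?thesis by blast
    qed
    show "a = 0" if a: "\<forall>i\<in>V. a \<bullet> p i = c" for a c
    proof -
      \<comment> \<open>A hyperplane through all points is a linear relation between the coordinate
        functions and the constant vector \<open>o1\<close>; \<open>f\<close> collects its
        coefficients.\<close>
      define f where "f = (\<lambda>w. if w = o1 then - c else a $ (inv h w))"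
      have "(\<Sum>w\<in>Bs. f w *\<^sub>R w) = f o1 *\<^sub>R o1 + (\<Sum>w\<in>range h. f w *\<^sub>R w)"
        unfolding Bs_eq using o1 by simp
      also have "(\<Sum>w\<in>range h. f w *\<^sub>R w) = (\<Sum>r\<in>UNIV. f (h r) *\<^sub>R h r)"
        using inj by (simp add: sum.reindex)
      also have "\<dots> = (\<Sum>r\<in>UNIV. a $ r *\<^sub>R h r)"
        using o1 inj by (intro sum.cong) (auto simp: f_def)
      finally have eq: "(\<Sum>w\<in>Bs. f w *\<^sub>R w) = (\<Sum>r\<in>UNIV. a $ r *\<^sub>R h r) - c *\<^sub>R o1"
        by (simp add: f_def)
      have "(\<Sum>w\<in>Bs. f w *\<^sub>R w) = 0"
      proof (rule vec_eq_iff[THEN iffD2], rule allI)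
        fix i
        show "(\<Sum>w\<in>Bs. f w *\<^sub>R w) $ i = 0 $ i"
        proof (cases "i \<in> V")
          case True
          then show ?thesis
            using a True by (simp add: eq o1_def p_def inner_vec_def sum_component)
        next
          case False
          then have "h r $ i = 0" for r
            using hK[of r] by (simp add: gale_kernel_def)
          then show ?thesis
            using False by (simp add: eq o1_def sum_component)
        qed
      qed
      then have f0: "f (h r) = 0" for r
        using independentD[OF Bs(3) finBs order_refl, of f "h r"] by (simp add: Bs_eq)
      have "f (h r) = a $ r" for r
        using o1 inj by (auto simp: f_def)
      then show ?thesis
        using f0 by (simp add: vec_eq_iff)
    qed
  qed
qed

lemma representation_super_stable:
  fixes G :: "('v::finite, 'e) multigraph" and b :: "'v \<Rightarrow> 'a::euclidean_space"
  assumes G: "multigraph G" and rep: "stable_representation (verts G) (adjacent G) b"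
    and ne: "verts G \<noteq> {}" and dim: "dim (b ` verts G) + (CARD('d::finite) + 1) = card (verts G)"
  shows "\<exists>(\<sigma> :: 'e \<Rightarrow> sign) (p :: 'v \<Rightarrow> real^'d).
    aff_dim (p ` verts G) = int CARD('d) \<and> inj_on p (verts G) \<and> super_stable G \<sigma> p"
proof -
  let ?V = "verts G" and ?\<omega> = "gram_stress G b"
  have b0: "(\<Sum>i\<in>?V. b i) = 0"
    by (rule stable_representationD(1)[OF rep])
  obtain p :: "'v \<Rightarrow> real^'d" where
    kernel: "\<And>w. (\<Sum>i\<in>?V. (w \<bullet> p i) *\<^sub>R b i) = 0"
    and sep: "\<And>x i j. x \<in> gale_kernel ?V b \<Longrightarrow> i \<in> ?V \<Longrightarrow> j \<in> ?V \<Longrightarrow> p i = p j \<Longrightarrow> x $ i = x $ j"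
    and indep: "\<And>a c. \<forall>i\<in>?V. a \<bullet> p i = c \<Longrightarrow> a = 0"
    by (rule gale_coordinates[OF ne b0 dim]) (rule that; assumption)
  define \<sigma> where "\<sigma> = (\<lambda>e. if 0 < ?\<omega> e then Plus else Minus)"
  have affdim: "aff_dim (p ` ?V) = int CARD('d)"
  proof (rule ccontr)
    assume "aff_dim (p ` ?V) \<noteq> int CARD('d)"
    then have "aff_dim (p ` ?V) < int (DIM(real^'d))"
      using aff_dim_le_DIM[of "p ` ?V"] by simp
    then obtain a c where "a \<noteq> 0" "p ` ?V \<subseteq> {x. a \<bullet> x = c}"
      by (rule aff_lowdim_subset_hyperplane)
    then show False
      using indep[of a c] by auto
  qed
  have hull: "affine hull (p ` ?V) = UNIV"
    using affdim aff_dim_eq_full[of "p ` ?V"] by simp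
  have inj: "inj_on p ?V"
  proof (rule inj_onI, rule ccontr)
    fix i j assume ij: "i \<in> ?V" "j \<in> ?V" "p i = p j" "i \<noteq> j"
    obtain x where "x \<in> gale_kernel ?V b" "x $ i \<noteq> x $ j"
      by (rule gale_kernel_separates[OF ij(1,2,4) stable_representationD(3)[OF rep ij(1,2,4)]])
    then show False
      using sep ij by blast
  qed
  have eq: "equilibrium_stress G p ?\<omega>"
    unfolding equilibrium_stress_def
  proof
    fix i assume i: "i \<in> ?V"
    have "(\<Sum>e\<in>{e \<in> edges G. ends G e = {i, j}}. ?\<omega> e *\<^sub>R (p j - p i)) = - ((b i \<bullet> b j) *\<^sub>R (p j - p i))" if "j \<in> ?V" for j
    proof (cases "i = j")
      case False
      then show ?thesis
        using sum_gram_stress[OF G rep i that] by (simp add: scaleR_sum_left[symmetric])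
    qed simp
    then have "(\<Sum>j\<in>?V. \<Sum>e\<in>{e \<in> edges G. ends G e = {i, j}}. ?\<omega> e *\<^sub>R (p j - p i)) =
        - (\<Sum>j\<in>?V. (b i \<bullet> b j) *\<^sub>R (p j - p i))"
      by (simp add: sum_negf)
    also have "(\<Sum>j\<in>?V. (b i \<bullet> b j) *\<^sub>R (p j - p i)) = 0"
    proof -
      have "w \<bullet> (\<Sum>j\<in>?V. (b i \<bullet> b j) *\<^sub>R (p j - p i)) = 0" for w
      proof -
        have "w \<bullet> (\<Sum>j\<in>?V. (b i \<bullet> b j) *\<^sub>R (p j - p i)) =
            b i \<bullet> (\<Sum>j\<in>?V. (w \<bullet> p j) *\<^sub>R b j) - (w \<bullet> p i) * (b i \<bullet> (\<Sum>j\<in>?V. b j))"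
          by (simp add: inner_sum_right inner_diff_right right_diff_distrib sum_subtractf sum_distrib_left mult_ac)
        then show ?thesis
          by (simp only: kernel b0) simp
      qed
      then show ?thesis
        using inner_eq_zero_iff by blast
    qed
    finally show "(\<Sum>j\<in>?V. \<Sum>e\<in>{e \<in> edges G. ends G e = {i, j}}. ?\<omega> e *\<^sub>R (p j - p i)) = 0"
      by simp
  qed
  have proper: "strictly_proper G \<sigma> ?\<omega>"
    unfolding strictly_proper_def
  proof
    fix e assume e: "e \<in> edges G"
    obtain i j where ij: "ends G e = {i, j}" "i \<noteq> j" "i \<in> ?V" "j \<in> ?V"
      using multigraph_edge[OF G e] by blast
    have "adjacent G i j"
      using e ij by (auto simp: adjacent_def)
    then have "b i \<bullet> b j \<noteq> 0"
      using stable_representationD(2)[OF rep ij(3,4,2)] by simp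
    moreover have "finite {e' \<in> edges G. ends G e' = {i, j}}" "e \<in> {e' \<in> edges G. ends G e' = {i, j}}"
      using G e ij by (auto simp: multigraph_def)
    then have "card {e' \<in> edges G. ends G e' = {i, j}} \<noteq> 0"
      by (metis card_eq_0_iff empty_iff)
    ultimately have "?\<omega> e \<noteq> 0"
      by (simp add: gram_stress_eq[OF ij(1,2)])
    then show "sign_value (\<sigma> e) * ?\<omega> e > 0"
      by (simp add: \<sigma>_def)
  qed
  have entry: "laplacian G ?\<omega> $ i $ j = axis i 1 \<bullet> (laplacian G ?\<omega> *v axis j 1)" for i j
    by (simp add: matrix_vector_mult_basis column_def inner_axis')
  have psd: "positive_semidefinite (laplacian G ?\<omega>)"
    unfolding positive_semidefinite_def
  proof
    show "transpose (laplacian G ?\<omega>) = laplacian G ?\<omega>"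
      unfolding vec_eq_iff transpose_def vec_lambda_beta entry inner_laplacian_gram[OF G rep]
      by (intro allI inner_commute)
    show "\<forall>x. 0 \<le> x \<bullet> (laplacian G ?\<omega> *v x)"
      by (simp add: inner_laplacian_gram[OF G rep])
  qed
  have "laplacian_kernel G ?\<omega> = gale_kernel ?V b"
  proof -
    \<comment> \<open>Testing with \<open>x\<close> gives the squared norm of the sum, testing with
      the image vector the squared norm of the image.\<close>
    have "laplacian G ?\<omega> *v x = 0 \<longleftrightarrow> (\<Sum>i\<in>?V. x $ i *\<^sub>R b i) = 0" for x
      using inner_laplacian_gram[OF G rep, of x x] inner_laplacian_gram[OF G rep, of "laplacian G ?\<omega> *v x" x]
      by auto
    then show ?thesis
      by (auto simp: laplacian_kernel_def gale_kernel_def)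
  qed
  then have dim_kernel: "dim (laplacian_kernel G ?\<omega>) = CARD('d) + 1"
    using dim_gale_kernel[of ?V b] dim by simp
  have conic: "S = 0" if S: "transpose S = S"
      "\<forall>e\<in>edges G. \<forall>i j. ends G e = {i, j} \<longrightarrow> (p j - p i) \<bullet> (S *v (p j - p i)) = 0" for S :: "real^'d^'d"
  proof -
    have S_sym: "x \<bullet> (S *v y) = y \<bullet> (S *v x)" for x y
      using dot_lmul_matrix[of y S x] S(1) by (metis inner_commute transpose_matrix_vector)
    \<comment> \<open>For fixed \<open>i\<close>, the form at \<open>p j - p i\<close> consists of a
      term in \<open>j\<close> alone, a linear function of \<open>p j\<close> and a constant. The
      last two are killed by summation against the \<open>b j\<close>, so the sum is independent of
      \<open>i\<close>, as the Strong Arnold Property requires.\<close>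
    define N :: "real^'v^'v" where
      "N = (\<chi> i j. if i \<in> ?V \<and> j \<in> ?V then (p j - p i) \<bullet> (S *v (p j - p i)) else 0)"
    have "N = 0"
    proof (rule stable_representationD(5)[OF rep])
      have "(p j - p i) \<bullet> (S *v (p j - p i)) = (p i - p j) \<bullet> (S *v (p i - p j))" for i j
        by (simp add: matrix_vector_mult_diff_distrib inner_diff_left inner_diff_right)
      then show "\<forall>i j. N $ i $ j = N $ j $ i"
        by (simp add: N_def)
      show "\<forall>i j. N $ i $ j \<noteq> 0 \<longrightarrow> i \<in> ?V \<and> j \<in> ?V \<and> i \<noteq> j \<and> \<not> adjacent G i j"
        using S(2) by (auto simp: N_def adjacent_def split: if_splits)
      show "\<forall>i\<in>?V. (\<Sum>j\<in>?V. N $ i $ j *\<^sub>R b j) = (\<Sum>j\<in>?V. (p j \<bullet> (S *v p j)) *\<^sub>R b j)"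
      proof
        fix i assume i: "i \<in> ?V"
        have "N $ i $ j = p j \<bullet> (S *v p j) - 2 * ((S *v p i) \<bullet> p j) + p i \<bullet> (S *v p i)" if "j \<in> ?V" for j
          using i that S_sym[of "p i" "p j"]
          by (simp add: N_def matrix_vector_mult_diff_distrib inner_diff_left inner_diff_right inner_commute)
        then have "(\<Sum>j\<in>?V. N $ i $ j *\<^sub>R b j) = (\<Sum>j\<in>?V. (p j \<bullet> (S *v p j)) *\<^sub>R b j)
            - 2 *\<^sub>R (\<Sum>j\<in>?V. ((S *v p i) \<bullet> p j) *\<^sub>R b j) + (p i \<bullet> (S *v p i)) *\<^sub>R (\<Sum>j\<in>?V. b j)"
          by (simp add: scaleR_left_distrib scaleR_left_diff_distrib sum.distrib sum_subtractf scaleR_sum_right)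
        then show "(\<Sum>j\<in>?V. N $ i $ j *\<^sub>R b j) = (\<Sum>j\<in>?V. (p j \<bullet> (S *v p j)) *\<^sub>R b j)"
          by (simp only: kernel b0) simp
      qed
    qed
    then have zero: "(p j - p i) \<bullet> (S *v (p j - p i)) = 0" if "i \<in> ?V" "j \<in> ?V" for i j
      using that by (auto simp: N_def vec_eq_iff split: if_splits)
    \<comment> \<open>The form now vanishes on the differences of all pairs, not just along edges.
      Polarization makes products of differences vanish; as no hyperplane contains the points, first
      \<open>S\<close> is constant on them and then, by symmetry, \<open>S\<close> is 0.\<close>
    obtain i0 where i0: "i0 \<in> ?V"
      using ne by blast
    have "S *v (p k - p i0) = 0" if k: "k \<in> ?V" for k
    proof (rule indep, rule ballI)
      fix j assume j: "j \<in> ?V"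
      have "(p j - p k) \<bullet> (S *v (p j - p k)) = (p j - p i0) \<bullet> (S *v (p j - p i0)) + (p k - p i0) \<bullet> (S *v (p k - p i0))
          - 2 * ((p j - p i0) \<bullet> (S *v (p k - p i0)))"
        using S_sym[of "p j" "p k"] S_sym[of "p j" "p i0"] S_sym[of "p k" "p i0"]
        by (simp add: matrix_vector_mult_diff_distrib inner_diff_left inner_diff_right)
      then have "(p j - p i0) \<bullet> (S *v (p k - p i0)) = 0"
        using zero[OF i0 j] zero[OF i0 k] zero[OF k j] by simp
      then show "(S *v (p k - p i0)) \<bullet> p j = (S *v (p k - p i0)) \<bullet> p i0"
        by (simp add: inner_diff_left inner_commute)
    qed
    then have Sp: "S *v p k = S *v p i0" if "k \<in> ?V" for k
      using that by (simp add: matrix_vector_mult_diff_distrib)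
    have "S *v w = 0" for w
    proof (rule indep, rule ballI)
      fix k assume "k \<in> ?V"
      then show "(S *v w) \<bullet> p k = w \<bullet> (S *v p i0)"
        using S_sym[of "p k" w] Sp by (simp add: inner_commute)
    qed
    then show "S = 0"
      by (simp add: matrix_eq)
  qed
  have "super_stable G \<sigma> p"
    unfolding super_stable_def using hull eq proper psd dim_kernel conic by blast
  then show ?thesis
    using affdim inj by blast
qed

section \<open>Two-connected multigraphs and the conclusion\<close>

lemma connected_on_mono:
  assumes "connected_on A S" "\<And>x y. A x y \<Longrightarrow> A' x y"
  shows "connected_on A' S"
  using assms unfolding connected_on_def by meson

lemma connected_multigraph_connected_on:
  assumes "connected_multigraph G" "\<And>e. e \<in> edges G \<Longrightarrow> ends G e \<subseteq> verts G"
  shows "connected_on (adjacent G) (verts G)"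
proof (rule connected_on_rtrancl)
  show "(x, y) \<in> {(x, y). adjacent G x y}\<^sup>*" if "x \<in> verts G" "y \<in> verts G" for x y
    using assms(1) that by (simp add: connected_multigraph_def adjacent_def)
  show "y \<in> verts G" if "x \<in> verts G" "adjacent G x y" for x y
    using that(2) assms(2) by (auto simp: adjacent_def)
qed

theorem theorem1p2:
  fixes G :: "('v::finite, 'e) multigraph"
  assumes "multigraph G"
    and "two_connected G"
    and "has_minor G (complete_graph (CARD('d::finite) + 2))"
  shows "\<exists>(\<sigma> :: 'e \<Rightarrow> sign) (p :: 'v \<Rightarrow> real^'d).
    aff_dim (p ` verts G) = int CARD('d) \<and> inj_on p (verts G) \<and> super_stable G \<sigma> p"
proof -
  let ?V = "verts G" and ?A = "adjacent G"
  have ends: "ends G e \<subseteq> ?V" if "e \<in> edges G" for e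
    using assms(1) that by (auto simp: multigraph_def)
  have conn: "connected_on ?A ?V"
    using assms(2) ends by (intro connected_multigraph_connected_on) (auto simp: two_connected_def)
  have conn': "connected_on ?A (?V - {x})" if "x \<in> ?V" for x
  proof -
    have "connected_on (adjacent (delete_vertex G x)) (verts (delete_vertex G x))"
      using assms(2) that ends
      by (intro connected_multigraph_connected_on) (auto simp: two_connected_def delete_vertex_def)
    then have "connected_on (adjacent (delete_vertex G x)) (?V - {x})"
      by (simp add: delete_vertex_def)
    then show ?thesis
    proof (rule connected_on_mono)
      show "?A y z" if "adjacent (delete_vertex G x) y z" for y z
        using that unfolding adjacent_def delete_vertex_def by auto
    qed
  qed
  obtain f where f: "clique_partition ?V ?A (CARD('d) + 2) f"
    using complete_minor_partition[OF assms(1) conn assms(3)] by auto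
  \<comment> \<open>The ambient space of the vectors is arbitrary as long as it is large enough;
    \<open>real^'v\<close> always is.\<close>
  have card: "card ?V \<le> DIM(real^'v)"
    using card_mono[of UNIV ?V] by simp
  have "\<exists>b :: 'v \<Rightarrow> real^'v. stable_representation ?V ?A b \<and> dim (b ` ?V) = card ?V - (CARD('d) + 1)"
    by (rule representation_exists[OF adjacent_sym conn' f _ card]) (simp_all add: Suc_le_eq)
  then obtain b :: "'v \<Rightarrow> real^'v" where b: "stable_representation ?V ?A b" "dim (b ` ?V) = card ?V - (CARD('d) + 1)"
    by blast
  have "f ` ?V = {..<CARD('d) + 2}"
    using f by (simp add: clique_partition_def)
  then have "CARD('d) + 2 \<le> card ?V"
    using card_image_le[of ?V f] by simp
  then show ?thesis
    using b by (intro representation_super_stable[OF assms(1) b(1)]) auto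
qed

end
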